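(* Let $m\ge 1$ be an integer and $2\le p\le\infty$. For every finite-dimensional complex Hilbert space $\mathcal H$ (of arbitrary dimension) and all $A_1,\dots,A_m\in\mathcal B(\mathcal H)$, $$\|A_1+\cdots+A_m\|_p\le C_{p,m}\,\bigl\||A_1|+\cdots+|A_m|\bigr\|_p .$$ Here, for $2\le p<\infty$, $$C_{p,m}=\frac{\sqrt{x_{p,m}(x_{p,m}+m-1)}}{(x_{p,m}^p+m-1)^{1/p}},$$ where $x_{p,m}$ is the unique solution in $(1,\infty)$ of $x^p=2x+m-1$, and $C_{\infty,m}=\sqrt m$. Moreover, for each such $p$ and $m$ the constant $C_{p,m}$ is optimal over all finite-dimensional $\mathcal H$: if $C$ is a real constant such that $\|A_1+\cdots+A_m\|_p\le C\,\||A_1|+\cdots+|A_m|\|_p$ for every finite-dimensional $\mathcal H$ and all $A_1,\dots,A_m\in\mathcal B(\mathcal H)$, then $C\ge C_{p,m}$.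
   Context: $\mathcal B(\mathcal H)$ is the space of linear operators on $\mathcal H$ (equivalently $d\times d$ complex matrices with $d=\dim\mathcal H$). For $A\in\mathcal B(\mathcal H)$, $|A|=(A^*A)^{1/2}$. For $1\le p<\infty$, $\|A\|_p=(\operatorname{Tr}|A|^p)^{1/p}$ is the Schatten $p$-norm, and $\|A\|_\infty$ is the operator norm. *)

theory Defs
  imports "Jordan_Normal_Form.Schur_Decomposition" "HOL-Library.Extended_Real"
begin

text \<open>
  Operators on a Hilbert space of dimension \<open>d\<close> are complex matrices in \<open>carrier_mat d d\<close>, so that
  the dimension can be quantified over inside a formula. The adjoint is \<^const>\<open>mat_adjoint\<close>.
\<close>

definition unitary_mat :: "nat \<Rightarrow> complex mat \<Rightarrow> bool" where
  "unitary_mat n U \<longleftrightarrow> U \<in> carrier_mat n n \<and> mat_adjoint U * U = 1\<^sub>m n"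

text \<open>
  The power \<open>P\<^sup>r\<close>, for real \<open>r > 0\<close>, of a positive semidefinite matrix \<open>P\<close> in the sense of
  functional calculus: if \<open>P = U diag(l) U\<^sup>*\<close> with \<open>U\<close> unitary and \<open>l \<ge> 0\<close>, then
  \<open>P\<^sup>r = U diag(l\<^sup>r) U\<^sup>*\<close>. The result does not depend on the diagonalization, which exists by the
  spectral theorem; for matrices that are not positive semidefinite the value is unspecified.
  Recall \<open>0 powr r = 0\<close>, as it should be for \<open>r > 0\<close>.
\<close>
definition psd_powr :: "complex mat \<Rightarrow> real \<Rightarrow> complex mat" where
  "psd_powr P r = (THE B. \<exists>U l. unitary_mat (dim_row P) U \<and> (\<forall>i<dim_row P. 0 \<le> l i) \<and>
      P = U * mat_diag (dim_row P) (\<lambda>i. complex_of_real (l i)) * mat_adjoint U \<and>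
      B = U * mat_diag (dim_row P) (\<lambda>i. complex_of_real (l i powr r)) * mat_adjoint U)"

definition mat_abs :: "complex mat \<Rightarrow> complex mat" where
  "mat_abs A = psd_powr (mat_adjoint A * A) (1/2)"

definition mat_trace :: "complex mat \<Rightarrow> complex" where
  "mat_trace A = (\<Sum>i<dim_row A. A $$ (i,i))"

definition vec_norm :: "complex vec \<Rightarrow> real" where
  "vec_norm v = sqrt (Re (v \<bullet>c v))"

text \<open>The condition is \<open>\<le> 1\<close> rather than \<open>= 1\<close> so that the set is nonempty in dimension 0.\<close>
definition op_norm :: "complex mat \<Rightarrow> real" where
  "op_norm A = (SUP v\<in>{v \<in> carrier_vec (dim_col A). vec_norm v \<le> 1}. vec_norm (A *\<^sub>v v))"

text \<open>Meant for \<open>1 \<le> p \<le> \<infinity>\<close>. The trace of \<open>|A|\<^sup>p\<close> is a nonnegative real number, hence \<^const>\<open>Re\<close>.\<close>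
definition schatten_norm :: "ereal \<Rightarrow> complex mat \<Rightarrow> real" where
  "schatten_norm p A = (if p = \<infinity> then op_norm A
     else Re (mat_trace (psd_powr (mat_abs A) (real_of_ereal p))) powr (1 / real_of_ereal p))"

abbreviation mat_sum :: "nat \<Rightarrow> nat \<Rightarrow> (nat \<Rightarrow> complex mat) \<Rightarrow> complex mat" where
  "mat_sum d m A \<equiv> finsum (module_mat TYPE(complex) d d) A {1..m}"

definition x_sol :: "real \<Rightarrow> nat \<Rightarrow> real" where
  "x_sol p m = (THE x. 1 < x \<and> x powr p = 2 * x + real m - 1)"

definition C_const :: "ereal \<Rightarrow> nat \<Rightarrow> real" where
  "C_const p m = (if p = \<infinity> then sqrt (real m)
     else let q = real_of_ereal p; x = x_sol q m
          in sqrt (x * (x + real m - 1)) / (x powr q + real m - 1) powr (1 / q))"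

end

theory Submission
  imports Defs
begin

text \<open>
  For \<open>p = \<infinity>\<close> the bound is Cauchy--Schwarz. For finite \<open>p\<close> write \<open>A\<^sub>i\<close> in its singular value
  decomposition, with singular values \<open>\<lambda>\<^sub>a\<close> indexed by pairs \<open>a = (i, k)\<close>. This factors the sum as
  \<open>T = X\<^sup>* Y\<close> with \<open>Y\<^sup>* Y = S = \<Sum>\<^sub>i |A\<^sub>i|\<close>, such that the Gram matrices \<open>H = Y Y\<^sup>*\<close> and \<open>G = X X\<^sup>*\<close> have
  the same diagonal \<open>\<lambda>\<close>. With \<open>n = m - 1\<close> and \<open>G' = G / (x + n)\<close> the key inequality, for any two positive
  semidefinite matrices, is
  \<open>Tr H\<^sup>p + m Tr G'\<^sup>p - Tr (H - (x - 1) G')\<^sub>+\<^sup>p \<ge> \<kappa> Tr (H\<^sup>1\<^sup>/\<^sup>2 G' H\<^sup>1\<^sup>/\<^sup>2)\<^sup>p\<^sup>/\<^sup>2\<close>, \<open>\<kappa> = 2 (x + n) / x\<^sup>p\<^sup>/\<^sup>2\<close>.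
  It reduces to the case of scalars: differentiate \<open>Tr (H - s G')\<^sub>+\<^sup>p\<close> in \<open>s\<close> and apply Jensen's inequality
  to the vectors \<open>X f\<^sub>j\<close>, where \<open>f\<^sub>j\<close> are the eigenvectors of \<open>T T\<^sup>*\<close>. Finally \<open>H - (x - 1) G'\<close> has the diagonal
  \<open>m \<lambda> / (x + n)\<close>, so that \<open>Tr (H - (x - 1) G')\<^sub>+\<^sup>p \<ge> (m / (x + n))\<^sup>p \<Sum>\<^sub>a \<lambda>\<^sub>a\<^sup>p \<ge> m Tr G'\<^sup>p\<close>.
\<close>

section \<open>Powers of the positive part and a scalar inequality\<close>

text \<open>For \<open>n > 0\<close> the equation for \<open>x\<close> is the stationarity condition
  in \<open>y\<close> of \<open>sqrt (y (y + n)) / (y^p + n)^(1/p)\<close>, the ratio attained by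
  certain matrices for which \<open>S\<close> has the eigenvalues \<open>y, 1, ..., 1\<close>. For
  \<open>y = x\<close> and apart from zero singular values, they give \<open>G' = P\<close>, the
  projection onto the constant vector, and \<open>H = x P + (1 - P)\<close>, so that
  \<open>H - (x - 1) G'\<close> is the identity. This dictates both the normalization of
  \<open>G'\<close> and the shift \<open>x - 1\<close>, and it is why the diagonal bound loses
  nothing. The obstacle is that \<open>H\<close> and \<open>G'\<close> need not commute, so the
  scalar inequality cannot be summed over a common eigenbasis. It is applied to the mean values of
  \<open>H\<close> and \<open>G'\<close> in the vectors \<open>X f_j\<close> instead: the quadratic
  form of \<open>H\<close> at \<open>X f_j\<close> is the squared norm of \<open>T^* f_j\<close>, an
  eigenvalue of \<open>T T^*\<close>. Convexity always enters through subgradients, and finite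
  differences replace the derivative in \<open>s\<close>, because the eigenvalues of
  \<open>H - s G'\<close> need not be smooth in \<open>s\<close>.\<close>

lemma bernoulli_powr:
  fixes z q :: real
  assumes "0 < z" "1 \<le> q"
  shows "1 + q * (z - 1) \<le> z powr q"
proof -
  have "1 - 1 / z \<le> ln z"
    using ln_le_minus_one[of "1 / z"] assms by (simp add: ln_div)
  then have "1 + (q - 1) * (1 - 1 / z) \<le> 1 + (q - 1) * ln z"
    using assms by (simp add: mult_left_mono)
  also have "\<dots> \<le> z powr (q - 1)"
    using exp_ge_add_one_self[of "(q - 1) * ln z"] assms by (simp add: powr_def)
  finally have "z * (1 + (q - 1) * (1 - 1 / z)) \<le> z * z powr (q - 1)"
    using assms by (simp add: mult_left_mono)
  also have "z * z powr (q - 1) = z powr q"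
    using assms powr_mult_base[of z "q - 1"] by simp
  also have "z * (1 + (q - 1) * (1 - 1 / z)) = 1 + q * (z - 1)"
    using assms by (simp add: field_simps)
  finally show ?thesis .
qed

text \<open>Differences such as \<open>H - s G'\<close> may have negative eigenvalues. Continuing
  \<open>t^q\<close> by zero gives, for \<open>q \<ge> 1\<close>, a function that is convex on the
  whole line, so the trace inequalities need no sign conditions on the spectrum.\<close>

definition pos_powr :: "real \<Rightarrow> real \<Rightarrow> real" where
  "pos_powr q t = max t 0 powr q"

lemma pos_powr_nonneg [simp]: "0 \<le> pos_powr q t"
  by (simp add: pos_powr_def)

lemma pos_powr_of_nonneg: "0 \<le> t \<Longrightarrow> pos_powr q t = t powr q"
  by (simp add: pos_powr_def)

lemma pos_powr_nonpos [simp]: "t \<le> 0 \<Longrightarrow> pos_powr q t = 0"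
  by (simp add: pos_powr_def max_def)

lemma pos_powr_mult: "0 \<le> c \<Longrightarrow> pos_powr q (c * t) = c powr q * pos_powr q t"
  unfolding pos_powr_def by (subst powr_mult[symmetric]) (auto simp: max_mult_distrib_left)

text \<open>At \<open>q = 1\<close>, \<open>x = 0\<close> this uses \<open>0 powr 0 = 0\<close>, which is a subgradient of the positive part.\<close>

lemma pos_powr_subgradient:
  fixes x y q :: real
  assumes "1 \<le> q"
  shows "pos_powr q x + q * pos_powr (q - 1) x * (y - x) \<le> pos_powr q y"
proof (cases "x \<le> 0")
  case False
  then have x: "0 < x" by simp
  have e: "x * x powr (q - 1) = x powr q"
    using x powr_mult_base[of x "q - 1"] by simp
  show ?thesis
  proof (cases "y \<le> 0")
    case True
    have "x powr q \<le> q * x powr q" using assms mult_right_mono[of 1 q "x powr q"] by simp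
    moreover have "q * x powr (q - 1) * y \<le> 0"
      using True assms by (simp add: mult_nonneg_nonpos)
    moreover have "x powr q + q * x powr (q - 1) * (y - x) = x powr q - q * x powr q + q * x powr (q - 1) * y"
      by (simp add: e[symmetric] algebra_simps)
    ultimately have "x powr q + q * x powr (q - 1) * (y - x) \<le> 0" by linarith
    then show ?thesis using x True by (simp add: pos_powr_def)
  next
    case False
    have "x powr q * (1 + q * (y / x - 1)) \<le> x powr q * (y / x) powr q"
      using bernoulli_powr[of "y / x" q] x False assms by (intro mult_left_mono) auto
    also have "\<dots> = y powr q" using x False by (simp add: powr_divide)
    also have "x powr q * (1 + q * (y / x - 1)) = x powr q + q * x powr (q - 1) * (y - x)"
      using x by (simp add: e[symmetric] field_simps)
    finally show ?thesis using x False by (simp add: pos_powr_def)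
  qed
qed simp

lemma powr_power2: "(x::real) powr r * x powr r = x powr (2 * r)"
  by (simp add: powr_add [symmetric])

text \<open>Gives the sign of the derivative of the auxiliary function \<open>\<chi>\<close> below.
  It is AM-GM for \<open>1\<close> and \<open>\<theta>^(2r-1)\<close> with weights proportional to
  \<open>r\<close> and \<open>r - 1\<close>, which produces \<open>\<theta>^(r-1)\<close>; for
  \<open>\<theta> \<le> 1\<close> the power \<open>\<theta>^(2r-2)\<close> is smaller still.\<close>

lemma weighted_am_gm_powr:
  fixes r \<theta> :: real
  assumes "1 \<le> r" "0 < \<theta>" "\<theta> \<le> 1"
  shows "(2 * r - 1) * \<theta> powr (2 * r - 2) \<le> r + (r - 1) * \<theta> powr (2 * r - 1)"
proof (cases "r = 1")
  case False
  then have r: "1 < r" using assms by simp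
  have q: "1 \<le> (2 * r - 1) / (r - 1)" using r by (simp add: field_simps)
  have "1 + (2 * r - 1) / (r - 1) * (\<theta> powr (r - 1) - 1) \<le> (\<theta> powr (r - 1)) powr ((2 * r - 1) / (r - 1))"
    using bernoulli_powr[OF _ q] assms by simp
  also have "\<dots> = \<theta> powr (2 * r - 1)" using r by (simp add: powr_powr)
  finally have "(2 * r - 1) * \<theta> powr (r - 1) \<le> r + (r - 1) * \<theta> powr (2 * r - 1)"
    using r by (simp add: field_simps)
  moreover have "\<theta> powr (2 * r - 2) \<le> \<theta> powr (r - 1)"
    using assms r by (intro powr_mono') auto
  ultimately show ?thesis using r mult_left_mono[of "\<theta> powr (2 * r - 2)" "\<theta> powr (r - 1)" "2 * r - 1"] by linarith
qed (use assms in auto)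

text \<open>The constant is \<open>\<kappa> = 2 (x + n) / x\<^sup>r\<close> with \<open>r = p / 2\<close>; equality holds at \<open>h = x\<close>.\<close>

lemma scalar_inequality_normalized:
  fixes r x n h :: real
  assumes r: "1 \<le> r" and x: "1 < x" and n: "0 \<le> n" and eq: "x powr (2 * r) = 2 * x + n"
    and h: "0 \<le> h"
  shows "2 * (x + n) / x powr r * h powr r \<le> h powr (2 * r) + (n + 1) - pos_powr (2 * r) (h - (x - 1))"
proof -
  define \<kappa> where "\<kappa> = 2 * (x + n) / x powr r"
  have xr: "0 < x powr r" using x by simp
  have xx: "x powr r * x powr r = 2 * x + n" using eq by (simp add: powr_power2)
  show ?thesis
  proof (cases "h \<le> x - 1")
    \<comment> \<open>Here the positive part vanishes, and the claim is a quadratic inequality in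
      \<open>h powr r\<close> whose discriminant \<open>\<kappa>^2 - 4 (n + 1)\<close> has to be at
      most zero. This amounts to \<open>x^2 \<le> 2 x + n\<close>, which holds because
      \<open>2 r \<ge> 2\<close>.\<close>
    case True
    have "x\<^sup>2 = x powr 2" using x by simp
    also have "\<dots> \<le> 2 * x + n" using x r eq powr_mono[of 2 "2 * r" x] by simp
    finally have "(x + n)\<^sup>2 \<le> (2 * x + n) * (n + 1)"
      by (simp add: power2_eq_square algebra_simps)
    then have "\<kappa>\<^sup>2 \<le> 4 * (n + 1)"
      using x n unfolding \<kappa>_def power_divide power_mult_distrib power2_eq_square[of "x powr r"] xx
      by (simp add: divide_le_eq algebra_simps)
    moreover have "0 \<le> (h powr r - \<kappa> / 2)\<^sup>2" by simp
    ultimately have "\<kappa> * h powr r \<le> h powr r * h powr r + (n + 1)"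
      by (simp add: power2_eq_square algebra_simps)
    with True show ?thesis by (simp add: powr_power2 \<kappa>_def)
  next
    case False
    define Y where "Y = x - 1"
    have Y: "0 < Y" "Y < h" "Y < x" using x False by (auto simp: Y_def)
    \<comment> \<open>\<open>\<phi>\<close> is the right side minus the left side, and its
      derivative is \<open>2 r u^(r-1) (\<chi> u - \<kappa> / 2)\<close>. As \<open>\<chi>\<close>
      is nondecreasing and equals \<open>\<kappa> / 2\<close> at \<open>x\<close>, the minimum of
      \<open>\<phi>\<close> beyond \<open>Y\<close> is its value \<open>0\<close> at
      \<open>x\<close>.\<close>
    define \<chi> where "\<chi> t = t powr r - (t - Y) powr (2 * r - 1) * t powr (1 - r)" for t
    define \<phi> where "\<phi> t = t powr (2 * r) + (n + 1) - (t - Y) powr (2 * r) - \<kappa> * t powr r" for t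
    have \<chi>_mono: "\<chi> s \<le> \<chi> t" if "Y < s" "s \<le> t" for s t
    proof (rule DERIV_nonneg_imp_nondecreasing[OF that(2)])
      fix u assume u: "s \<le> u" "u \<le> t"
      then have u0: "0 < u" "Y < u" using that Y by auto
      define \<theta> where "\<theta> = (u - Y) / u"
      have \<theta>: "0 < \<theta>" "\<theta> \<le> 1" and uY: "u - Y = \<theta> * u" using u0 Y by (auto simp: \<theta>_def)
      let ?D = "r * u powr (r - 1) - ((2 * r - 1) * (u - Y) powr (2 * r - 1 - 1) * u powr (1 - r) +
                 (u - Y) powr (2 * r - 1) * ((1 - r) * u powr (1 - r - 1)))"
      have "(\<chi> has_real_derivative ?D) (at u)"
        unfolding \<chi>_def using u0 by (auto intro!: derivative_eq_intros simp: algebra_simps)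
      moreover have "?D = u powr (r - 1) * (r - (2 * r - 1) * \<theta> powr (2 * r - 2) + (r - 1) * \<theta> powr (2 * r - 1))"
      proof -
        have "(u - Y) powr (2 * r - 1 - 1) * u powr (1 - r) = \<theta> powr (2 * r - 2) * u powr (r - 1)"
          unfolding uY using u0 \<theta> by (simp add: powr_mult powr_add[symmetric] mult.assoc)
        moreover have "(u - Y) powr (2 * r - 1) * u powr (1 - r - 1) = \<theta> powr (2 * r - 1) * u powr (r - 1)"
          unfolding uY using u0 \<theta> by (simp add: powr_mult powr_add[symmetric] mult.assoc)
        ultimately show ?thesis by (simp add: algebra_simps)
      qed
      moreover have "0 \<le> r - (2 * r - 1) * \<theta> powr (2 * r - 2) + (r - 1) * \<theta> powr (2 * r - 1)"
        using weighted_am_gm_powr[OF r \<theta>] by linarith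
      ultimately show "\<exists>y. DERIV \<chi> u :> y \<and> 0 \<le> y"
        by (intro exI[of _ ?D]) simp
    qed
    have "x powr r = (2 * x + n) / x powr r" using xr xx by (simp add: field_simps)
    moreover have "x powr (1 - r) = x / x powr r" using x by (simp add: powr_diff)
    ultimately have "\<chi> x = (2 * x + n) / x powr r - x / x powr r"
      unfolding \<chi>_def Y_def by simp
    then have \<chi>x: "\<chi> x = \<kappa> / 2"
      unfolding \<kappa>_def using xr by (simp add: field_simps)
    have \<phi>': "(\<phi> has_real_derivative (2 * r * u powr (r - 1) * (\<chi> u - \<kappa> / 2))) (at u)" if "Y < u" for u
    proof -
      have "(\<phi> has_real_derivative (2 * r * u powr (2 * r - 1) - 2 * r * (u - Y) powr (2 * r - 1) - \<kappa> * (r * u powr (r - 1)))) (at u)"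
        unfolding \<phi>_def using that Y by (auto intro!: derivative_eq_intros simp: algebra_simps)
      moreover have "u powr (2 * r - 1) = u powr (r - 1) * u powr r"
        using that Y by (simp add: powr_add[symmetric])
      moreover have "u powr (r - 1) * (w * u powr (1 - r)) = w" for w
        using that Y by (simp add: powr_add[symmetric] mult.left_commute)
      ultimately show ?thesis
        unfolding \<chi>_def by (simp only: right_diff_distrib mult.assoc) (simp add: algebra_simps)
    qed
    have "x powr (2 * r) = 2 * x + n" "x - Y = 1" "\<kappa> * x powr r = 2 * (x + n)"
      using eq xr by (simp_all add: Y_def \<kappa>_def)
    then have \<phi>x: "\<phi> x = 0" by (simp add: \<phi>_def)
    have "0 \<le> \<phi> h"
    proof (cases "x \<le> h")
      case True
      have "\<phi> x \<le> \<phi> h"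
      proof (rule DERIV_nonneg_imp_nondecreasing[OF True])
        fix u assume "x \<le> u" "u \<le> h"
        then show "\<exists>y. DERIV \<phi> u :> y \<and> 0 \<le> y"
          using \<phi>'[of u] \<chi>_mono[of x u] \<chi>x Y r by (intro exI conjI) (auto intro!: mult_nonneg_nonneg)
      qed
      with \<phi>x show ?thesis by simp
    next
      case False
      have "\<phi> x \<le> \<phi> h"
      proof (rule DERIV_nonpos_imp_nonincreasing[of h x])
        fix u assume "h \<le> u" "u \<le> x"
        then show "\<exists>y. DERIV \<phi> u :> y \<and> y \<le> 0"
          using \<phi>'[of u] \<chi>_mono[of u x] \<chi>x Y r by (intro exI conjI) (auto intro!: mult_nonneg_nonpos)
      qed (use False in simp)
      with \<phi>x show ?thesis by simp
    qed
    then show ?thesis using Y False by (simp add: \<phi>_def \<kappa>_def Y_def pos_powr_def)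
  qed
qed

text \<open>Both sides are homogeneous of degree \<open>2 r\<close> in \<open>(h, g)\<close>, so
  only the quotient \<open>h / g\<close> matters.\<close>

lemma scalar_inequality:
  fixes r x n h g :: real
  assumes r: "1 \<le> r" and x: "1 < x" and n: "0 \<le> n" and eq: "x powr (2 * r) = 2 * x + n"
    and h: "0 \<le> h" and g: "0 < g"
  shows "2 * (x + n) / x powr r * (h powr r * g powr r) \<le>
    h powr (2 * r) + (n + 1) * g powr (2 * r) - pos_powr (2 * r) (h - (x - 1) * g)"
proof -
  have h': "h = g * (h / g)" and d: "h - (x - 1) * g = g * (h / g - (x - 1))"
    using g by (auto simp: field_simps)
  have "g powr (2 * r) * (2 * (x + n) / x powr r * (h / g) powr r) \<le>
     g powr (2 * r) * ((h / g) powr (2 * r) + (n + 1) - pos_powr (2 * r) (h / g - (x - 1)))"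
    using scalar_inequality_normalized[OF r x n eq, of "h / g"] h g by (intro mult_left_mono) auto
  moreover have "g powr (2 * r) * (h / g) powr (2 * r) = h powr (2 * r)"
    "g powr (2 * r) * (h / g) powr r = h powr r * g powr r"
    using h g by (simp_all add: powr_divide powr_power2[symmetric])
  moreover have "g powr (2 * r) * pos_powr (2 * r) (h / g - (x - 1)) = pos_powr (2 * r) (h - (x - 1) * g)"
    unfolding d using g by (simp add: pos_powr_mult)
  ultimately show ?thesis by (simp add: algebra_simps)
qed

lemma ex1_x_sol:
  fixes p n :: real
  assumes p: "2 \<le> p" and n: "0 \<le> n"
  shows "\<exists>!x. 1 < x \<and> x powr p = 2 * x + n"
proof (rule ex_ex1I)
  let ?g = "\<lambda>x::real. x powr p - 2 * x - n"
  have "?g 1 \<le> 0" using n by simp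
  \<comment> \<open>At \<open>n + 3\<close> the square already dominates the linear side, and a
    larger exponent only helps since the base exceeds 1.\<close>
  moreover have "0 \<le> ?g (n + 3)"
  proof -
    have "2 * (n + 3) + n \<le> (n + 3) * (n + 3)" using n by (simp add: algebra_simps)
    also have "\<dots> = (n + 3) powr 2" using n by (simp add: power2_eq_square)
    also have "\<dots> \<le> (n + 3) powr p" using p n by (intro powr_mono) auto
    finally show ?thesis by simp
  qed
  moreover have "\<forall>x. 1 \<le> x \<and> x \<le> n + 3 \<longrightarrow> isCont ?g x"
    by (intro allI impI continuous_intros) auto
  ultimately obtain x where x: "1 \<le> x" "?g x = 0"
    using IVT[of ?g 1 0 "n + 3"] n by auto
  moreover have "x \<noteq> 1" using x n by auto
  ultimately show "\<exists>x. 1 < x \<and> x powr p = 2 * x + n" by (intro exI[of _ x]) auto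
next
  \<comment> \<open>A convex function that is negative at 1 has at most one zero beyond 1.\<close>
  have less: False if a: "1 < a" "a < b" "a powr p = 2 * a + n" "b powr p = 2 * b + n" for a b :: real
  proof -
    let ?s = "p * pos_powr (p - 1) a - 2"
    have 1: "a powr p + p * pos_powr (p - 1) a * (1 - a) \<le> 1"
      using pos_powr_subgradient[of p a 1] p a by (simp add: pos_powr_of_nonneg)
    have 2: "a powr p + p * pos_powr (p - 1) a * (b - a) \<le> b powr p"
      using pos_powr_subgradient[of p a b] p a by (simp add: pos_powr_of_nonneg)
    have "?s * (1 - a) \<le> - 1 - n" using 1 a by (simp add: algebra_simps)
    then have "0 < ?s * (a - 1)" using n by (simp add: algebra_simps)
    then have "0 < ?s" using a by (simp add: zero_less_mult_iff)
    then have "0 < ?s * (b - a)" using a by simp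
    then show False using 2 a by (simp add: algebra_simps)
  qed
  show "x = y" if "1 < x \<and> x powr p = 2 * x + n" "1 < y \<and> y powr p = 2 * y + n" for x y
    using less[of x y] less[of y x] that by (cases x y rule: linorder_cases) auto
qed

section \<open>Vectors and matrices over finite index sets\<close>

text \<open>
  Vectors and matrices are functions on arbitrary index types, of which only the values on a finite index
  set matter. This allows block indices \<open>(i, k)\<close> without flattening them to natural numbers.
\<close>

definition cinner :: "'a set \<Rightarrow> ('a \<Rightarrow> complex) \<Rightarrow> ('a \<Rightarrow> complex) \<Rightarrow> complex" where
  "cinner I v w = (\<Sum>a\<in>I. v a * cnj (w a))"

definition sqnorm :: "'a set \<Rightarrow> ('a \<Rightarrow> complex) \<Rightarrow> real" where
  "sqnorm I v = (\<Sum>a\<in>I. (cmod (v a))\<^sup>2)"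

definition matvec :: "'b set \<Rightarrow> ('a \<Rightarrow> 'b \<Rightarrow> complex) \<Rightarrow> ('b \<Rightarrow> complex) \<Rightarrow> 'a \<Rightarrow> complex" where
  "matvec K M v a = (\<Sum>c\<in>K. M a c * v c)"

definition adjoint :: "('a \<Rightarrow> 'b \<Rightarrow> complex) \<Rightarrow> 'b \<Rightarrow> 'a \<Rightarrow> complex" where
  "adjoint M c a = cnj (M a c)"

definition matmul :: "'b set \<Rightarrow> ('a \<Rightarrow> 'b \<Rightarrow> complex) \<Rightarrow> ('b \<Rightarrow> 'c \<Rightarrow> complex) \<Rightarrow> 'a \<Rightarrow> 'c \<Rightarrow> complex" where
  "matmul K M N a d = (\<Sum>c\<in>K. M a c * N c d)"

definition quadform :: "'a set \<Rightarrow> ('a \<Rightarrow> 'a \<Rightarrow> complex) \<Rightarrow> ('a \<Rightarrow> complex) \<Rightarrow> real" where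
  "quadform I M v = Re (cinner I (matvec I M v) v)"

definition orthonormal :: "'a set \<Rightarrow> 'b set \<Rightarrow> ('b \<Rightarrow> 'a \<Rightarrow> complex) \<Rightarrow> bool" where
  "orthonormal I J e \<longleftrightarrow> (\<forall>i\<in>J. \<forall>j\<in>J. cinner I (e i) (e j) = (if i = j then 1 else 0))"

text \<open>With \<open>U\<close> the matrix whose columns are the \<open>e k\<close>, the three
  conjuncts say \<open>U^* U = 1\<close>, \<open>U U^* = 1\<close> and
  \<open>M = U diag(l) U^*\<close>. Eigenvectors are numbered by the coordinate set \<open>I\<close>
  itself, so no ordering or dimension count is involved.\<close>

definition eigensys :: "'a set \<Rightarrow> ('a \<Rightarrow> 'a \<Rightarrow> complex) \<Rightarrow> ('a \<Rightarrow> real) \<Rightarrow> ('a \<Rightarrow> 'a \<Rightarrow> complex) \<Rightarrow> bool" where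
  "eigensys I e l M \<longleftrightarrow> orthonormal I I e \<and>
     (\<forall>a\<in>I. \<forall>b\<in>I. (\<Sum>k\<in>I. e k a * cnj (e k b)) = (if a = b then 1 else 0)) \<and>
     (\<forall>a\<in>I. \<forall>b\<in>I. M a b = (\<Sum>k\<in>I. of_real (l k) * e k a * cnj (e k b)))"

lemma sqnorm_nonneg [simp]: "0 \<le> sqnorm I v"
  by (simp add: sqnorm_def sum_nonneg)

lemma sqnorm_cong: "(\<And>a. a \<in> I \<Longrightarrow> v a = w a) \<Longrightarrow> sqnorm I v = sqnorm I w"
  unfolding sqnorm_def by (rule sum.cong) auto

lemma sqnorm_scale: "sqnorm I (\<lambda>a. c * v a) = (cmod c)\<^sup>2 * sqnorm I v"
  by (simp add: sqnorm_def norm_mult power_mult_distrib sum_distrib_left)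

lemma sqnorm_eq_0_iff: "finite I \<Longrightarrow> sqnorm I v = 0 \<longleftrightarrow> (\<forall>a\<in>I. v a = 0)"
  by (simp add: sqnorm_def sum_nonneg_eq_0_iff)

lemma cinner_self: "cinner I v v = of_real (sqnorm I v)"
  unfolding cinner_def sqnorm_def by (simp only: complex_norm_square of_real_sum)

lemma cnj_cinner: "cnj (cinner I v w) = cinner I w v"
  by (simp add: cinner_def mult.commute)

lemma cmod_cinner_commute: "cmod (cinner I v w) = cmod (cinner I w v)"
  by (metis cnj_cinner complex_mod_cnj)

lemma cinner_cong:
  "(\<And>a. a \<in> I \<Longrightarrow> v a = v' a) \<Longrightarrow> (\<And>a. a \<in> I \<Longrightarrow> w a = w' a) \<Longrightarrow> cinner I v w = cinner I v' w'"
  unfolding cinner_def by (rule sum.cong) auto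

lemma cinner_scale_left: "cinner I (\<lambda>a. c * v a) w = c * cinner I v w"
  by (simp add: cinner_def sum_distrib_left mult.assoc)

lemma cinner_scale_right: "cinner I v (\<lambda>a. c * w a) = cnj c * cinner I v w"
  by (simp add: cinner_def sum_distrib_left mult.left_commute)

lemma cinner_diff_left: "cinner I (\<lambda>a. u a - v a) w = cinner I u w - cinner I v w"
  by (simp add: cinner_def sum_subtractf left_diff_distrib)

lemma cinner_sum_left: "cinner I (\<lambda>a. \<Sum>j\<in>J. v j a) w = (\<Sum>j\<in>J. cinner I (v j) w)"
  unfolding cinner_def by (subst sum.swap) (simp add: sum_distrib_right)

lemma matvec_cong: "(\<And>c. c \<in> K \<Longrightarrow> v c = w c) \<Longrightarrow> matvec K M v = matvec K M w"
  unfolding matvec_def by (intro ext sum.cong) auto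

lemma matvec_scale: "matvec K M (\<lambda>c. z * v c) a = z * matvec K M v a"
  by (simp add: matvec_def sum_distrib_left mult.left_commute)

lemma matvec_matmul: "matvec K (matmul L M N) v = matvec L M (matvec K N v)"
proof
  fix a
  have "matvec K (matmul L M N) v a = (\<Sum>d\<in>K. \<Sum>c\<in>L. M a c * (N c d * v d))"
    by (simp add: matvec_def matmul_def sum_distrib_right mult.assoc)
  also have "\<dots> = (\<Sum>c\<in>L. \<Sum>d\<in>K. M a c * (N c d * v d))" by (rule sum.swap)
  also have "\<dots> = matvec L M (matvec K N v) a" by (simp add: matvec_def sum_distrib_left)
  finally show "matvec K (matmul L M N) v a = matvec L M (matvec K N v) a" .
qed

lemma adjoint_adjoint [simp]: "adjoint (adjoint M) = M"
  by (intro ext) (simp add: adjoint_def)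

lemma adjoint_matmul: "adjoint (matmul K M N) = matmul K (adjoint N) (adjoint M)"
  by (intro ext) (simp add: adjoint_def matmul_def mult.commute)

lemma cinner_matvec: "cinner I (matvec K M v) w = cinner K v (matvec I (adjoint M) w)"
proof -
  have "cinner I (matvec K M v) w = (\<Sum>a\<in>I. \<Sum>c\<in>K. M a c * v c * cnj (w a))"
    by (simp add: cinner_def matvec_def sum_distrib_right)
  also have "\<dots> = (\<Sum>c\<in>K. \<Sum>a\<in>I. M a c * v c * cnj (w a))" by (rule sum.swap)
  also have "\<dots> = cinner K v (matvec I (adjoint M) w)"
    by (simp add: cinner_def matvec_def adjoint_def sum_distrib_left mult_ac)
  finally show ?thesis .
qed

lemma quadform_gram: "quadform I (matmul K A (adjoint A)) v = sqnorm K (matvec I (adjoint A) v)"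
proof -
  have "cinner I (matvec K A (matvec I (adjoint A) v)) v = of_real (sqnorm K (matvec I (adjoint A) v))"
    by (simp only: cinner_matvec cinner_self)
  then show ?thesis by (simp add: quadform_def matvec_matmul)
qed

lemma quadform_gram': "quadform I (matmul K (adjoint A) A) v = sqnorm K (matvec I A v)"
  using quadform_gram[of I K "adjoint A" v] by simp

section \<open>Bessel, Parseval and convexity inequalities for quadratic forms\<close>

lemma bessel:
  assumes "finite J" "orthonormal I J f"
  shows "(\<Sum>j\<in>J. (cmod (cinner I v (f j)))\<^sup>2) \<le> sqnorm I v"
proof -
  define c where "c j = cinner I v (f j)" for j
  define u where "u a = (\<Sum>j\<in>J. c j * f j a)" for a
  \<comment> \<open>\<open>r\<close> is what remains of \<open>v\<close> after the orthogonal
    projection \<open>u\<close> onto the span of the family; its squared norm is the difference of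
    the two sides.\<close>
  define r where "r a = v a - u a" for a
  have ur: "cinner I u w = (\<Sum>j\<in>J. c j * cinner I (f j) w)" for w
    unfolding u_def by (simp add: cinner_sum_left cinner_scale_left)
  have fu: "cinner I (f j) u = cnj (c j)" if "j \<in> J" for j
  proof -
    have "cinner I u (f j) = (\<Sum>i\<in>J. if i = j then c j else 0)"
      unfolding ur using assms(2) that by (intro sum.cong) (auto simp: orthonormal_def)
    also have "\<dots> = c j" using assms(1) that by simp
    finally show ?thesis by (metis cnj_cinner)
  qed
  have N: "of_real (\<Sum>j\<in>J. (cmod (c j))\<^sup>2) = (\<Sum>j\<in>J. c j * cnj (c j))"
    by (simp only: of_real_sum complex_norm_square)
  have uu: "cinner I u u = of_real (\<Sum>j\<in>J. (cmod (c j))\<^sup>2)"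
    unfolding ur N using fu by simp
  have uv: "cinner I u v = of_real (\<Sum>j\<in>J. (cmod (c j))\<^sup>2)"
    unfolding ur N by (simp add: c_def cnj_cinner)
  have vu: "cinner I v u = of_real (\<Sum>j\<in>J. (cmod (c j))\<^sup>2)"
    using arg_cong[OF uv, of cnj] by (simp only: cnj_cinner complex_cnj_complex_of_real)
  have "cinner I r r = cinner I v r - cinner I u r"
    unfolding r_def by (rule cinner_diff_left)
  also have "\<dots> = cnj (cinner I r v) - cnj (cinner I r u)" by (simp add: cnj_cinner)
  also have "\<dots> = cnj (cinner I v v - cinner I u v) - cnj (cinner I v u - cinner I u u)"
    unfolding r_def by (simp add: cinner_diff_left)
  also have "\<dots> = of_real (sqnorm I v - (\<Sum>j\<in>J. (cmod (c j))\<^sup>2))"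
    by (simp only: uu uv vu) (simp add: cinner_self)
  finally have "sqnorm I r = sqnorm I v - (\<Sum>j\<in>J. (cmod (c j))\<^sup>2)"
    unfolding cinner_self using of_real_eq_iff by blast
  then show ?thesis using sqnorm_nonneg[of I r] by (simp add: c_def)
qed

lemma cauchy_schwarz:
  assumes "sqnorm I f = 1"
  shows "(cmod (cinner I v f))\<^sup>2 \<le> sqnorm I v"
  using bessel[of "{()}" I "\<lambda>_. f" v] assms by (simp add: orthonormal_def cinner_self)

lemma orthonormalD: "orthonormal I J e \<Longrightarrow> j \<in> J \<Longrightarrow> sqnorm I (e j) = 1"
  unfolding orthonormal_def by (metis cinner_self of_real_eq_1_iff)

lemma parseval:
  assumes I: "finite I" and E: "eigensys I e l M"
  shows "(\<Sum>k\<in>I. (cmod (cinner I v (e k)))\<^sup>2) = sqnorm I v"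
proof -
  have C: "(\<Sum>k\<in>I. e k b * cnj (e k a)) = (if b = a then 1 else 0)" if "a \<in> I" "b \<in> I" for a b
    using E that unfolding eigensys_def by blast
  have "complex_of_real (\<Sum>k\<in>I. (cmod (cinner I v (e k)))\<^sup>2) = (\<Sum>k\<in>I. cinner I v (e k) * cinner I (e k) v)"
    by (simp only: of_real_sum complex_norm_square cnj_cinner)
  also have "\<dots> = (\<Sum>k\<in>I. \<Sum>a\<in>I. \<Sum>b\<in>I. v a * cnj (v b) * (e k b * cnj (e k a)))"
    by (simp add: cinner_def sum_product mult_ac)
  also have "\<dots> = (\<Sum>a\<in>I. \<Sum>k\<in>I. \<Sum>b\<in>I. v a * cnj (v b) * (e k b * cnj (e k a)))"
    by (rule sum.swap)
  also have "\<dots> = (\<Sum>a\<in>I. \<Sum>b\<in>I. \<Sum>k\<in>I. v a * cnj (v b) * (e k b * cnj (e k a)))"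
    by (rule sum.cong[OF refl sum.swap])
  also have "\<dots> = (\<Sum>a\<in>I. \<Sum>b\<in>I. if b = a then v a * cnj (v a) else 0)"
    by (intro sum.cong refl) (simp add: sum_distrib_left[symmetric] C)
  also have "\<dots> = cinner I v v" using I by (simp add: cinner_def)
  finally show ?thesis unfolding cinner_self using of_real_eq_iff by blast
qed

lemma quadform_eigensys:
  assumes E: "eigensys I e l M"
  shows "quadform I M v = (\<Sum>k\<in>I. l k * (cmod (cinner I v (e k)))\<^sup>2)"
proof -
  have M: "M a b = (\<Sum>k\<in>I. of_real (l k) * e k a * cnj (e k b))" if "a \<in> I" "b \<in> I" for a b
    using E that unfolding eigensys_def by blast
  have "cinner I (matvec I M v) v = (\<Sum>a\<in>I. \<Sum>b\<in>I. M a b * v b * cnj (v a))"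
    by (simp add: cinner_def matvec_def sum_distrib_right)
  also have "\<dots> = (\<Sum>a\<in>I. \<Sum>b\<in>I. \<Sum>k\<in>I. of_real (l k) * ((v b * cnj (e k b)) * (e k a * cnj (v a))))"
    by (intro sum.cong refl) (simp add: M sum_distrib_left sum_distrib_right mult_ac)
  also have "\<dots> = (\<Sum>k\<in>I. \<Sum>a\<in>I. \<Sum>b\<in>I. of_real (l k) * ((v b * cnj (e k b)) * (e k a * cnj (v a))))"
    by (rule trans[OF sum.cong[OF refl sum.swap] sum.swap])
  also have "\<dots> = (\<Sum>k\<in>I. of_real (l k) * (cinner I (e k) v * cinner I v (e k)))"
    by (intro sum.cong refl) (simp add: cinner_def sum_product sum_distrib_left mult_ac)
  also have "\<dots> = of_real (\<Sum>k\<in>I. l k * (cmod (cinner I v (e k)))\<^sup>2)"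
    by (simp only: of_real_sum of_real_mult complex_norm_square cnj_cinner mult.commute)
  finally show ?thesis by (simp add: quadform_def)
qed

lemma matvec_eigensys:
  assumes I: "finite I" and E: "eigensys I e l M" and k: "k \<in> I" and a: "a \<in> I"
  shows "matvec I M (e k) a = of_real (l k) * e k a"
proof -
  have M: "M a b = (\<Sum>j\<in>I. of_real (l j) * e j a * cnj (e j b))" if "b \<in> I" for b
    using E a that unfolding eigensys_def by blast
  have O: "cinner I (e k) (e j) = (if k = j then 1 else 0)" if "j \<in> I" for j
    using E k that unfolding eigensys_def orthonormal_def by blast
  have "matvec I M (e k) a = (\<Sum>b\<in>I. \<Sum>j\<in>I. of_real (l j) * e j a * (e k b * cnj (e j b)))"
    unfolding matvec_def by (intro sum.cong refl) (simp add: M sum_distrib_left sum_distrib_right mult_ac)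
  also have "\<dots> = (\<Sum>j\<in>I. of_real (l j) * e j a * cinner I (e k) (e j))"
    by (subst sum.swap) (simp add: cinner_def sum_distrib_left)
  also have "\<dots> = (\<Sum>j\<in>I. if k = j then of_real (l k) * e k a else 0)"
    by (intro sum.cong refl) (simp add: O)
  also have "\<dots> = of_real (l k) * e k a" using I k by simp
  finally show ?thesis .
qed

lemma eigensys_sqnorm: "eigensys I e l M \<Longrightarrow> k \<in> I \<Longrightarrow> sqnorm I (e k) = 1"
  by (rule orthonormalD) (auto simp: eigensys_def)

lemma quadform_eigenvector:
  assumes I: "finite I" and E: "eigensys I e l M" and k: "k \<in> I"
  shows "quadform I M (e k) = l k"
proof -
  have "cinner I (matvec I M (e k)) (e k) = cinner I (\<lambda>a. of_real (l k) * e k a) (e k)"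
    by (intro cinner_cong matvec_eigensys[OF I E k]) auto
  also have "\<dots> = of_real (l k)"
    using eigensys_sqnorm[OF E k] by (simp add: cinner_scale_left cinner_self)
  finally show ?thesis by (simp add: quadform_def)
qed

text \<open>Jensen's inequality for the spectral distribution of \<open>v\<close>: the weights
  \<open>w k\<close> sum to \<open>sqnorm I v\<close> by Parseval, and the weighted mean of the
  eigenvalues is \<open>t\<close>. Stating convexity through a subgradient \<open>f'\<close> also
  covers the function with a kink that occurs at \<open>p = 2\<close>.\<close>

lemma peierls:
  assumes I: "finite I" and E: "eigensys I e l M"
    and f: "\<And>x y. f x + f' x * (y - x) \<le> (f y :: real)" and v: "0 < sqnorm I v"
  shows "sqnorm I v * f (quadform I M v / sqnorm I v) \<le> (\<Sum>k\<in>I. (cmod (cinner I v (e k)))\<^sup>2 * f (l k))"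
proof -
  define g where "g = sqnorm I v"
  define t where "t = quadform I M v / g"
  define w where "w k = (cmod (cinner I v (e k)))\<^sup>2" for k
  have w1: "(\<Sum>k\<in>I. w k) = g" using parseval[OF I E, of v] by (simp add: w_def g_def)
  have "(\<Sum>k\<in>I. w k * l k) = quadform I M v"
    unfolding quadform_eigensys[OF E] w_def by (intro sum.cong refl mult.commute)
  also have "\<dots> = t * g" using v by (simp add: t_def g_def)
  finally have w2: "(\<Sum>k\<in>I. w k * l k) = t * g" .
  have "g * f t = (f t - f' t * t) * g + f' t * (t * g)" by (simp add: algebra_simps)
  also have "\<dots> = (\<Sum>k\<in>I. (f t - f' t * t) * w k + f' t * (w k * l k))"
    by (simp only: sum.distrib sum_distrib_left[symmetric] w1 w2)
  also have "\<dots> = (\<Sum>k\<in>I. w k * (f t + f' t * (l k - t)))"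
    by (rule sum.cong[OF refl]) (simp add: algebra_simps)
  also have "\<dots> \<le> (\<Sum>k\<in>I. w k * f (l k))"
    by (intro sum_mono mult_left_mono f) (simp add: w_def)
  finally show ?thesis unfolding g_def t_def w_def .
qed

text \<open>By Bessel each eigenvalue receives total weight at most 1, and \<open>f \<ge> 0\<close>
  allows raising this weight to 1; hence the orthonormal family may be incomplete. It is used with
  the standard basis, with eigenbases of another matrix and with singular vectors.\<close>

lemma peierls_sum:
  assumes I: "finite I" and J: "finite J" and E: "eigensys I e l M"
    and f: "\<And>x y. f x + f' x * (y - x) \<le> (f y :: real)" and f0: "\<And>x. 0 \<le> f x"
    and v: "orthonormal I J v"
  shows "(\<Sum>j\<in>J. f (quadform I M (v j))) \<le> (\<Sum>k\<in>I. f (l k))"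
proof -
  have "(\<Sum>j\<in>J. f (quadform I M (v j))) \<le> (\<Sum>j\<in>J. \<Sum>k\<in>I. (cmod (cinner I (v j) (e k)))\<^sup>2 * f (l k))"
  proof (rule sum_mono)
    fix j assume "j \<in> J"
    then show "f (quadform I M (v j)) \<le> (\<Sum>k\<in>I. (cmod (cinner I (v j) (e k)))\<^sup>2 * f (l k))"
      using peierls[OF I E f, of "v j"] orthonormalD[OF v, of j] by simp
  qed
  also have "\<dots> = (\<Sum>k\<in>I. (\<Sum>j\<in>J. (cmod (cinner I (e k) (v j)))\<^sup>2) * f (l k))"
    by (subst sum.swap) (simp add: sum_distrib_right cmod_cinner_commute)
  also have "\<dots> \<le> (\<Sum>k\<in>I. 1 * f (l k))"
  proof (intro sum_mono mult_right_mono f0)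
    fix k assume "k \<in> I"
    then show "(\<Sum>j\<in>J. (cmod (cinner I (e k) (v j)))\<^sup>2) \<le> 1"
      using bessel[OF J v, of "e k"] eigensys_sqnorm[OF E, of k] by simp
  qed
  finally show ?thesis by simp
qed

text \<open>The eigenvectors of \<open>A A^*\<close> are left singular vectors of \<open>A\<close>,
  and \<open>A^* (e k) / sqrt (l k)\<close> are the matching right ones. Restricting to
  \<open>0 < l k\<close> keeps the normalization meaningful; nothing is chosen on the
  kernel.\<close>

lemma singular_vectors:
  assumes I: "finite I" and E: "eigensys I e l (matmul K A (adjoint A))"
  shows eigenvalue_gram: "k \<in> I \<Longrightarrow> l k = sqnorm K (matvec I (adjoint A) (e k))"
    and orthonormal_singular_vectors:
      "orthonormal K {k\<in>I. 0 < l k} (\<lambda>k c. of_real (1 / sqrt (l k)) * matvec I (adjoint A) (e k) c)"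
    and matvec_singular_vector: "k \<in> I \<Longrightarrow> 0 < l k \<Longrightarrow> a \<in> I \<Longrightarrow>
      matvec K A (\<lambda>c. of_real (1 / sqrt (l k)) * matvec I (adjoint A) (e k) c) a = of_real (sqrt (l k)) * e k a"
proof -
  have AA: "matvec K A (matvec I (adjoint A) (e k)) a = of_real (l k) * e k a" if "k \<in> I" "a \<in> I" for k a
    using matvec_eigensys[OF I E that] by (simp add: matvec_matmul)
  show "k \<in> I \<Longrightarrow> l k = sqnorm K (matvec I (adjoint A) (e k))"
    using quadform_eigenvector[OF I E, of k] by (simp add: quadform_gram)
  have ip: "cinner K (matvec I (adjoint A) (e i)) (matvec I (adjoint A) (e j)) = (if i = j then of_real (l i) else 0)"
    if "i \<in> I" "j \<in> I" for i j
  proof -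
    have "cinner K (matvec I (adjoint A) (e i)) (matvec I (adjoint A) (e j)) = cinner I (e i) (matvec K A (matvec I (adjoint A) (e j)))"
      by (simp add: cinner_matvec)
    also have "\<dots> = cinner I (e i) (\<lambda>a. of_real (l j) * e j a)"
      using AA that by (intro cinner_cong) auto
    also have "\<dots> = (if i = j then of_real (l i) else 0)"
      using E that by (simp add: cinner_scale_right eigensys_def orthonormal_def)
    finally show ?thesis .
  qed
  show "orthonormal K {k\<in>I. 0 < l k} (\<lambda>k c. of_real (1 / sqrt (l k)) * matvec I (adjoint A) (e k) c)"
    unfolding orthonormal_def
  proof (intro ballI)
    fix i j assume ij: "i \<in> {k\<in>I. 0 < l k}" "j \<in> {k\<in>I. 0 < l k}"
    have "complex_of_real (1 / sqrt (l i)) * (complex_of_real (1 / sqrt (l i)) * of_real (l i)) = 1"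
      using ij by (simp only: of_real_mult[symmetric]) (simp add: real_div_sqrt field_simps)
    moreover have "i \<in> I" "j \<in> I" using ij by auto
    ultimately show "cinner K (\<lambda>c. of_real (1 / sqrt (l i)) * matvec I (adjoint A) (e i) c)
      (\<lambda>c. of_real (1 / sqrt (l j)) * matvec I (adjoint A) (e j) c) = (if i = j then 1 else 0)"
      by (cases "i = j") (simp_all only: cinner_scale_left cinner_scale_right ip complex_cnj_complex_of_real if_True if_False mult_zero_right refl simp_thms)
  qed
  show "matvec K A (\<lambda>c. of_real (1 / sqrt (l k)) * matvec I (adjoint A) (e k) c) a = of_real (sqrt (l k)) * e k a"
    if "k \<in> I" "0 < l k" "a \<in> I"
  proof -
    have "1 / sqrt (l k) * l k = sqrt (l k)" using that by (simp add: real_div_sqrt)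
    then show ?thesis using that by (simp only: matvec_scale AA mult.assoc[symmetric] of_real_mult[symmetric])
  qed
qed

text \<open>\<open>F\<close> falls at least at the rate \<open>\<psi>\<close>, and
  \<open>\<Phi>\<close> at most at this rate. The hypotheses sample \<open>\<psi>\<close> at
  opposite ends of a step; over \<open>N\<close> equal steps the mismatch telescopes to
  \<open>Y (\<psi> 0 - \<psi> Y) / N\<close>, which is arbitrarily small. This takes the place of
  integrating derivatives.\<close>

lemma riemann_comparison:
  fixes F \<Phi> \<psi> :: "real \<Rightarrow> real"
  assumes Y: "0 \<le> Y"
    and F: "\<And>s t. 0 \<le> s \<Longrightarrow> s \<le> t \<Longrightarrow> t \<le> Y \<Longrightarrow> (t - s) * \<psi> t \<le> F s - F t"
    and \<Phi>: "\<And>s t. 0 \<le> s \<Longrightarrow> s \<le> t \<Longrightarrow> t \<le> Y \<Longrightarrow> \<Phi> s - \<Phi> t \<le> (t - s) * \<psi> s"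
  shows "\<Phi> 0 - \<Phi> Y \<le> F 0 - F Y"
proof (rule ccontr)
  assume neg: "\<not> ?thesis"
  define D where "D t = F t - \<Phi> t" for t
  have D: "(t - s) * (\<psi> t - \<psi> s) \<le> D s - D t" if "0 \<le> s" "s \<le> t" "t \<le> Y" for s t
    using F[OF that] \<Phi>[OF that] by (simp add: D_def algebra_simps)
  have *: "Y * (\<psi> Y - \<psi> 0) \<le> real N * (D 0 - D Y)" if "0 < N" for N :: nat
  proof -
    define s where "s k = Y * real k / real N" for k
    have "Y / real N * (\<psi> (s (Suc k)) - \<psi> (s k)) \<le> D (s k) - D (s (Suc k))" if "k < N" for k
    proof -
      have "s (Suc k) - s k = Y / real N" by (simp add: s_def diff_divide_distrib[symmetric] algebra_simps)
      moreover have "0 \<le> s k" "s k \<le> s (Suc k)" using Y by (auto simp: s_def divide_right_mono mult_left_mono)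
      moreover have "s (Suc k) \<le> Y"
        using Y that mult_left_mono[of "real (Suc k)" "real N" Y] by (simp add: s_def divide_le_eq)
      ultimately show ?thesis using D[of "s k" "s (Suc k)"] by simp
    qed
    then have "(\<Sum>k<N. Y / real N * (\<psi> (s (Suc k)) - \<psi> (s k))) \<le> (\<Sum>k<N. D (s k) - D (s (Suc k)))"
      by (intro sum_mono) auto
    then have "Y / real N * (\<psi> (s N) - \<psi> (s 0)) \<le> D (s 0) - D (s N)"
      using sum_lessThan_telescope[of "\<lambda>k. \<psi> (s k)" N] sum_lessThan_telescope'[of "\<lambda>k. D (s k)" N]
      by (simp only: sum_distrib_left[symmetric])
    then show ?thesis using that by (simp add: s_def field_simps)
  qed
  have "0 < D Y - D 0" using neg by (simp add: D_def)
  then obtain N :: nat where "Y * (\<psi> 0 - \<psi> Y) < real N * (D Y - D 0)"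
    using reals_Archimedean3 by blast
  moreover have "real N * (D Y - D 0) < real (Suc N) * (D Y - D 0)"
    using \<open>0 < D Y - D 0\<close> by simp
  ultimately show False using *[of "Suc N"] by (simp add: algebra_simps)
qed

section \<open>Spectral theorem\<close>

lemma trace_mult_commute:
  assumes "A \<in> carrier_mat n k" "B \<in> carrier_mat k n"
  shows "mat_trace (A * B) = mat_trace (B * A)"
proof -
  have "mat_trace (A * B) = (\<Sum>i<n. \<Sum>j<k. A $$ (i,j) * B $$ (j,i))"
    using assms by (simp add: mat_trace_def scalar_prod_def lessThan_atLeast0)
  also have "\<dots> = (\<Sum>j<k. \<Sum>i<n. A $$ (i,j) * B $$ (j,i))" by (rule sum.swap)
  also have "\<dots> = mat_trace (B * A)"
    using assms by (simp add: mat_trace_def scalar_prod_def lessThan_atLeast0 mult.commute)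
  finally show ?thesis .
qed

text \<open>The diagonal of a Schur form lists the eigenvalues with multiplicity, so they sum to the
  trace; if all of them were \<open>t\<close>, the trace would be \<open>n t\<close>. This is the
  source of new eigenvectors in the spectral theorem, without restricting the matrix to a
  subspace.\<close>

lemma eigenvector_avoiding:
  fixes N :: "nat \<Rightarrow> nat \<Rightarrow> complex"
  assumes t: "of_nat n * t \<noteq> (\<Sum>i<n. N i i)"
  shows "\<exists>v z. (\<exists>i<n. v i \<noteq> 0) \<and> (\<forall>i<n. matvec {..<n} N v i = z * v i) \<and> z \<noteq> t"
proof -
  define A where "A = mat n n (\<lambda>(i,j). N i j)"
  have A: "A \<in> carrier_mat n n" by (simp add: A_def)
  obtain es where es: "char_poly A = (\<Prod>e\<leftarrow>es. [:- e, 1:])" and len: "length es = n"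
    using char_poly_factorized[OF A] by auto
  obtain B P Q where "schur_decomposition A es = (B, P, Q)" by (cases "schur_decomposition A es")
  from schur_decomposition[OF A es this]
  have sim: "similar_mat_wit A B P Q" and diag: "diag_mat B = es" by auto
  note BPQ = similar_mat_witD2[OF A sim]
  have "\<exists>z\<in>set es. z \<noteq> t"
  proof (rule ccontr)
    assume "\<not> ?thesis"
    then have "\<forall>i<n. B $$ (i,i) = t"
      using diag BPQ len by (auto simp: diag_mat_def in_set_conv_nth)
    then have "mat_trace B = of_nat n * t" using BPQ by (simp add: mat_trace_def)
    moreover have "mat_trace A = mat_trace B"
    proof -
      have "mat_trace A = mat_trace (P * (B * Q))" using BPQ by (simp add: assoc_mult_mat[of _ n n])
      also have "\<dots> = mat_trace (B * Q * P)" using BPQ by (intro trace_mult_commute) auto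
      also have "B * Q * P = B * (Q * P)" using BPQ by (intro assoc_mult_mat) auto
      finally show ?thesis using BPQ by simp
    qed
    ultimately show False using t by (simp add: mat_trace_def A_def)
  qed
  then obtain z where z: "z \<in> set es" "z \<noteq> t" by auto
  have "poly (char_poly A) z = 0" unfolding es using z(1) by (auto simp: poly_prod_list prod_list_zero_iff)
  then have "eigenvalue A z" using eigenvalue_root_char_poly[OF A] by simp
  then obtain w where w: "w \<in> carrier_vec n" "w \<noteq> 0\<^sub>v n" "A *\<^sub>v w = z \<cdot>\<^sub>v w"
    using A by (auto simp: eigenvalue_def eigenvector_def)
  have "\<exists>i<n. w $ i \<noteq> 0"
  proof (rule ccontr)
    assume "\<not> ?thesis"
    then have "w = 0\<^sub>v n" using w(1) by (intro eq_vecI) auto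
    with w(2) show False by simp
  qed
  moreover have "matvec {..<n} N (\<lambda>j. w $ j) i = z * w $ i" if "i < n" for i
    using arg_cong[OF w(3), of "\<lambda>u. u $ i"] that w(1) A
    by (simp add: matvec_def A_def scalar_prod_def lessThan_atLeast0 row_def)
  ultimately show ?thesis using z(2) by (intro exI[of _ "\<lambda>j. w $ j"] exI[of _ z]) auto
qed

text \<open>
  Given \<open>k < n\<close> orthonormal eigenvectors of \<open>M\<close>, move their eigenvalues to a common value \<open>t\<close>
  such that the trace is not \<open>n t\<close>. Then some eigenvalue differs from \<open>t\<close>, and its eigenvector
  is orthogonal to the given ones.
\<close>

lemma orthonormal_eigenvectors_extend:
  fixes M :: "nat \<Rightarrow> nat \<Rightarrow> complex"
  assumes herm: "\<And>a b. a < n \<Longrightarrow> b < n \<Longrightarrow> M b a = cnj (M a b)" and k: "k < n"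
    and on: "orthonormal {..<n} {..<k} e"
    and ev: "\<And>j a. j < k \<Longrightarrow> a < n \<Longrightarrow> matvec {..<n} M (e j) a = of_real (l j) * e j a"
  shows "\<exists>v z. sqnorm {..<n} v = 1 \<and> (\<forall>j<k. cinner {..<n} v (e j) = 0) \<and>
    (\<forall>a<n. matvec {..<n} M v a = complex_of_real z * v a)"
proof -
  let ?I = "{..<n}"
  \<comment> \<open>Replacing the \<open>k\<close> known eigenvalues by \<open>t\<close> changes the
    trace to \<open>Tr M - \<Sum> l + k t\<close>. The summand \<open>1\<close> makes the real part
    of this \<open>n t - (n - k)\<close>, which differs from \<open>n t\<close> because
    \<open>k < n\<close>.\<close>
  define t where "t = (Re (\<Sum>i<n. M i i) - (\<Sum>j<k. l j)) / (real n - real k) + 1"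
  define N where "N a b = M a b + (\<Sum>j<k. of_real (t - l j) * e j a * cnj (e j b))" for a b
  have Nherm: "adjoint N a b = N a b" if "a < n" "b < n" for a b
    using herm[OF that(2) that(1)] by (simp add: N_def adjoint_def mult_ac)
  have appN: "matvec ?I N v a = matvec ?I M v a + (\<Sum>j<k. of_real (t - l j) * e j a * cinner ?I v (e j))" for v a
  proof -
    have "matvec ?I N v a = matvec ?I M v a + (\<Sum>b<n. \<Sum>j<k. of_real (t - l j) * e j a * (v b * cnj (e j b)))"
      by (simp add: matvec_def N_def distrib_left distrib_right sum.distrib sum_distrib_left sum_distrib_right mult_ac)
    also have "(\<Sum>b<n. \<Sum>j<k. of_real (t - l j) * e j a * (v b * cnj (e j b))) =
       (\<Sum>j<k. of_real (t - l j) * e j a * cinner ?I v (e j))"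
      by (subst sum.swap) (simp add: cinner_def sum_distrib_left)
    finally show ?thesis .
  qed
  have Ne: "matvec ?I N (e j) a = of_real t * e j a" if "j < k" "a < n" for j a
  proof -
    have "(\<Sum>i<k. of_real (t - l i) * e i a * cinner ?I (e j) (e i)) =
       (\<Sum>i<k. if i = j then of_real (t - l j) * e j a else 0)"
      using on that by (intro sum.cong refl) (auto simp: orthonormal_def)
    then show ?thesis using that by (simp add: appN ev algebra_simps)
  qed
  have "(\<Sum>i<n. N i i) = (\<Sum>i<n. M i i) + (\<Sum>i<n. \<Sum>j<k. of_real (t - l j) * (e j i * cnj (e j i)))"
    by (simp add: N_def sum.distrib mult.assoc)
  also have "(\<Sum>i<n. \<Sum>j<k. of_real (t - l j) * (e j i * cnj (e j i))) = (\<Sum>j<k. of_real (t - l j) * cinner ?I (e j) (e j))"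
    by (subst sum.swap) (simp add: cinner_def sum_distrib_left)
  also have "\<dots> = of_real (\<Sum>j<k. t - l j)"
    using on by (simp add: orthonormal_def)
  finally have "Re (\<Sum>i<n. N i i) = Re (\<Sum>i<n. M i i) + real k * t - (\<Sum>j<k. l j)"
    by (simp add: sum_subtractf)
  also have "\<dots> = real n * t - (real n - real k)"
    using k by (simp add: t_def field_simps)
  finally have tr: "Re (\<Sum>i<n. N i i) = real n * t - (real n - real k)" .
  have avoid: "of_nat n * of_real t \<noteq> (\<Sum>i<n. N i i)"
  proof
    assume "of_nat n * of_real t = (\<Sum>i<n. N i i)"
    then have "Re (of_nat n * of_real t) = real n * t - (real n - real k)" using tr by simp
    with k show False by simp
  qed
  obtain w z where w: "\<exists>i<n. w i \<noteq> 0"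
    and wz: "\<And>i. i < n \<Longrightarrow> matvec ?I N w i = z * w i" and z: "z \<noteq> of_real t"
    using eigenvector_avoiding[where N = N, OF avoid] by auto
  have sa: "cinner ?I (matvec ?I N u) v = cinner ?I u (matvec ?I N v)" for u v
  proof -
    have "matvec ?I (adjoint N) v a = matvec ?I N v a" if "a < n" for a
      unfolding matvec_def using that by (intro sum.cong refl) (simp add: Nherm)
    then show ?thesis unfolding cinner_matvec by (intro cinner_cong) auto
  qed
  have w0: "sqnorm ?I w \<noteq> 0" using w by (auto simp: sqnorm_eq_0_iff)
  have "z * cinner ?I w w = cinner ?I (matvec ?I N w) w"
    unfolding cinner_scale_left[symmetric] using wz by (intro cinner_cong) auto
  also have "\<dots> = cinner ?I w (matvec ?I N w)" by (rule sa)
  also have "\<dots> = cnj z * cinner ?I w w"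
    unfolding cinner_scale_right[symmetric] using wz by (intro cinner_cong) auto
  finally have "z = cnj z" using w0 by (simp add: cinner_self)
  then have zr: "z = of_real (Re z)" by (metis Reals_cnj_iff of_real_Re)
  have orth: "cinner ?I w (e j) = 0" if j: "j < k" for j
  proof -
    have "z * cinner ?I w (e j) = cinner ?I (matvec ?I N w) (e j)"
      unfolding cinner_scale_left[symmetric] using wz by (intro cinner_cong) auto
    also have "\<dots> = cinner ?I w (matvec ?I N (e j))" by (rule sa)
    also have "\<dots> = cnj (of_real t) * cinner ?I w (e j)"
      unfolding cinner_scale_right[symmetric] using Ne[OF j] by (intro cinner_cong) auto
    finally show ?thesis using z by simp
  qed
  define c where "c = complex_of_real (1 / sqrt (sqnorm ?I w))"
  have pos: "0 < sqnorm ?I w" using w0 sqnorm_nonneg[of ?I w] by linarith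
  show ?thesis
  proof (intro exI[of _ "\<lambda>a. c * w a"] exI[of _ "Re z"] conjI allI impI)
    show "sqnorm ?I (\<lambda>a. c * w a) = 1"
      unfolding sqnorm_scale using pos by (simp add: c_def norm_divide power_divide)
    show "cinner ?I (\<lambda>a. c * w a) (e j) = 0" if "j < k" for j
      using orth[OF that] by (simp add: cinner_scale_left)
    show "matvec ?I M (\<lambda>a. c * w a) a = of_real (Re z) * (c * w a)" if "a < n" for a
    proof -
      \<comment> \<open>The correction terms in \<open>N\<close> contain the inner products with the
        \<open>e j\<close>, which vanish at \<open>w\<close>.\<close>
      have "matvec ?I N w a = matvec ?I M w a" using orth by (simp add: appN)
      then show ?thesis using wz[OF that] zr by (simp add: matvec_scale mult.left_commute)
    qed
  qed
qed

lemma orthonormal_eigenvectors: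
  fixes M :: "nat \<Rightarrow> nat \<Rightarrow> complex"
  assumes herm: "\<And>a b. a < n \<Longrightarrow> b < n \<Longrightarrow> M b a = cnj (M a b)" and "k \<le> n"
  shows "\<exists>e l. orthonormal {..<n} {..<k} e \<and>
    (\<forall>j<k. \<forall>a<n. matvec {..<n} M (e j) a = complex_of_real (l j) * e j a)"
  using assms(2)
proof (induction k)
  case 0
  then show ?case by (simp add: orthonormal_def)
next
  case (Suc k)
  then obtain e l where on: "orthonormal {..<n} {..<k} e"
    and ev: "\<And>j a. j < k \<Longrightarrow> a < n \<Longrightarrow> matvec {..<n} M (e j) a = complex_of_real (l j) * e j a"
    by auto
  obtain v z where v: "sqnorm {..<n} v = 1" "\<And>j. j < k \<Longrightarrow> cinner {..<n} v (e j) = 0"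
    "\<And>a. a < n \<Longrightarrow> matvec {..<n} M v a = of_real z * v a"
    using orthonormal_eigenvectors_extend[where M = M and e = e and l = l and n = n and k = k, OF herm _ on ev] Suc.prems
    by auto
  have v': "cinner {..<n} (e j) v = 0" if "j < k" for j
    using v(2)[OF that] cnj_cinner[of "{..<n}" v "e j"] by simp
  have "orthonormal {..<n} {..<Suc k} (e(k := v))"
    using on v(2) v' cinner_self[of "{..<n}" v] v(1) by (auto simp: orthonormal_def less_Suc_eq)
  moreover have "\<forall>j<Suc k. \<forall>a<n. matvec {..<n} M ((e(k := v)) j) a = complex_of_real ((l(k := z)) j) * (e(k := v)) j a"
    using ev v by (auto simp: less_Suc_eq)
  ultimately show ?case by blast
qed

text \<open>\<open>n\<close> orthonormal vectors in dimension \<open>n\<close> form a square matrix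
  with a left inverse. A left inverse of a square matrix is also a right inverse, which is the
  completeness relation, and completeness turns the eigenvalue equations into the spectral
  resolution.\<close>

lemma hermitian_eigensys_nat:
  fixes M :: "nat \<Rightarrow> nat \<Rightarrow> complex"
  assumes herm: "\<And>a b. a < n \<Longrightarrow> b < n \<Longrightarrow> M b a = cnj (M a b)"
  shows "\<exists>e l. eigensys {..<n} e l M"
proof -
  obtain e l where on: "orthonormal {..<n} {..<n} e"
    and ev: "\<And>j a. j < n \<Longrightarrow> a < n \<Longrightarrow> matvec {..<n} M (e j) a = complex_of_real (l j) * e j a"
    using orthonormal_eigenvectors[where M = M, OF herm order_refl] by blast
  define U where "U = mat n n (\<lambda>(a,k). e k a)"
  define V where "V = mat n n (\<lambda>(k,a). cnj (e k a))"
  have "V * U = 1\<^sub>m n"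
  proof (rule eq_matI)
    fix i j assume "i < dim_row (1\<^sub>m n :: complex mat)" "j < dim_col (1\<^sub>m n :: complex mat)"
    then show "(V * U) $$ (i,j) = 1\<^sub>m n $$ (i,j)"
      using on by (auto simp: U_def V_def scalar_prod_def orthonormal_def cinner_def lessThan_atLeast0 mult.commute row_def col_def)
  qed (auto simp: U_def V_def)
  then have "U * V = 1\<^sub>m n"
    by (rule mat_mult_left_right_inverse[rotated 2]) (auto simp: U_def V_def)
  then have UV: "(U * V) $$ (a,b) = 1\<^sub>m n $$ (a,b)" for a b by simp
  have C: "(\<Sum>k<n. e k a * cnj (e k b)) = (if a = b then 1 else 0)" if "a < n" "b < n" for a b
    using UV[of a b] that by (simp add: U_def V_def scalar_prod_def lessThan_atLeast0 row_def col_def)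
  have "M a b = (\<Sum>k<n. of_real (l k) * e k a * cnj (e k b))" if "a < n" "b < n" for a b
  proof -
    have "(\<Sum>k<n. of_real (l k) * e k a * cnj (e k b)) = (\<Sum>k<n. \<Sum>c<n. M a c * (e k c * cnj (e k b)))"
      using ev that by (intro sum.cong refl) (simp add: matvec_def sum_distrib_right mult.assoc flip: ev)
    also have "\<dots> = (\<Sum>c<n. M a c * (\<Sum>k<n. e k c * cnj (e k b)))"
      by (subst sum.swap) (simp add: sum_distrib_left)
    also have "\<dots> = (\<Sum>c<n. if c = b then M a b else 0)"
      using that by (intro sum.cong refl) (simp add: C)
    finally show ?thesis using that by simp
  qed
  then show ?thesis using on C unfolding eigensys_def by blast
qed

text \<open>Transport along a bijection with an initial segment of the natural numbers; the Gram
  matrices of the proof live on pairs \<open>(i, k)\<close>.\<close>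

lemma hermitian_eigensys:
  fixes M :: "'a \<Rightarrow> 'a \<Rightarrow> complex"
  assumes I: "finite I" and herm: "\<And>a b. a \<in> I \<Longrightarrow> b \<in> I \<Longrightarrow> M b a = cnj (M a b)"
  shows "\<exists>e l. eigensys I e l M"
proof -
  obtain h where "bij_betw h I {..<card I}"
    using ex_bij_betw_finite_nat[OF I] by (auto simp: lessThan_atLeast0)
  then have h: "bij_betw h I {..<card I}" and hI: "\<And>a. a \<in> I \<Longrightarrow> h a < card I"
    and inj: "\<And>a b. a \<in> I \<Longrightarrow> b \<in> I \<Longrightarrow> h a = h b \<longleftrightarrow> a = b"
    by (auto simp: bij_betw_def inj_on_eq_iff)
  define g where "g = the_inv_into I h"
  have g: "bij_betw g {..<card I} I" unfolding g_def by (rule bij_betw_the_inv_into[OF h])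
  have gh: "g (h a) = a" if "a \<in> I" for a
    using h that unfolding g_def bij_betw_def by (simp add: the_inv_into_f_f)
  have gI: "g i \<in> I" if "i < card I" for i using g that by (auto simp: bij_betw_def)
  obtain e l where E: "eigensys {..<card I} e l (\<lambda>i j. M (g i) (g j))"
    using hermitian_eigensys_nat[of "card I" "\<lambda>i j. M (g i) (g j)"] herm gI by blast
  have sum_h: "(\<Sum>a\<in>I. f (h a)) = (\<Sum>i<card I. f i)" for f :: "nat \<Rightarrow> complex"
    by (rule sum.reindex_bij_betw[OF h])
  have "eigensys I (\<lambda>k a. e (h k) (h a)) (\<lambda>k. l (h k)) M"
    unfolding eigensys_def orthonormal_def cinner_def
  proof (intro conjI ballI)
    fix a b assume ab: "a \<in> I" "b \<in> I"
    show "(\<Sum>c\<in>I. e (h a) (h c) * cnj (e (h b) (h c))) = (if a = b then 1 else 0)"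
      using E hI[OF ab(1)] hI[OF ab(2)] inj[OF ab] sum_h[of "\<lambda>c. e (h a) c * cnj (e (h b) c)"]
      by (simp add: eigensys_def orthonormal_def cinner_def)
    show "(\<Sum>k\<in>I. e (h k) (h a) * cnj (e (h k) (h b))) = (if a = b then 1 else 0)"
      using E hI[OF ab(1)] hI[OF ab(2)] inj[OF ab] sum_h[of "\<lambda>k. e k (h a) * cnj (e k (h b))"]
      by (simp add: eigensys_def)
    have "M (g (h a)) (g (h b)) = (\<Sum>k<card I. of_real (l k) * e k (h a) * cnj (e k (h b)))"
      using E hI[OF ab(1)] hI[OF ab(2)] unfolding eigensys_def by blast
    then show "M a b = (\<Sum>k\<in>I. of_real (l (h k)) * e (h k) (h a) * cnj (e (h k) (h b)))"
      using sum_h[of "\<lambda>k. of_real (l k) * e k (h a) * cnj (e k (h b))"] gh ab by simp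
  qed
  then show ?thesis by blast
qed

section \<open>The trace inequality\<close>

lemma quadform_diff: "quadform I (\<lambda>a b. M a b - of_real c * N a b) w = quadform I M w - c * quadform I N w"
proof -
  have "matvec I (\<lambda>a b. M a b - of_real c * N a b) w = (\<lambda>a. matvec I M w a - of_real c * matvec I N w a)"
    by (intro ext) (simp add: matvec_def left_diff_distrib sum_subtractf sum_distrib_left mult.assoc)
  then show ?thesis by (simp add: quadform_def cinner_diff_left cinner_scale_left)
qed

text \<open>\<open>B\<close> exceeds \<open>B'\<close> by \<open>\<delta> G\<close>. Convexity of
  the \<open>p\<close>-th power of the positive part bounds the change of trace below by
  \<open>\<delta> Tr (f'(B') G)\<close>. Since \<open>G\<close> dominates the sum of the rank one
  matrices \<open>v_j v_j^*\<close>, the quadratic forms of \<open>f'(B')\<close> at the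
  \<open>v_j\<close> bound this below, and Jensen's inequality for \<open>f'\<close> moves them
  inside.\<close>

lemma trace_decrease:
  assumes I: "finite I" and J: "finite J" and E: "eigensys I e l B" and E': "eigensys I e' l' B'"
    and p: "2 \<le> p" and \<delta>: "0 \<le> \<delta>"
    and B: "\<And>w. quadform I B w = quadform I B' w + \<delta> * quadform I G w"
    and G: "\<And>w. (\<Sum>j\<in>J. (cmod (cinner I w (v j)))\<^sup>2) \<le> quadform I G w"
    and v: "\<And>j. j \<in> J \<Longrightarrow> 0 < sqnorm I (v j)"
  shows "\<delta> * (\<Sum>j\<in>J. sqnorm I (v j) * (p * pos_powr (p - 1) (quadform I B' (v j) / sqnorm I (v j)))) \<le>
    (\<Sum>k\<in>I. pos_powr p (l k)) - (\<Sum>k\<in>I. pos_powr p (l' k))"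
proof -
  define f' where "f' t = p * pos_powr (p - 1) t" for t
  have f: "pos_powr p x + f' x * (y - x) \<le> pos_powr p y" for x y
    using pos_powr_subgradient[of p x y] p by (simp add: f'_def)
  \<comment> \<open>\<open>f'\<close> is convex too because \<open>p - 1 \<ge> 1\<close>. At
    \<open>p = 2\<close> its subgradient is twice a step function, with the value \<open>0\<close>
    at \<open>0\<close>.\<close>
  have f'': "f' x + p * (p - 1) * pos_powr (p - 2) x * (y - x) \<le> f' y" for x y
    using mult_left_mono[OF pos_powr_subgradient[of "p - 1" x y], of p] p by (simp add: f'_def algebra_simps)
  have f'0: "0 \<le> f' t" for t using p by (simp add: f'_def)
  have "(\<Sum>j\<in>J. sqnorm I (v j) * f' (quadform I B' (v j) / sqnorm I (v j)))
      \<le> (\<Sum>j\<in>J. \<Sum>k\<in>I. (cmod (cinner I (v j) (e' k)))\<^sup>2 * f' (l' k))"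
    by (intro sum_mono peierls[OF I E' f''] v)
  also have "\<dots> = (\<Sum>k\<in>I. f' (l' k) * (\<Sum>j\<in>J. (cmod (cinner I (e' k) (v j)))\<^sup>2))"
    by (subst sum.swap) (simp add: sum_distrib_left cmod_cinner_commute mult.commute)
  also have "\<dots> \<le> (\<Sum>k\<in>I. f' (l' k) * quadform I G (e' k))"
    by (intro sum_mono mult_left_mono G f'0)
  finally have 1: "\<delta> * (\<Sum>j\<in>J. sqnorm I (v j) * f' (quadform I B' (v j) / sqnorm I (v j)))
      \<le> \<delta> * (\<Sum>k\<in>I. f' (l' k) * quadform I G (e' k))"
    using \<delta> by (rule mult_left_mono)
  \<comment> \<open>The tangents are taken at the \<open>l' k\<close>: in the eigenbasis of
    \<open>B'\<close> the increment is read off the diagonal of \<open>B\<close>, and Peierls passes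
    from this diagonal to the eigenvalues of \<open>B\<close>.\<close>
  have "(\<Sum>k\<in>I. pos_powr p (l' k)) + \<delta> * (\<Sum>k\<in>I. f' (l' k) * quadform I G (e' k)) =
      (\<Sum>k\<in>I. pos_powr p (l' k) + f' (l' k) * (quadform I B (e' k) - l' k))"
    unfolding sum_distrib_left sum.distrib[symmetric]
    by (intro sum.cong refl) (simp add: B quadform_eigenvector[OF I E'])
  also have "\<dots> \<le> (\<Sum>k\<in>I. pos_powr p (quadform I B (e' k)))"
    by (intro sum_mono f)
  also have "\<dots> \<le> (\<Sum>k\<in>I. pos_powr p (l k))"
    using E' by (intro peierls_sum[OF I I E f]) (auto simp: eigensys_def)
  finally show ?thesis using 1 by (simp add: f'_def)
qed

text \<open>\<open>A A^*\<close> and \<open>A^* A\<close> share their nonzero spectrum. The one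
  direction needed follows from Peierls with the right singular vectors as test family, so
  eigenvalues never have to be matched with multiplicity.\<close>

lemma trace_powr_gram_le:
  assumes I: "finite I" and K: "finite K" and p: "1 \<le> p"
    and E: "eigensys I b \<beta> (matmul K A (adjoint A))" and E': "eigensys K e \<sigma> (matmul I (adjoint A) A)"
  shows "(\<Sum>k\<in>I. pos_powr p (\<beta> k)) \<le> (\<Sum>k\<in>K. pos_powr p (\<sigma> k))"
proof -
  let ?J = "{k\<in>I. 0 < \<beta> k}"
  let ?z = "\<lambda>k c. of_real (1 / sqrt (\<beta> k)) * matvec I (adjoint A) (b k) c"
  have q: "quadform K (matmul I (adjoint A) A) (?z k) = \<beta> k" if "k \<in> ?J" for k
  proof -
    have "quadform K (matmul I (adjoint A) A) (?z k) = sqnorm I (matvec K A (?z k))" by (rule quadform_gram')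
    also have "\<dots> = sqnorm I (\<lambda>a. of_real (sqrt (\<beta> k)) * b k a)"
      using matvec_singular_vector[OF I E] that by (intro sqnorm_cong) auto
    also have "\<dots> = \<beta> k" using eigensys_sqnorm[OF E] that by (simp add: sqnorm_scale)
    finally show ?thesis .
  qed
  have "(\<Sum>k\<in>I. pos_powr p (\<beta> k)) = (\<Sum>k\<in>?J. pos_powr p (\<beta> k))"
    using I by (intro sum.mono_neutral_right) (auto, metis not_le pos_powr_nonpos)
  also have "\<dots> = (\<Sum>k\<in>?J. pos_powr p (quadform K (matmul I (adjoint A) A) (?z k)))"
    by (rule sum.cong[OF refl]) (simp only: q)
  also have "\<dots> \<le> (\<Sum>k\<in>K. pos_powr p (\<sigma> k))"
    using I by (intro peierls_sum[OF K _ E' pos_powr_subgradient[OF p] _ orthonormal_singular_vectors[OF I E]]) auto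
  finally show ?thesis .
qed

text \<open>Jensen's inequality for \<open>t^(p-1)\<close> with the weights
  \<open>w k * r k\<close>: they sum to the quadratic form of \<open>M\<close> at \<open>f\<close>,
  and the mean of \<open>r\<close> under them is the quotient \<open>\<gamma>\<close>. The right
  side is the quadratic form of \<open>M^p\<close>, so a sum over an orthonormal family of
  \<open>f\<close> is controlled by \<open>Tr M^p\<close>.\<close>

lemma moment_inequality:
  assumes K: "finite K" and E: "eigensys K e r M" and r: "\<And>k. k \<in> K \<Longrightarrow> 0 \<le> r k"
    and p: "2 \<le> p" and g: "0 < quadform K M f"
  shows "quadform K M f * (sqnorm K (matvec K M f) / quadform K M f) powr (p - 1) \<le>
    (\<Sum>k\<in>K. (cmod (cinner K f (e k)))\<^sup>2 * pos_powr p (r k))"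
proof -
  define w where "w k = (cmod (cinner K f (e k)))\<^sup>2" for k
  define \<gamma> where "\<gamma> = sqnorm K (matvec K M f) / quadform K M f"
  have \<gamma>: "0 \<le> \<gamma>" using g by (simp add: \<gamma>_def)
  have g': "(\<Sum>k\<in>K. w k * r k) = quadform K M f"
    unfolding quadform_eigensys[OF E] w_def by (intro sum.cong refl mult.commute)
  have "cinner K (matvec K M f) (e k) = of_real (r k) * cinner K f (e k)" if k: "k \<in> K" for k
  proof -
    have herm: "cnj (M b a) = M a b" if "a \<in> K" "b \<in> K" for a b
    proof -
      have "M a b = (\<Sum>k\<in>K. of_real (r k) * e k a * cnj (e k b))" 
           "M b a = (\<Sum>k\<in>K. of_real (r k) * e k b * cnj (e k a))"
        using E that unfolding eigensys_def by blast+
      then show ?thesis by (simp add: mult_ac)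
    qed
    have "matvec K (adjoint M) (e k) a = matvec K M (e k) a" if "a \<in> K" for a
      unfolding matvec_def adjoint_def using herm[OF that] by (intro sum.cong refl) simp
    then have "cinner K f (matvec K (adjoint M) (e k)) = cinner K f (\<lambda>a. of_real (r k) * e k a)"
      using matvec_eigensys[OF K E k] by (intro cinner_cong) auto
    then show ?thesis by (simp add: cinner_matvec cinner_scale_right)
  qed
  then have "(\<Sum>k\<in>K. (r k)\<^sup>2 * w k) = (\<Sum>k\<in>K. (cmod (cinner K (matvec K M f) (e k)))\<^sup>2)"
    by (intro sum.cong refl) (simp add: w_def norm_mult power_mult_distrib)
  also have "\<dots> = \<gamma> * quadform K M f" unfolding parseval[OF K E] using g by (simp add: \<gamma>_def)
  finally have d: "(\<Sum>k\<in>K. (r k)\<^sup>2 * w k) = \<gamma> * quadform K M f" .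
  let ?D = "(p - 1) * pos_powr (p - 2) \<gamma>"
  have *: "w k * r k * (\<gamma> powr (p - 1)) + ?D * ((r k)\<^sup>2 * w k - \<gamma> * (w k * r k)) \<le> w k * pos_powr p (r k)"
    if "k \<in> K" for k
  proof -
    have "w k * r k * (pos_powr (p - 1) \<gamma> + ?D * (r k - \<gamma>)) \<le> w k * r k * pos_powr (p - 1) (r k)"
      using pos_powr_subgradient[of "p - 1" \<gamma> "r k"] p r[OF that] by (intro mult_left_mono) (auto simp: w_def)
    also have "r k * pos_powr (p - 1) (r k) = pos_powr p (r k)"
      using powr_mult_base[of "r k" "p - 1"] r[OF that] by (simp add: pos_powr_of_nonneg)
    then have "w k * r k * pos_powr (p - 1) (r k) = w k * pos_powr p (r k)" by simp
    finally show ?thesis using \<gamma> by (simp add: pos_powr_of_nonneg algebra_simps power2_eq_square)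
  qed
  have "quadform K M f * \<gamma> powr (p - 1) =
      (\<Sum>k\<in>K. w k * r k) * \<gamma> powr (p - 1) + ?D * ((\<Sum>k\<in>K. (r k)\<^sup>2 * w k) - \<gamma> * (\<Sum>k\<in>K. w k * r k))"
    by (simp add: g' d)
  also have "\<dots> = (\<Sum>k\<in>K. w k * r k * (\<gamma> powr (p - 1)) + ?D * ((r k)\<^sup>2 * w k - \<gamma> * (w k * r k)))"
    by (simp only: sum.distrib sum_distrib_left[symmetric] sum_distrib_right sum_subtractf)
  also have "\<dots> \<le> (\<Sum>k\<in>K. w k * pos_powr p (r k))"
    by (intro sum_mono *)
  finally show ?thesis by (simp add: \<gamma>_def w_def)
qed

section \<open>The inequality for a pair of Gram matrices\<close>

lemma eigensys_cong:
  "(\<And>a b. a \<in> I \<Longrightarrow> b \<in> I \<Longrightarrow> M a b = N a b) \<Longrightarrow> eigensys I e l M = eigensys I e l N"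
  by (auto simp: eigensys_def)

text \<open>\<open>F s\<close> is the trace of the \<open>p\<close>-th power of the positive part of
  \<open>H - s G'\<close>, and \<open>\<Phi>\<close> is its scalar model. Four facts add up:
  \<open>F\<close> drops at least as much as \<open>\<Phi>\<close> between \<open>0\<close> and
  \<open>x - 1\<close>; \<open>F 0\<close> is at most \<open>Tr S^p\<close>; the diagonal bounds
  \<open>F (x - 1)\<close> below; and the scalar inequality bounds the drop of \<open>\<Phi>\<close>
  below by the main term minus the same diagonal sum, which cancels. The bound \<open>R\<close> is
  an assumption because its proof depends on the block structure of \<open>X\<close>.\<close>

theorem gram_pair_inequality:
  fixes X Y :: "'a \<Rightarrow> 'b \<Rightarrow> complex"
  assumes I: "finite I" and K: "finite K"
    and r: "1 \<le> r" and x: "1 < x" and n: "0 \<le> n" and eq: "x powr (2 * r) = 2 * x + n"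
    and Yrow: "\<And>a. a \<in> I \<Longrightarrow> (\<Sum>c\<in>K. (cmod (Y a c))\<^sup>2) = lam a"
    and Xrow: "\<And>a. a \<in> I \<Longrightarrow> (\<Sum>c\<in>K. (cmod (X a c))\<^sup>2) = lam a"
    and ES: "eigensys K eS \<sigma> (matmul I (adjoint Y) Y)"
    and ER: "eigensys K eR \<rho> (matmul I (adjoint X) X)"
    and ET: "eigensys K eT \<tau> (matmul K (adjoint (matmul I (adjoint X) Y)) (matmul I (adjoint X) Y))"
    and R: "(\<Sum>k\<in>K. pos_powr (2 * r) (\<rho> k)) \<le> (n + 1) powr (2 * r - 1) * (\<Sum>a\<in>I. lam a powr (2 * r))"
  shows "2 * (x + n) / x powr r * (\<Sum>k\<in>K. \<tau> k powr r) \<le> (x + n) powr r * (\<Sum>k\<in>K. pos_powr (2 * r) (\<sigma> k))"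
proof -
  define p where "p = 2 * r"
  have p: "2 \<le> p" using r by (simp add: p_def)
  define \<omega> where "\<omega> = x + n"
  have \<omega>: "0 < \<omega>" using x n by (simp add: \<omega>_def)
  define H where "H = matmul K Y (adjoint Y)"
  define G where "G = matmul K X (adjoint X)"
  define T where "T = matmul I (adjoint X) Y"
  define Rm where "Rm = matmul I (adjoint X) X"
  define B where "B s a b = H a b - of_real (s / \<omega>) * G a b" for s a b
  have adjT: "adjoint T = matmul I (adjoint Y) X" by (simp add: T_def adjoint_matmul)
  have herm: "matmul K A (adjoint A) b a = cnj (matmul K A (adjoint A) a b)" for A :: "'a \<Rightarrow> 'b \<Rightarrow> complex" and a b
    by (simp add: matmul_def adjoint_def mult.commute)
  \<comment> \<open>An eigenbasis is picked for each \<open>s\<close> separately. The choices are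
    unrelated, so \<open>F\<close> is controlled only through its increments.\<close>
  have "\<exists>e l. eigensys I e l (B s)" for s
    using I by (intro hermitian_eigensys) (auto simp: B_def H_def G_def herm[symmetric])
  then obtain eB lB where EB: "eigensys I (eB s) (lB s) (B s)" for s by metis
  have qB: "quadform I (B s) w = quadform I H w - s / \<omega> * quadform I G w" for s w
    unfolding B_def by (rule quadform_diff)
  define F where "F s = (\<Sum>k\<in>I. pos_powr p (lB s k))" for s
  define J where "J = {k\<in>K. 0 < \<tau> k}"
  have J: "finite J" using K by (simp add: J_def)
  have ET': "eigensys K eT \<tau> (matmul K (adjoint T) (adjoint (adjoint T)))" using ET by (simp add: T_def)
  \<comment> \<open>The double adjoint comes from using \<open>singular_vectors\<close> with
    \<open>adjoint T\<close> in the place of \<open>A\<close>. For \<open>k \<in> J\<close>,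
    \<open>f k\<close> is \<open>T (eT k) / sqrt (\<tau> k)\<close>, a unit eigenvector of
    \<open>T T^*\<close>.\<close>
  define f where "f k c = of_real (1 / sqrt (\<tau> k)) * matvec K (adjoint (adjoint T)) (eT k) c" for k c
  have fo: "orthonormal K J f"
    unfolding f_def J_def by (rule orthonormal_singular_vectors[OF K ET'])
  have Tf: "matvec K (adjoint T) (f j) a = of_real (sqrt (\<tau> j)) * eT j a" if "j \<in> J" "a \<in> K" for j a
    using matvec_singular_vector[OF K ET'] that unfolding f_def J_def by auto
  define v where "v j = matvec K X (f j)" for j
  define g where "g j = sqnorm I (v j)" for j
  define d where "d j = quadform I G (v j)" for j
  have qH: "quadform I H (v j) = \<tau> j" if "j \<in> J" for j
  proof -
    have "quadform I H (v j) = sqnorm K (matvec K (adjoint T) (f j))"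
      by (simp add: H_def quadform_gram v_def adjT matvec_matmul)
    also have "\<dots> = sqnorm K (\<lambda>a. of_real (sqrt (\<tau> j)) * eT j a)"
      using Tf[OF that] by (intro sqnorm_cong) auto
    also have "\<dots> = \<tau> j" using that eigensys_sqnorm[OF ET] by (simp add: sqnorm_scale J_def)
    finally show ?thesis .
  qed
  have g_eq: "g j = quadform K Rm (f j)" for j
    by (simp add: g_def v_def Rm_def quadform_gram')
  have d_eq: "d j = sqnorm K (matvec K Rm (f j))" for j
    by (simp add: d_def G_def quadform_gram v_def Rm_def matvec_matmul)
  have g0: "0 < g j" if "j \<in> J" for j
  proof (rule ccontr)
    assume "\<not> 0 < g j"
    then have "sqnorm I (v j) = 0" using sqnorm_nonneg[of I "v j"] by (simp add: g_def)
    then have "\<forall>a\<in>I. v j a = 0" using I by (simp add: sqnorm_eq_0_iff)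
    then have "quadform I H (v j) = 0" by (simp add: quadform_def cinner_def)
    with qH[OF that] that show False by (simp add: J_def)
  qed
  have gd: "(g j)\<^sup>2 \<le> d j" if "j \<in> J" for j
  proof -
    have "(g j)\<^sup>2 \<le> (cmod (cinner K (matvec K Rm (f j)) (f j)))\<^sup>2"
      unfolding g_eq quadform_def using abs_Re_le_cmod by (intro abs_le_square_iff[THEN iffD1]) simp
    also have "\<dots> \<le> d j" unfolding d_eq by (rule cauchy_schwarz[OF orthonormalD[OF fo that]])
    finally show ?thesis .
  qed
  \<comment> \<open>Bessel for \<open>X^* w\<close> and the \<open>f j\<close>; in matrix terms, the
    sum of the \<open>v_j v_j^*\<close> is at most \<open>X X^* = G\<close>.\<close>
  have bG: "(\<Sum>j\<in>J. (cmod (cinner I w (v j)))\<^sup>2) \<le> quadform I G w" for w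
  proof -
    have "cinner I w (v j) = cinner K (matvec I (adjoint X) w) (f j)" for j
      by (simp add: v_def cinner_matvec)
    then show ?thesis using bessel[OF J fo, of "matvec I (adjoint X) w"] by (simp add: G_def quadform_gram)
  qed
  \<comment> \<open>\<open>\<gamma> j\<close> and \<open>h j\<close> are the mean values of
    \<open>G'\<close> and \<open>H\<close> in the normalized vector \<open>v j\<close>. They play
    the roles of \<open>g\<close> and \<open>h\<close> in the scalar inequality.\<close>
  define \<gamma> where "\<gamma> j = d j / (\<omega> * g j)" for j
  define h where "h j = \<tau> j / g j" for j
  have g\<gamma>: "g j / \<omega> \<le> \<gamma> j" if "j \<in> J" for j
    using gd[OF that] g0[OF that] \<omega> by (simp add: \<gamma>_def field_simps power2_eq_square)
  have \<gamma>0: "0 < \<gamma> j" if "j \<in> J" for j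
    using g\<gamma>[OF that] g0[OF that] \<omega> by (meson divide_pos_pos less_le_trans)
  \<comment> \<open>The weights \<open>g j / (\<omega> * \<gamma> j)\<close> are chosen such that
    the derivative of \<open>\<Phi>\<close> is \<open>- \<psi>\<close>, where \<open>\<psi>\<close>
    is the rate supplied by \<open>trace_decrease\<close>.\<close>
  define \<Phi> where "\<Phi> s = (\<Sum>j\<in>J. g j / (\<omega> * \<gamma> j) * pos_powr p (h j - s * \<gamma> j))" for s
  define \<psi> where "\<psi> s = (\<Sum>j\<in>J. g j / \<omega> * (p * pos_powr (p - 1) (h j - s * \<gamma> j)))" for s
  have "\<Phi> 0 - \<Phi> (x - 1) \<le> F 0 - F (x - 1)"
  proof (rule riemann_comparison)
    fix s t :: real assume st: "0 \<le> s" "s \<le> t" "t \<le> x - 1"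
    have "(t - s) / \<omega> * (\<Sum>j\<in>J. sqnorm I (v j) * (p * pos_powr (p - 1) (quadform I (B t) (v j) / sqnorm I (v j)))) \<le> F s - F t"
      unfolding F_def
    proof (rule trace_decrease[OF I J EB EB p _ _ bG])
      show "0 \<le> (t - s) / \<omega>" using st \<omega> by simp
      show "quadform I (B s) w = quadform I (B t) w + (t - s) / \<omega> * quadform I G w" for w
        by (simp add: qB diff_divide_distrib algebra_simps)
      show "0 < sqnorm I (v j)" if "j \<in> J" for j using g0[OF that] by (simp add: g_def)
    qed
    also have "(t - s) / \<omega> * (\<Sum>j\<in>J. sqnorm I (v j) * (p * pos_powr (p - 1) (quadform I (B t) (v j) / sqnorm I (v j)))) = (t - s) * \<psi> t"
    proof -
      have "quadform I (B t) (v j) / sqnorm I (v j) = h j - t * \<gamma> j" if "j \<in> J" for j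
        using g0[OF that] \<omega> by (simp add: qB qH[OF that] h_def \<gamma>_def d_def[symmetric] g_def[symmetric] field_simps)
      then show ?thesis
        unfolding \<psi>_def sum_distrib_left by (intro sum.cong refl) (simp add: g_def)
    qed
    finally show "(t - s) * \<psi> t \<le> F s - F t" .
    show "\<Phi> s - \<Phi> t \<le> (t - s) * \<psi> s"
      unfolding \<Phi>_def \<psi>_def sum_subtractf[symmetric] sum_distrib_left
    proof (rule sum_mono)
      fix j assume j: "j \<in> J"
      let ?A = "h j - s * \<gamma> j"
      have "pos_powr p ?A + p * pos_powr (p - 1) ?A * (h j - t * \<gamma> j - ?A) \<le> pos_powr p (h j - t * \<gamma> j)"
        using p by (intro pos_powr_subgradient) simp
      then have "pos_powr p ?A - pos_powr p (h j - t * \<gamma> j) \<le> p * pos_powr (p - 1) ?A * ((t - s) * \<gamma> j)"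
        by (simp add: algebra_simps)
      then have "g j / (\<omega> * \<gamma> j) * (pos_powr p ?A - pos_powr p (h j - t * \<gamma> j))
          \<le> g j / (\<omega> * \<gamma> j) * (p * pos_powr (p - 1) ?A * ((t - s) * \<gamma> j))"
        using g0[OF j] \<gamma>0[OF j] \<omega> by (intro mult_left_mono) auto
      also have "\<dots> = (t - s) * (g j / \<omega> * (p * pos_powr (p - 1) ?A))"
        using \<gamma>0[OF j] \<omega> by simp
      finally show "g j / (\<omega> * \<gamma> j) * pos_powr p ?A - g j / (\<omega> * \<gamma> j) * pos_powr p (h j - t * \<gamma> j)
          \<le> (t - s) * (g j / \<omega> * (p * pos_powr (p - 1) ?A))"
        by (simp only: right_diff_distrib)
    qed
  qed (use x in simp)
  moreover have "F 0 \<le> (\<Sum>k\<in>K. pos_powr p (\<sigma> k))"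
  proof -
    have "eigensys I (eB 0) (lB 0) (matmul K Y (adjoint Y))"
      using EB[of 0] by (subst (asm) eigensys_cong[of _ _ H]) (auto simp: B_def H_def)
    then show ?thesis unfolding F_def using trace_powr_gram_le[OF I K _ _ ES] p by simp
  qed
  moreover have "((n + 1) / \<omega>) powr p * (\<Sum>a\<in>I. lam a powr p) \<le> F (x - 1)"
  proof -
    \<comment> \<open>With the standard basis as test family, Peierls compares the trace with the
      diagonal, where the equal row norms of \<open>X\<close> and \<open>Y\<close> enter.\<close>
    define u :: "'a \<Rightarrow> 'a \<Rightarrow> complex" where "u a b = (if b = a then 1 else 0)" for a b
    have "cinner I (u a) (u b) = (if a = b then 1 else 0)" if "a \<in> I" for a b
    proof -
      have "cinner I (u a) (u b) = (\<Sum>c\<in>I. if c = a then if a = b then 1 else 0 else 0)"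
        unfolding cinner_def u_def by (intro sum.cong) auto
      then show ?thesis using I that by simp
    qed
    then have uo: "orthonormal I I u" by (simp add: orthonormal_def)
    have au: "matvec I (adjoint A) (u a) c = cnj (A a c)" if "a \<in> I" for A :: "'a \<Rightarrow> 'b \<Rightarrow> complex" and a c
    proof -
      have "matvec I (adjoint A) (u a) c = (\<Sum>b\<in>I. if b = a then cnj (A a c) else 0)"
        unfolding matvec_def u_def adjoint_def by (intro sum.cong) auto
      then show ?thesis using I that by simp
    qed
    have "quadform I (B (x - 1)) (u a) = (n + 1) / \<omega> * lam a" if "a \<in> I" for a
    proof -
      have "quadform I H (u a) = lam a" "quadform I G (u a) = lam a"
        using Yrow[OF that] Xrow[OF that] by (simp_all add: H_def G_def quadform_gram sqnorm_def au[OF that])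
      then have "quadform I (B (x - 1)) (u a) = (1 - (x - 1) / \<omega>) * lam a"
        by (simp add: qB left_diff_distrib)
      also have "1 - (x - 1) / \<omega> = (n + 1) / \<omega>" using \<omega> by (simp add: \<omega>_def field_simps)
      finally show ?thesis .
    qed
    moreover have "0 \<le> lam a" if "a \<in> I" for a using Yrow[OF that] by (metis sum_nonneg zero_le_power2)
    ultimately have "((n + 1) / \<omega>) powr p * (\<Sum>a\<in>I. lam a powr p) = (\<Sum>a\<in>I. pos_powr p (quadform I (B (x - 1)) (u a)))"
      unfolding sum_distrib_left using n \<omega>
      by (intro sum.cong refl) (simp add: pos_powr_of_nonneg powr_mult powr_divide)
    also have "\<dots> \<le> F (x - 1)"
      unfolding F_def using p by (intro peierls_sum[OF I I EB pos_powr_subgradient _ uo]) auto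
    finally show ?thesis .
  qed
  moreover have "2 * (x + n) / x powr r / \<omega> powr r * (\<Sum>k\<in>K. \<tau> k powr r) - ((n + 1) / \<omega>) powr p * (\<Sum>a\<in>I. lam a powr p)
    \<le> \<Phi> 0 - \<Phi> (x - 1)"
  proof -
    define \<kappa> where "\<kappa> = 2 * (x + n) / x powr r"
    have \<kappa>: "0 \<le> \<kappa>" using x n by (simp add: \<kappa>_def)
    have rho0: "0 \<le> \<rho> k" if "k \<in> K" for k
      using eigenvalue_gram[OF K _ that, of eR \<rho> I "adjoint X"] ER by simp
    have "(\<Sum>j\<in>J. g j * (d j / g j) powr (p - 1)) \<le> (\<Sum>j\<in>J. \<Sum>k\<in>K. (cmod (cinner K (f j) (eR k)))\<^sup>2 * pos_powr p (\<rho> k))"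
    proof (rule sum_mono)
      fix j assume "j \<in> J"
      then show "g j * (d j / g j) powr (p - 1) \<le> (\<Sum>k\<in>K. (cmod (cinner K (f j) (eR k)))\<^sup>2 * pos_powr p (\<rho> k))"
        using moment_inequality[OF K ER rho0 p, of "f j"] g0[of j] by (simp add: g_eq d_eq Rm_def)
    qed
    also have "\<dots> = (\<Sum>k\<in>K. (\<Sum>j\<in>J. (cmod (cinner K (eR k) (f j)))\<^sup>2) * pos_powr p (\<rho> k))"
      by (subst sum.swap) (simp add: sum_distrib_right cmod_cinner_commute)
    also have "\<dots> \<le> (\<Sum>k\<in>K. 1 * pos_powr p (\<rho> k))"
    proof (intro sum_mono mult_right_mono)
      show "(\<Sum>j\<in>J. (cmod (cinner K (eR k) (f j)))\<^sup>2) \<le> 1" if "k \<in> K" for k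
        using bessel[OF J fo, of "eR k"] eigensys_sqnorm[OF ER that] by simp
    qed simp
    also have "\<dots> \<le> (n + 1) powr (p - 1) * (\<Sum>a\<in>I. lam a powr p)" using R by (simp add: p_def)
    finally have M: "(\<Sum>j\<in>J. g j * (d j / g j) powr (p - 1)) \<le> (n + 1) powr (p - 1) * (\<Sum>a\<in>I. lam a powr p)" .
    have summand: "\<kappa> / \<omega> powr r * \<tau> j powr r - (n + 1) / \<omega> powr p * (g j * (d j / g j) powr (p - 1))
        \<le> g j / (\<omega> * \<gamma> j) * (pos_powr p (h j) - pos_powr p (h j - (x - 1) * \<gamma> j))" if j: "j \<in> J" for j
    proof -
      have gj: "0 < g j" and \<gamma>j: "0 < \<gamma> j" and hj: "0 < h j"
        using g0[OF j] \<gamma>0[OF j] j by (auto simp: h_def J_def)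
      have "\<kappa> * (h j powr r * \<gamma> j powr r) \<le> h j powr p + (n + 1) * \<gamma> j powr p - pos_powr p (h j - (x - 1) * \<gamma> j)"
        unfolding \<kappa>_def p_def using hj \<gamma>j by (intro scalar_inequality r x n eq) auto
      then have "g j / (\<omega> * \<gamma> j) * (\<kappa> * (h j powr r * \<gamma> j powr r) - (n + 1) * \<gamma> j powr p)
          \<le> g j / (\<omega> * \<gamma> j) * (pos_powr p (h j) - pos_powr p (h j - (x - 1) * \<gamma> j))"
        using gj \<gamma>j \<omega> hj by (intro mult_left_mono) (auto simp: pos_powr_of_nonneg)
      \<comment> \<open>The weight leaves \<open>\<gamma>^(r-1)\<close> where
        \<open>(g / \<omega>)^(r-1)\<close> is wanted; the Cauchy-Schwarz bound
        \<open>g / \<omega> \<le> \<gamma>\<close> and \<open>r \<ge> 1\<close> bridge the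
        two.\<close>
      moreover have "\<kappa> / \<omega> powr r * \<tau> j powr r \<le> g j / (\<omega> * \<gamma> j) * (\<kappa> * (h j powr r * \<gamma> j powr r))"
      proof -
        have "\<tau> j = h j * g j" using gj by (simp add: h_def)
        then have "\<kappa> / \<omega> powr r * \<tau> j powr r = \<kappa> * h j powr r * (g j / \<omega>) powr r"
          using gj hj \<omega> by (simp add: powr_mult powr_divide)
        also have "(g j / \<omega>) powr r = g j / \<omega> * (g j / \<omega>) powr (r - 1)"
          using powr_mult_base[of "g j / \<omega>" "r - 1"] gj \<omega> by simp
        also have "\<kappa> * h j powr r * (g j / \<omega> * (g j / \<omega>) powr (r - 1)) \<le> \<kappa> * h j powr r * (g j / \<omega> * \<gamma> j powr (r - 1))"
          using gj \<omega> \<kappa> r g\<gamma>[OF j] by (intro mult_left_mono powr_mono2) auto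
        also have "\<gamma> j powr (r - 1) = \<gamma> j powr r / \<gamma> j"
          using \<gamma>j by (simp add: powr_diff)
        finally show ?thesis by (simp add: algebra_simps)
      qed
      moreover have "g j / (\<omega> * \<gamma> j) * ((n + 1) * \<gamma> j powr p) = (n + 1) / \<omega> powr p * (g j * (d j / g j) powr (p - 1))"
      proof -
        have "d j / g j = \<omega> * \<gamma> j" using gj \<omega> by (simp add: \<gamma>_def)
        moreover have "(\<omega> * \<gamma> j) powr (p - 1) = \<omega> powr p * \<gamma> j powr p / (\<omega> * \<gamma> j)"
          using \<omega> \<gamma>j by (simp add: powr_diff powr_mult)
        ultimately show ?thesis using \<omega> \<gamma>j by simp
      qed
      ultimately show ?thesis by (simp only: right_diff_distrib)
    qed
    have "(n + 1) / \<omega> powr p * (\<Sum>j\<in>J. g j * (d j / g j) powr (p - 1))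
        \<le> (n + 1) / \<omega> powr p * ((n + 1) powr (p - 1) * (\<Sum>a\<in>I. lam a powr p))"
      using M n by (intro mult_left_mono) auto
    also have "\<dots> = ((n + 1) / \<omega>) powr p * (\<Sum>a\<in>I. lam a powr p)"
      using powr_mult_base[of "n + 1" "p - 1"] n \<omega> by (simp add: powr_divide)
    finally have "\<kappa> / \<omega> powr r * (\<Sum>j\<in>J. \<tau> j powr r) - ((n + 1) / \<omega>) powr p * (\<Sum>a\<in>I. lam a powr p)
      \<le> \<kappa> / \<omega> powr r * (\<Sum>j\<in>J. \<tau> j powr r) - (n + 1) / \<omega> powr p * (\<Sum>j\<in>J. g j * (d j / g j) powr (p - 1))"
      by simp
    also have "\<dots> = (\<Sum>j\<in>J. \<kappa> / \<omega> powr r * \<tau> j powr r - (n + 1) / \<omega> powr p * (g j * (d j / g j) powr (p - 1)))"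
      by (simp only: sum_subtractf sum_distrib_left)
    also have "\<dots> \<le> (\<Sum>j\<in>J. g j / (\<omega> * \<gamma> j) * (pos_powr p (h j) - pos_powr p (h j - (x - 1) * \<gamma> j)))"
      by (intro sum_mono summand)
    also have "\<dots> = \<Phi> 0 - \<Phi> (x - 1)"
      by (simp add: \<Phi>_def right_diff_distrib sum_subtractf)
    \<comment> \<open>The indices outside \<open>J\<close> have \<open>\<tau> k = 0\<close> and
      contribute nothing, since \<open>0 powr r = 0\<close>.\<close>
    also have "(\<Sum>j\<in>J. \<tau> j powr r) = (\<Sum>k\<in>K. \<tau> k powr r)"
    proof (rule sum.mono_neutral_left)
      have "0 \<le> \<tau> k" if "k \<in> K" for k
        using eigenvalue_gram[OF K ET' that] by simp
      then show "\<forall>k\<in>K - J. \<tau> k powr r = 0" by (force simp: J_def)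
    qed (use K J_def in auto)
    finally show ?thesis by (simp add: \<kappa>_def)
  qed
  ultimately have "2 * (x + n) / x powr r / \<omega> powr r * (\<Sum>k\<in>K. \<tau> k powr r) \<le> (\<Sum>k\<in>K. pos_powr p (\<sigma> k))"
    by linarith
  then have "\<omega> powr r * (2 * (x + n) / x powr r / \<omega> powr r * (\<Sum>k\<in>K. \<tau> k powr r)) \<le> \<omega> powr r * (\<Sum>k\<in>K. pos_powr p (\<sigma> k))"
    by (rule mult_left_mono) simp
  then show ?thesis using \<omega> by (simp add: \<omega>_def p_def)
qed

section \<open>From Gram pairs to sums of absolute values\<close>

lemma pos_powr_sum_le:
  assumes J: "finite J" and m: "m = real (card J)" "0 < m" and p: "1 \<le> p" and \<xi>: "\<And>i. i \<in> J \<Longrightarrow> 0 \<le> \<xi> i"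
  shows "pos_powr p (\<Sum>i\<in>J. \<xi> i) \<le> m powr (p - 1) * (\<Sum>i\<in>J. pos_powr p (\<xi> i))"
proof -
  define t where "t = (\<Sum>i\<in>J. \<xi> i) / m"
  have t: "0 \<le> t" using \<xi> m by (simp add: t_def sum_nonneg)
  have "m * pos_powr p t = (\<Sum>i\<in>J. pos_powr p t + p * pos_powr (p - 1) t * (\<xi> i - t))"
  proof -
    have "(\<Sum>i\<in>J. \<xi> i - t) = 0" using m by (simp add: sum_subtractf t_def)
    then show ?thesis using m by (simp only: sum.distrib sum_distrib_left[symmetric]) simp
  qed
  also have "\<dots> \<le> (\<Sum>i\<in>J. pos_powr p (\<xi> i))" by (intro sum_mono pos_powr_subgradient p)
  finally have "m powr (p - 1) * (m * pos_powr p t) \<le> m powr (p - 1) * (\<Sum>i\<in>J. pos_powr p (\<xi> i))"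
    by (rule mult_left_mono) simp
  moreover have "m powr (p - 1) * (m * pos_powr p t) = pos_powr p (\<Sum>i\<in>J. \<xi> i)"
  proof -
    have "m powr (p - 1) * m = m powr p" using powr_mult_base[of m "p - 1"] m by (simp add: mult.commute)
    moreover have "(\<Sum>i\<in>J. \<xi> i) = m * t" using m by (simp add: t_def)
    ultimately show ?thesis using m by (simp add: pos_powr_mult flip: mult.assoc)
  qed
  ultimately show ?thesis by simp
qed

text \<open>The missing mass \<open>1 - W\<close> is placed at \<open>0\<close>, where
  \<open>f\<close> vanishes. This serves for the weights coming from the left singular vectors,
  which need not span the space.\<close>

lemma jensen_subconvex:
  assumes J: "finite J" and f: "\<And>x y. f x + f' x * (y - x) \<le> (f y :: real)" and f0: "f 0 = 0"
    and \<omega>: "\<And>k. k \<in> J \<Longrightarrow> 0 \<le> \<omega> k" "(\<Sum>k\<in>J. \<omega> k) \<le> 1"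
  shows "f (\<Sum>k\<in>J. \<omega> k * y k) \<le> (\<Sum>k\<in>J. \<omega> k * f (y k))"
proof -
  define t where "t = (\<Sum>k\<in>J. \<omega> k * y k)"
  define W where "W = (\<Sum>k\<in>J. \<omega> k)"
  have "(1 - W) * (f t + f' t * (0 - t)) \<le> (1 - W) * f 0"
    using \<omega>(2) f[of t 0] by (intro mult_left_mono) (auto simp: W_def)
  then have "(1 - W) * f t - (1 - W) * f' t * t \<le> 0" by (simp add: f0 algebra_simps)
  moreover have "(\<Sum>k\<in>J. \<omega> k * (f t + f' t * (y k - t))) \<le> (\<Sum>k\<in>J. \<omega> k * f (y k))"
    using \<omega>(1) by (intro sum_mono mult_left_mono f) auto
  moreover have "(\<Sum>k\<in>J. \<omega> k * (f t + f' t * (y k - t))) = (f t - f' t * t) * W + f' t * t"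
  proof -
    have "(\<Sum>k\<in>J. \<omega> k * (f t + f' t * (y k - t))) = (\<Sum>k\<in>J. (f t - f' t * t) * \<omega> k + f' t * (\<omega> k * y k))"
      by (intro sum.cong refl) (simp add: algebra_simps)
    also have "\<dots> = (f t - f' t * t) * W + f' t * t"
      by (simp only: sum.distrib sum_distrib_left[symmetric] W_def t_def)
    finally show ?thesis .
  qed
  ultimately show ?thesis unfolding t_def[symmetric] by (simp add: algebra_simps)
qed

text \<open>Row \<open>(i, k)\<close> of \<open>Y\<close> and of \<open>X\<close> is
  \<open>sqrt lam\<close> times the conjugate of the right and of the left singular vector of
  \<open>A i\<close>, respectively. Splitting each singular value evenly between the two factors is
  what makes the row norms agree.\<close>

theorem sum_abs_trace_inequality:
  fixes A :: "nat \<Rightarrow> 'b \<Rightarrow> 'b \<Rightarrow> complex"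
  assumes K: "finite K" and m: "1 \<le> m"
    and r: "1 \<le> r" and x: "1 < x" and eq: "x powr (2 * r) = 2 * x + (real m - 1)"
    and U: "\<And>i. i \<in> {1..m} \<Longrightarrow> eigensys K (u i) (\<mu> i) (matmul K (adjoint (A i)) (A i))"
    and ES: "eigensys K eS \<sigma> (\<lambda>c c'. \<Sum>i\<in>{1..m}. \<Sum>k\<in>K. of_real (sqrt (\<mu> i k)) * u i k c * cnj (u i k c'))"
    and ET: "eigensys K eT \<tau> (matmul K (adjoint (\<lambda>c c'. \<Sum>i\<in>{1..m}. A i c c')) (\<lambda>c c'. \<Sum>i\<in>{1..m}. A i c c'))"
  shows "2 * (x + (real m - 1)) / x powr r * (\<Sum>k\<in>K. \<tau> k powr r)
    \<le> (x + (real m - 1)) powr r * (\<Sum>k\<in>K. pos_powr (2 * r) (\<sigma> k))"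
proof -
  define I where "I = {1..m} \<times> K"
  have I: "finite I" using K by (simp add: I_def)
  have U': "eigensys K (u i) (\<mu> i) (matmul K (adjoint (A i)) (adjoint (adjoint (A i))))" if "i \<in> {1..m}" for i
    using U[OF that] by simp
  have \<mu>_eq: "\<mu> i k = sqnorm K (matvec K (A i) (u i k))" if "i \<in> {1..m}" "k \<in> K" for i k
    using eigenvalue_gram[OF K U'[OF that(1)] that(2)] by simp
  have \<mu>0: "0 \<le> \<mu> i k" if "i \<in> {1..m}" "k \<in> K" for i k using \<mu>_eq[OF that] by simp
  define lam where "lam a = sqrt (\<mu> (fst a) (snd a))" for a
  have lam0: "0 \<le> lam a" if "a \<in> I" for a using \<mu>0 that by (auto simp: lam_def I_def)
  \<comment> \<open>On the kernel \<open>q\<close> is zero rather than completed to a basis. There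
    \<open>lam\<close> is zero as well, so the factorization and the row norms are
    unaffected.\<close>
  define q where "q i k c = (if 0 < \<mu> i k then of_real (1 / sqrt (\<mu> i k)) * matvec K (A i) (u i k) c else 0)" for i k c
  have qo: "orthonormal K {k\<in>K. 0 < \<mu> i k} (q i)" if "i \<in> {1..m}" for i
  proof -
    have "orthonormal K {k\<in>K. 0 < \<mu> i k} (\<lambda>k c. of_real (1 / sqrt (\<mu> i k)) * matvec K (adjoint (adjoint (A i))) (u i k) c)"
      by (rule orthonormal_singular_vectors[OF K U'[OF that]])
    moreover have "q i k = (\<lambda>c. of_real (1 / sqrt (\<mu> i k)) * matvec K (adjoint (adjoint (A i))) (u i k) c)" if "0 < \<mu> i k" for k
      using that by (intro ext) (simp add: q_def)
    ultimately show ?thesis by (simp add: orthonormal_def)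
  qed
  have q_lam: "of_real (sqrt (\<mu> i k)) * q i k c = matvec K (A i) (u i k) c" if "i \<in> {1..m}" "k \<in> K" "c \<in> K" for i k c
  proof (cases "0 < \<mu> i k")
    case True
    then show ?thesis by (simp add: q_def)
  next
    case False
    then have "\<mu> i k = 0" using \<mu>0[OF that(1,2)] by simp
    with \<mu>_eq[OF that(1,2)] that(3) K show ?thesis by (simp add: sqnorm_eq_0_iff)
  qed
  have q_sqnorm: "sqnorm K (q i k) = (if 0 < \<mu> i k then 1 else 0)" if "i \<in> {1..m}" "k \<in> K" for i k
    using orthonormalD[OF qo[OF that(1)], of k] that(2) by (simp add: sqnorm_def q_def)
  have q_bessel: "(\<Sum>k\<in>K. (cmod (cinner K w (q i k)))\<^sup>2) \<le> sqnorm K w" if "i \<in> {1..m}" for i w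
  proof -
    have "(\<Sum>k\<in>K. (cmod (cinner K w (q i k)))\<^sup>2) = (\<Sum>k\<in>{k\<in>K. 0 < \<mu> i k}. (cmod (cinner K w (q i k)))\<^sup>2)"
      using K by (intro sum.mono_neutral_right) (auto simp: q_def cinner_def)
    also have "\<dots> \<le> sqnorm K w" using K by (intro bessel qo that) simp
    finally show ?thesis .
  qed
  define Y where "Y a c = of_real (sqrt (lam a)) * cnj (u (fst a) (snd a) c)" for a c
  define X where "X a c = of_real (sqrt (lam a)) * cnj (q (fst a) (snd a) c)" for a c
  have sq: "complex_of_real (sqrt (lam a)) * complex_of_real (sqrt (lam a)) = of_real (lam a)" if "a \<in> I" for a
    using lam0[OF that] by (simp flip: of_real_mult)
  have S: "matmul I (adjoint Y) Y c c' = (\<Sum>i\<in>{1..m}. \<Sum>k\<in>K. of_real (sqrt (\<mu> i k)) * u i k c * cnj (u i k c'))" for c c'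
  proof -
    have "matmul I (adjoint Y) Y c c' = (\<Sum>a\<in>I. of_real (lam a) * u (fst a) (snd a) c * cnj (u (fst a) (snd a) c'))"
      unfolding matmul_def adjoint_def Y_def by (intro sum.cong refl) (simp add: mult_ac flip: sq)
    then show ?thesis by (simp add: I_def lam_def sum.cartesian_product case_prod_beta)
  qed
  have T: "matmul I (adjoint X) Y c c' = (\<Sum>i\<in>{1..m}. A i c c')" if c: "c \<in> K" "c' \<in> K" for c c'
  proof -
    have "matmul I (adjoint X) Y c c' = (\<Sum>a\<in>I. of_real (lam a) * q (fst a) (snd a) c * cnj (u (fst a) (snd a) c'))"
      unfolding matmul_def adjoint_def X_def Y_def by (intro sum.cong refl) (simp add: mult_ac flip: sq)
    also have "\<dots> = (\<Sum>i\<in>{1..m}. \<Sum>k\<in>K. of_real (sqrt (\<mu> i k)) * q i k c * cnj (u i k c'))"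
      by (simp add: I_def lam_def sum.cartesian_product case_prod_beta)
    also have "\<dots> = (\<Sum>i\<in>{1..m}. A i c c')"
    proof (rule sum.cong[OF refl])
      fix i assume i: "i \<in> {1..m}"
      have C: "(\<Sum>k\<in>K. u i k b * cnj (u i k c')) = (if b = c' then 1 else 0)" if "b \<in> K" for b
        using U[OF i] that c unfolding eigensys_def by blast
      have "(\<Sum>k\<in>K. of_real (sqrt (\<mu> i k)) * q i k c * cnj (u i k c')) = (\<Sum>k\<in>K. \<Sum>b\<in>K. A i c b * (u i k b * cnj (u i k c')))"
        by (intro sum.cong refl) (simp only: q_lam[OF i _ c(1)] matvec_def sum_distrib_right mult.assoc)
      also have "\<dots> = (\<Sum>b\<in>K. A i c b * (\<Sum>k\<in>K. u i k b * cnj (u i k c')))"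
        by (subst sum.swap) (simp add: sum_distrib_left)
      also have "\<dots> = (\<Sum>b\<in>K. if b = c' then A i c c' else 0)"
        by (intro sum.cong refl) (simp add: C)
      finally show "(\<Sum>k\<in>K. of_real (sqrt (\<mu> i k)) * q i k c * cnj (u i k c')) = A i c c'"
        using K c by simp
    qed
    finally show ?thesis .
  qed
  have "\<exists>e l. eigensys K e l (matmul I (adjoint X) X)"
    by (intro hermitian_eigensys K) (simp add: matmul_def adjoint_def mult.commute)
  then obtain eR \<rho> where ER: "eigensys K eR \<rho> (matmul I (adjoint X) X)" by blast
  have row: "(\<Sum>c\<in>K. (cmod (of_real (sqrt (lam a)) * cnj (w c)))\<^sup>2) = lam a * sqnorm K w" if "a \<in> I" for a w
    using lam0[OF that] by (simp add: norm_mult power_mult_distrib sqnorm_def sum_distrib_left)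
  \<comment> \<open>\<open>X^* X\<close> is the sum of the \<open>|A_i^*|\<close>, and the claim is
    that the trace of its \<open>p\<close>-th power is at most
    \<open>m^(p-1) \<Sum> Tr |A_i^*|^p\<close>. In the eigenbasis \<open>eR\<close> the diagonal
    entries of \<open>|A_i^*|\<close> are the \<open>\<xi> i k\<close>: the power mean inequality
    separates the blocks, then Jensen works within each block.\<close>
  have R: "(\<Sum>k\<in>K. pos_powr (2 * r) (\<rho> k)) \<le> (real m - 1 + 1) powr (2 * r - 1) * (\<Sum>a\<in>I. lam a powr (2 * r))"
  proof -
    define p where "p = 2 * r"
    have p: "1 \<le> p" using r by (simp add: p_def)
    define \<xi> where "\<xi> i k = (\<Sum>k'\<in>K. (cmod (cinner K (eR k) (q i k')))\<^sup>2 * lam (i, k'))" for i k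
    have \<xi>0: "0 \<le> \<xi> i k" if "i \<in> {1..m}" for i k
      using lam0 that unfolding \<xi>_def by (intro sum_nonneg mult_nonneg_nonneg) (auto simp: I_def)
    have \<rho>: "\<rho> k = (\<Sum>i\<in>{1..m}. \<xi> i k)" if k: "k \<in> K" for k
    proof -
      have "\<rho> k = sqnorm I (matvec K X (eR k))"
        using quadform_eigenvector[OF K ER k] by (simp add: quadform_gram')
      also have "\<dots> = (\<Sum>a\<in>I. (cmod (cinner K (eR k) (q (fst a) (snd a))))\<^sup>2 * lam a)"
        unfolding sqnorm_def
      proof (rule sum.cong[OF refl])
        fix a assume a: "a \<in> I"
        have "matvec K X (eR k) a = of_real (sqrt (lam a)) * cinner K (eR k) (q (fst a) (snd a))"
          by (simp add: matvec_def X_def cinner_def sum_distrib_left mult_ac)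
        then show "(cmod (matvec K X (eR k) a))\<^sup>2 = (cmod (cinner K (eR k) (q (fst a) (snd a))))\<^sup>2 * lam a"
          using lam0[OF a] by (simp add: norm_mult power_mult_distrib)
      qed
      also have "\<dots> = (\<Sum>i\<in>{1..m}. \<xi> i k)"
        by (simp add: I_def \<xi>_def sum.cartesian_product case_prod_beta)
      finally show ?thesis .
    qed
    have "(\<Sum>k\<in>K. pos_powr p (\<rho> k)) \<le> (\<Sum>k\<in>K. real m powr (p - 1) * (\<Sum>i\<in>{1..m}. pos_powr p (\<xi> i k)))"
    proof (rule sum_mono)
      fix k assume "k \<in> K"
      then show "pos_powr p (\<rho> k) \<le> real m powr (p - 1) * (\<Sum>i\<in>{1..m}. pos_powr p (\<xi> i k))"
        unfolding \<rho>[OF \<open>k \<in> K\<close>] using m p \<xi>0 by (intro pos_powr_sum_le) auto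
    qed
    also have "\<dots> \<le> (\<Sum>k\<in>K. real m powr (p - 1) * (\<Sum>i\<in>{1..m}. \<Sum>k'\<in>K. (cmod (cinner K (eR k) (q i k')))\<^sup>2 * pos_powr p (lam (i, k'))))"
    proof (intro sum_mono mult_left_mono)
      fix k i assume k: "k \<in> K" and i: "i \<in> {1..m}"
      show "pos_powr p (\<xi> i k) \<le> (\<Sum>k'\<in>K. (cmod (cinner K (eR k) (q i k')))\<^sup>2 * pos_powr p (lam (i, k')))"
        unfolding \<xi>_def using q_bessel[OF i, of "eR k"] eigensys_sqnorm[OF ER k]
        by (intro jensen_subconvex[OF K pos_powr_subgradient[OF p]]) auto
    qed simp
    also have "\<dots> = real m powr (p - 1) * (\<Sum>i\<in>{1..m}. \<Sum>k'\<in>K. (\<Sum>k\<in>K. (cmod (cinner K (eR k) (q i k')))\<^sup>2) * pos_powr p (lam (i, k')))"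
    proof -
      have "(\<Sum>k\<in>K. \<Sum>i\<in>{1..m}. \<Sum>k'\<in>K. (cmod (cinner K (eR k) (q i k')))\<^sup>2 * pos_powr p (lam (i, k'))) =
        (\<Sum>i\<in>{1..m}. \<Sum>k\<in>K. \<Sum>k'\<in>K. (cmod (cinner K (eR k) (q i k')))\<^sup>2 * pos_powr p (lam (i, k')))"
        by (rule sum.swap)
      also have "\<dots> = (\<Sum>i\<in>{1..m}. \<Sum>k'\<in>K. \<Sum>k\<in>K. (cmod (cinner K (eR k) (q i k')))\<^sup>2 * pos_powr p (lam (i, k')))"
        by (rule sum.cong[OF refl sum.swap])
      finally show ?thesis by (simp only: sum_distrib_left[symmetric] sum_distrib_right)
    qed
    also have "\<dots> \<le> real m powr (p - 1) * (\<Sum>i\<in>{1..m}. \<Sum>k'\<in>K. 1 * pos_powr p (lam (i, k')))"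
    proof (intro mult_left_mono sum_mono mult_right_mono)
      fix i k' assume "i \<in> {1..m}" "k' \<in> K"
      then show "(\<Sum>k\<in>K. (cmod (cinner K (eR k) (q i k')))\<^sup>2) \<le> 1"
        using parseval[OF K ER, of "q i k'"] q_sqnorm[of i k'] by (simp add: cmod_cinner_commute)
    qed auto
    also have "(\<Sum>i\<in>{1..m}. \<Sum>k'\<in>K. 1 * pos_powr p (lam (i, k'))) = (\<Sum>a\<in>I. pos_powr p (lam a))"
      by (simp add: I_def sum.cartesian_product case_prod_beta)
    also have "\<dots> = (\<Sum>a\<in>I. lam a powr p)"
      using lam0 by (intro sum.cong refl) (simp add: pos_powr_of_nonneg)
    finally show ?thesis by (simp add: p_def)
  qed
  show ?thesis
  proof (rule gram_pair_inequality[OF I K r x _ eq _ _ _ ER _ R])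
    show "0 \<le> real m - 1" using m by simp
    show "(\<Sum>c\<in>K. (cmod (Y a c))\<^sup>2) = lam a" if "a \<in> I" for a
      unfolding Y_def row[OF that] using eigensys_sqnorm[OF U] that by (auto simp: I_def)
    show "(\<Sum>c\<in>K. (cmod (X a c))\<^sup>2) = lam a" if "a \<in> I" for a
    proof -
      have ik: "fst a \<in> {1..m}" "snd a \<in> K" using that by (auto simp: I_def)
      show ?thesis unfolding X_def row[OF that] q_sqnorm[OF ik] using \<mu>0[OF ik] by (simp add: lam_def)
    qed
    show "eigensys K eS \<sigma> (matmul I (adjoint Y) Y)" using ES by (subst eigensys_cong[OF S])
    have "matmul K (adjoint (matmul I (adjoint X) Y)) (matmul I (adjoint X) Y) a b = matmul K (adjoint (\<lambda>c c'. \<Sum>i\<in>{1..m}. A i c c')) (\<lambda>c c'. \<Sum>i\<in>{1..m}. A i c c') a b"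
      if "a \<in> K" "b \<in> K" for a b
      unfolding matmul_def[of K] adjoint_def[of "matmul I (adjoint X) Y"] adjoint_def[of "\<lambda>c c'. \<Sum>i\<in>{1..m}. A i c c'"]
      using T that by (intro sum.cong refl) simp
    then show "eigensys K eT \<tau> (matmul K (adjoint (matmul I (adjoint X) Y)) (matmul I (adjoint X) Y))"
      using ET by (subst eigensys_cong)
  qed
qed

section \<open>Schatten norms of matrices\<close>

abbreviation entries :: "complex mat \<Rightarrow> nat \<Rightarrow> nat \<Rightarrow> complex" where
  "entries M \<equiv> \<lambda>i j. M $$ (i, j)"

text \<open>\<open>U diag(l) U^*\<close> for the matrix \<open>U\<close> with columns
  \<open>e k\<close>, written like the last conjunct of \<open>eigensys\<close>. Values of
  \<open>psd_powr\<close> and \<open>mat_abs\<close> are brought into this form.\<close>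

definition spectral_mat :: "nat \<Rightarrow> (nat \<Rightarrow> nat \<Rightarrow> complex) \<Rightarrow> (nat \<Rightarrow> real) \<Rightarrow> complex mat" where
  "spectral_mat n e l = mat n n (\<lambda>(i, j). \<Sum>k<n. of_real (l k) * e k i * cnj (e k j))"

lemma spectral_mat_carrier [simp]: "spectral_mat n e l \<in> carrier_mat n n"
  by (simp add: spectral_mat_def)

lemma spectral_mat_index [simp]:
  "i < n \<Longrightarrow> j < n \<Longrightarrow> spectral_mat n e l $$ (i, j) = (\<Sum>k<n. of_real (l k) * e k i * cnj (e k j))"
  by (simp add: spectral_mat_def)

lemma spectral_mat_dim [simp]: "dim_row (spectral_mat n e l) = n" "dim_col (spectral_mat n e l) = n"
  by (simp_all add: spectral_mat_def)

lemma mat_adjoint_index [simp]: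
  "i < dim_col A \<Longrightarrow> j < dim_row A \<Longrightarrow> mat_adjoint A $$ (i, j) = cnj (A $$ (j, i))"
  for A :: "complex mat"
  by (simp add: mat_adjoint_def mat_of_rows_index)

lemma mat_adjoint_dim [simp]: "dim_row (mat_adjoint A) = dim_col A" "dim_col (mat_adjoint A) = dim_row A"
  by (simp_all add: mat_adjoint_def)

lemma mat_adjoint_mult_index:
  assumes "A \<in> carrier_mat n n" "i < n" "j < n"
  shows "(mat_adjoint A * A) $$ (i, j) = matmul {..<n} (adjoint (entries A)) (entries A) i j"
  using assms by (simp add: scalar_prod_def matmul_def adjoint_def lessThan_atLeast0)

lemma diagonalization_index:
  assumes "U \<in> carrier_mat n n" "i < n" "j < n"
  shows "(U * mat_diag n f * mat_adjoint U) $$ (i, j) = (\<Sum>k<n. f k * U $$ (i, k) * cnj (U $$ (j, k)))"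
proof -
  have "U * mat_diag n f = mat n n (\<lambda>(i, j). U $$ (i, j) * f j)"
    using assms(1) by (rule mat_diag_mult_right)
  then show ?thesis using assms by (simp add: scalar_prod_def lessThan_atLeast0 mult_ac)
qed

text \<open>Together with the converse that follows, this identifies eigensystems with the unitary
  diagonalizations over which \<open>psd_powr\<close> quantifies.\<close>

lemma eigensys_imp_diagonalization:
  assumes E: "eigensys {..<n} e l (entries P)" and P: "P \<in> carrier_mat n n"
  defines "U \<equiv> mat n n (\<lambda>(i, k). e k i)"
  shows "unitary_mat n U" "P = U * mat_diag n (\<lambda>i. complex_of_real (l i)) * mat_adjoint U"
    "spectral_mat n e f = U * mat_diag n (\<lambda>i. complex_of_real (f i)) * mat_adjoint U"
proof -
  have U: "U \<in> carrier_mat n n" by (simp add: U_def)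
  have "(mat_adjoint U * U) $$ (i, j) = 1\<^sub>m n $$ (i, j)" if "i < n" "j < n" for i j
  proof -
    have "(mat_adjoint U * U) $$ (i, j) = cinner {..<n} (e j) (e i)"
      unfolding mat_adjoint_mult_index[OF U that] using that
      by (simp add: matmul_def adjoint_def cinner_def U_def mult.commute)
    then show ?thesis using E that by (auto simp: eigensys_def orthonormal_def)
  qed
  then show "unitary_mat n U" using U unfolding unitary_mat_def by (intro conjI eq_matI) auto
  show "spectral_mat n e f = U * mat_diag n (\<lambda>i. complex_of_real (f i)) * mat_adjoint U" for f
  proof (rule eq_matI)
    fix i j assume "i < dim_row (U * mat_diag n (\<lambda>i. complex_of_real (f i)) * mat_adjoint U)"
      "j < dim_col (U * mat_diag n (\<lambda>i. complex_of_real (f i)) * mat_adjoint U)"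
    then have ij: "i < n" "j < n" using U by auto
    then show "spectral_mat n e f $$ (i, j) = (U * mat_diag n (\<lambda>i. complex_of_real (f i)) * mat_adjoint U) $$ (i, j)"
      unfolding diagonalization_index[OF U ij] by (simp add: U_def)
  qed (use U in auto)
  then have "U * mat_diag n (\<lambda>i. complex_of_real (l i)) * mat_adjoint U = spectral_mat n e l" by simp
  also have "\<dots> = P"
    using E P by (intro eq_matI) (auto simp: eigensys_def)
  finally show "P = U * mat_diag n (\<lambda>i. complex_of_real (l i)) * mat_adjoint U" by simp
qed

lemma diagonalization_imp_eigensys:
  assumes U: "unitary_mat n U" and P: "P = U * mat_diag n (\<lambda>i. complex_of_real (l i)) * mat_adjoint U"
  shows "eigensys {..<n} (\<lambda>k i. U $$ (i, k)) l (entries P)"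
proof -
  have Uc: "U \<in> carrier_mat n n" and UU: "mat_adjoint U * U = 1\<^sub>m n" using U by (auto simp: unitary_mat_def)
  have aU: "mat_adjoint U \<in> carrier_mat n n" using Uc by (intro carrier_matI) auto
  have "U * mat_adjoint U = 1\<^sub>m n" by (rule mat_mult_left_right_inverse[OF aU Uc UU])
  then have C: "(U * mat_adjoint U) $$ (a, b) = 1\<^sub>m n $$ (a, b)" for a b by simp
  have O: "(mat_adjoint U * U) $$ (a, b) = 1\<^sub>m n $$ (a, b)" for a b using UU by simp
  have "cinner {..<n} (\<lambda>i. U $$ (i, a)) (\<lambda>i. U $$ (i, b)) = (if a = b then 1 else 0)" if "a < n" "b < n" for a b
    using O[of b a] that unfolding mat_adjoint_mult_index[OF Uc that(2,1)]
    by (auto simp: matmul_def adjoint_def cinner_def mult.commute)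
  moreover have "(\<Sum>k<n. U $$ (a, k) * cnj (U $$ (b, k))) = (if a = b then 1 else 0)" if "a < n" "b < n" for a b
    using C[of a b] that Uc by (simp add: scalar_prod_def lessThan_atLeast0)
  moreover have "P $$ (a, b) = (\<Sum>k<n. of_real (l k) * U $$ (a, k) * cnj (U $$ (b, k)))" if "a < n" "b < n" for a b
    unfolding P by (rule diagonalization_index[OF Uc that])
  ultimately show ?thesis by (simp add: eigensys_def orthonormal_def)
qed

lemma eigensys_expand:
  assumes I: "finite I" and E: "eigensys I e l M" and a: "a \<in> I"
  shows "v a = (\<Sum>k\<in>I. cinner I v (e k) * e k a)"
proof -
  have C: "(\<Sum>k\<in>I. e k a * cnj (e k b)) = (if a = b then 1 else 0)" if "b \<in> I" for b
    using E a that unfolding eigensys_def by blast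
  have "(\<Sum>k\<in>I. cinner I v (e k) * e k a) = (\<Sum>k\<in>I. \<Sum>b\<in>I. v b * (e k a * cnj (e k b)))"
    by (simp add: cinner_def sum_distrib_left sum_distrib_right mult_ac)
  also have "\<dots> = (\<Sum>b\<in>I. v b * (\<Sum>k\<in>I. e k a * cnj (e k b)))"
    by (subst sum.swap) (simp add: sum_distrib_left)
  also have "\<dots> = (\<Sum>b\<in>I. if a = b then v a else 0)" by (intro sum.cong refl) (simp add: C)
  finally show ?thesis using I a by simp
qed

text \<open>Two orthonormal eigenbases are related by a matrix that only connects equal eigenvalues.\<close>

lemma functional_calculus_unique:
  assumes I: "finite I" and E: "eigensys I e l M" and E': "eigensys I e' l' M" and a: "a \<in> I" and b: "b \<in> I"
  shows "(\<Sum>k\<in>I. of_real (f (l k)) * e k a * cnj (e k b)) = (\<Sum>k\<in>I. of_real (f (l' k)) * e' k a * cnj (e' k b))"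
proof -
  define c where "c j k = cinner I (e j) (e' k)" for j k
  have herm: "adjoint M x y = M x y" if "x \<in> I" "y \<in> I" for x y
  proof -
    have "M x y = (\<Sum>k\<in>I. of_real (l k) * e k x * cnj (e k y))"
      "M y x = (\<Sum>k\<in>I. of_real (l k) * e k y * cnj (e k x))"
      using E that unfolding eigensys_def by blast+
    then show ?thesis by (simp add: adjoint_def mult_ac)
  qed
  have lc: "of_real (f (l j)) * c j k = of_real (f (l' k)) * c j k" if "j \<in> I" "k \<in> I" for j k
  proof -
    have "of_real (l j) * c j k = cinner I (matvec I M (e j)) (e' k)"
      unfolding c_def cinner_scale_left[symmetric] using matvec_eigensys[OF I E that(1)] by (intro cinner_cong) auto
    also have "\<dots> = cinner I (e j) (matvec I M (e' k))"
      unfolding cinner_matvec matvec_def using herm by (intro cinner_cong refl sum.cong) auto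
    also have "\<dots> = cinner I (e j) (\<lambda>x. of_real (l' k) * e' k x)"
      using matvec_eigensys[OF I E' that(2)] by (intro cinner_cong) auto
    also have "\<dots> = of_real (l' k) * c j k" by (simp add: cinner_scale_right c_def)
    finally show ?thesis by (cases "c j k = 0") auto
  qed
  have 1: "cnj (e j b) = (\<Sum>k\<in>I. cnj (c j k) * cnj (e' k b))" for j
    using arg_cong[OF eigensys_expand[OF I E' b, of "e j"], of cnj] by (simp add: c_def)
  have 2: "e' k a = (\<Sum>j\<in>I. cnj (c j k) * e j a)" for k
    using eigensys_expand[OF I E a, of "e' k"] by (simp add: c_def cnj_cinner)
  have "(\<Sum>j\<in>I. of_real (f (l j)) * e j a * cnj (e j b)) =
      (\<Sum>j\<in>I. \<Sum>k\<in>I. cnj (of_real (f (l j)) * c j k) * (e j a * cnj (e' k b)))"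
    by (simp add: 1 sum_distrib_left mult_ac)
  also have "\<dots> = (\<Sum>k\<in>I. \<Sum>j\<in>I. cnj (of_real (f (l j)) * c j k) * (e j a * cnj (e' k b)))"
    by (rule sum.swap)
  also have "\<dots> = (\<Sum>k\<in>I. \<Sum>j\<in>I. cnj (of_real (f (l' k)) * c j k) * (e j a * cnj (e' k b)))"
    by (intro sum.cong refl) (simp only: lc)
  also have "\<dots> = (\<Sum>k\<in>I. of_real (f (l' k)) * e' k a * cnj (e' k b))"
    by (simp add: 2 sum_distrib_left sum_distrib_right mult_ac)
  finally show ?thesis .
qed

text \<open>Resolves the definite description: all diagonalizations with nonnegative eigenvalues
  give the same power, because the functional calculus depends on the matrix alone.\<close>

lemma psd_powr_eq:
  assumes P: "P \<in> carrier_mat n n" and E: "eigensys {..<n} e l (entries P)" and l: "\<And>k. k < n \<Longrightarrow> 0 \<le> l k"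
  shows "psd_powr P r = spectral_mat n e (\<lambda>k. l k powr r)"
proof -
  have dim: "dim_row P = n" using P by simp
  show ?thesis unfolding psd_powr_def dim
  proof (rule the_equality)
    let ?U = "mat n n (\<lambda>(i, k). e k i)"
    show "\<exists>U la. unitary_mat n U \<and> (\<forall>i<n. 0 \<le> la i) \<and>
      P = U * mat_diag n (\<lambda>i. complex_of_real (la i)) * mat_adjoint U \<and>
      spectral_mat n e (\<lambda>k. l k powr r) = U * mat_diag n (\<lambda>i. complex_of_real (la i powr r)) * mat_adjoint U"
      using eigensys_imp_diagonalization[OF E P] l by (intro exI[of _ ?U] exI[of _ l]) auto
  next
    fix B
    assume "\<exists>U la. unitary_mat n U \<and> (\<forall>i<n. 0 \<le> la i) \<and>
      P = U * mat_diag n (\<lambda>i. complex_of_real (la i)) * mat_adjoint U \<and>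
      B = U * mat_diag n (\<lambda>i. complex_of_real (la i powr r)) * mat_adjoint U"
    then obtain U la where U: "unitary_mat n U"
      and PU: "P = U * mat_diag n (\<lambda>i. complex_of_real (la i)) * mat_adjoint U"
      and B: "B = U * mat_diag n (\<lambda>i. complex_of_real (la i powr r)) * mat_adjoint U" by blast
    have Uc: "U \<in> carrier_mat n n" using U by (simp add: unitary_mat_def)
    note E' = diagonalization_imp_eigensys[OF U PU]
    show "B = spectral_mat n e (\<lambda>k. l k powr r)"
    proof (rule eq_matI)
      fix i j assume "i < dim_row (spectral_mat n e (\<lambda>k. l k powr r))" "j < dim_col (spectral_mat n e (\<lambda>k. l k powr r))"
      then have ij: "i < n" "j < n" by auto
      show "B $$ (i, j) = spectral_mat n e (\<lambda>k. l k powr r) $$ (i, j)"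
        using functional_calculus_unique[OF _ E' E, of i j "\<lambda>t. t powr r"] ij
        by (simp add: B diagonalization_index[OF Uc ij])
    qed (use Uc B in auto)
  qed
qed

lemma eigensys_spectral_mat:
  assumes "eigensys {..<n} e l M"
  shows "eigensys {..<n} e f (entries (spectral_mat n e f))"
  using assms by (simp add: eigensys_def)

lemma mat_abs_eq:
  assumes A: "A \<in> carrier_mat n n" and E: "eigensys {..<n} e \<mu> (matmul {..<n} (adjoint (entries A)) (entries A))"
  shows "mat_abs A = spectral_mat n e (\<lambda>k. sqrt (\<mu> k))"
proof -
  have \<mu>: "0 \<le> \<mu> k" if "k < n" for k
    using eigenvalue_gram[of "{..<n}" e \<mu> "{..<n}" "adjoint (entries A)" k] E that by simp
  have "eigensys {..<n} e \<mu> (entries (mat_adjoint A * A))"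
    using E by (subst eigensys_cong[where N = "matmul {..<n} (adjoint (entries A)) (entries A)"]) (auto intro: mat_adjoint_mult_index[OF A])
  moreover have "mat_adjoint A * A \<in> carrier_mat n n" using A by (intro carrier_matI) auto
  ultimately have "mat_abs A = spectral_mat n e (\<lambda>k. \<mu> k powr (1/2))"
    unfolding mat_abs_def using \<mu> by (intro psd_powr_eq) auto
  also have "\<dots> = spectral_mat n e (\<lambda>k. sqrt (\<mu> k))"
    using \<mu> by (intro eq_matI) (auto simp: powr_half_sqrt)
  finally show ?thesis .
qed

lemma mat_trace_spectral_mat:
  assumes "eigensys {..<n} e l M"
  shows "mat_trace (spectral_mat n e f) = of_real (\<Sum>k<n. f k)"
proof -
  have "mat_trace (spectral_mat n e f) = (\<Sum>i<n. \<Sum>k<n. of_real (f k) * (e k i * cnj (e k i)))"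
    by (simp add: mat_trace_def mult.assoc)
  also have "\<dots> = (\<Sum>k<n. of_real (f k) * cinner {..<n} (e k) (e k))"
    by (subst sum.swap) (simp add: cinner_def sum_distrib_left)
  also have "\<dots> = of_real (\<Sum>k<n. f k)"
    using assms by (simp add: eigensys_def orthonormal_def)
  finally show ?thesis .
qed

lemma schatten_norm_eq:
  assumes A: "A \<in> carrier_mat n n" and E: "eigensys {..<n} e \<mu> (matmul {..<n} (adjoint (entries A)) (entries A))"
  shows "schatten_norm (ereal q) A = (\<Sum>k<n. \<mu> k powr (q / 2)) powr (1 / q)"
proof -
  have \<mu>: "0 \<le> \<mu> k" if "k < n" for k
    using eigenvalue_gram[of "{..<n}" e \<mu> "{..<n}" "adjoint (entries A)" k] E that by simp
  have "psd_powr (mat_abs A) q = spectral_mat n e (\<lambda>k. sqrt (\<mu> k) powr q)"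
    unfolding mat_abs_eq[OF A E] using \<mu> by (intro psd_powr_eq eigensys_spectral_mat[OF E]) auto
  also have "\<dots> = spectral_mat n e (\<lambda>k. \<mu> k powr (q / 2))"
    using \<mu> by (intro eq_matI) (auto simp: powr_powr simp flip: powr_half_sqrt)
  finally show ?thesis by (simp add: schatten_norm_def mat_trace_spectral_mat[OF E])
qed

lemma eigensys_square:
  assumes I: "finite I" and E: "eigensys I e l M"
  shows "eigensys I e (\<lambda>k. (l k)\<^sup>2) (matmul I (adjoint M) M)"
proof -
  have M: "M a b = (\<Sum>k\<in>I. of_real (l k) * e k a * cnj (e k b))" if "a \<in> I" "b \<in> I" for a b
    using E that unfolding eigensys_def by blast
  have "matmul I (adjoint M) M a b = (\<Sum>k\<in>I. of_real ((l k)\<^sup>2) * e k a * cnj (e k b))" if "a \<in> I" "b \<in> I" for a b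
  proof -
    have "matmul I (adjoint M) M a b = (\<Sum>c\<in>I. \<Sum>k\<in>I. M a c * (of_real (l k) * e k c * cnj (e k b)))"
      unfolding matmul_def
    proof (rule sum.cong[OF refl])
      fix c assume c: "c \<in> I"
      have "adjoint M a c = M a c" using M[OF that(1) c] M[OF c that(1)] by (simp add: adjoint_def mult_ac)
      then show "adjoint M a c * M c b = (\<Sum>k\<in>I. M a c * (of_real (l k) * e k c * cnj (e k b)))"
        using M[OF c that(2)] by (simp add: sum_distrib_left)
    qed
    also have "\<dots> = (\<Sum>k\<in>I. of_real (l k) * matvec I M (e k) a * cnj (e k b))"
      by (subst sum.swap) (simp add: matvec_def sum_distrib_left sum_distrib_right mult_ac)
    also have "\<dots> = (\<Sum>k\<in>I. of_real ((l k)\<^sup>2) * e k a * cnj (e k b))"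
      by (intro sum.cong refl) (simp add: matvec_eigensys[OF I E _ that(1)] power2_eq_square)
    finally show ?thesis .
  qed
  then show ?thesis using E by (auto simp: eigensys_def)
qed

text \<open>Squaring the eigenvalues of \<open>P\<close> gives an eigensystem of
  \<open>A^* A\<close>, and the positive square root is unique. This lets the extremal example name
  its absolute values without computing eigenvectors.\<close>

lemma mat_abs_eqI:
  assumes A: "A \<in> carrier_mat n n" and P: "P \<in> carrier_mat n n" and E: "eigensys {..<n} e l (entries P)"
    and l: "\<And>k. k < n \<Longrightarrow> 0 \<le> l k"
    and AP: "\<And>i j. i < n \<Longrightarrow> j < n \<Longrightarrow> matmul {..<n} (adjoint (entries A)) (entries A) i j = matmul {..<n} (adjoint (entries P)) (entries P) i j"
  shows "mat_abs A = P"
proof -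
  have "eigensys {..<n} e (\<lambda>k. (l k)\<^sup>2) (matmul {..<n} (adjoint (entries A)) (entries A))"
    using eigensys_square[OF _ E] by (subst eigensys_cong[OF AP]) auto
  then have "mat_abs A = spectral_mat n e (\<lambda>k. sqrt ((l k)\<^sup>2))" by (rule mat_abs_eq[OF A])
  also have "\<dots> = P" using l E P by (intro eq_matI) (auto simp: eigensys_def)
  finally show ?thesis .
qed

lemma schatten_norm_psd:
  assumes P: "P \<in> carrier_mat n n" and E: "eigensys {..<n} e l (entries P)" and l: "\<And>k. k < n \<Longrightarrow> 0 \<le> l k"
  shows "schatten_norm (ereal q) P = (\<Sum>k<n. l k powr q) powr (1 / q)"
proof -
  have "(l k)\<^sup>2 powr (q / 2) = l k powr q" if "k < n" for k
    using l[OF that] by (cases "l k = 0") (simp_all add: powr_powr flip: powr_numeral)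
  then show ?thesis
    using schatten_norm_eq[OF P eigensys_square[OF _ E], of q] by simp
qed

lemma mat_sum_carrier_index:
  assumes "\<forall>i\<in>{1..m}. A i \<in> carrier_mat d d"
  shows "mat_sum d m A \<in> carrier_mat d d \<and> (\<forall>a<d. \<forall>b<d. mat_sum d m A $$ (a, b) = (\<Sum>i\<in>{1..m}. A i $$ (a, b)))"
proof -
  interpret abelian_group "module_mat TYPE(complex) d d" by (rule abelian_group_mat)
  have "finsum (module_mat TYPE(complex) d d) A J \<in> carrier_mat d d \<and>
    (\<forall>a<d. \<forall>b<d. finsum (module_mat TYPE(complex) d d) A J $$ (a, b) = (\<Sum>i\<in>J. A i $$ (a, b)))"
    if "finite J" "\<forall>i\<in>J. A i \<in> carrier_mat d d" for J
    using that
  proof (induction J)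
    case empty
    then show ?case by (simp add: module_mat_simps)
  next
    case (insert j J)
    then have "A \<in> J \<rightarrow> carrier (module_mat TYPE(complex) d d)" "A j \<in> carrier (module_mat TYPE(complex) d d)"
      by (auto simp: module_mat_simps)
    then have "finsum (module_mat TYPE(complex) d d) A (insert j J) = A j + finsum (module_mat TYPE(complex) d d) A J"
      using finsum_insert[OF insert(1,2)] by (simp add: module_mat_simps)
    then show ?case using insert by auto
  qed
  then show ?thesis using assms by blast
qed

text \<open>The entrywise formula matches the matrix in the trace inequality. The formula for the
  quadratic form shows that the sum is positive semidefinite and dominates each
  \<open>|A_i|\<close>, which the operator norm bound uses.\<close>

lemma mat_abs_sum_eigensys:
  assumes A: "\<And>i. i \<in> {1..m} \<Longrightarrow> A i \<in> carrier_mat d d"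
    and U: "\<And>i. i \<in> {1..m} \<Longrightarrow> eigensys {..<d} (u i) (\<mu> i) (matmul {..<d} (adjoint (entries (A i))) (entries (A i)))"
  obtains e \<sigma> where "eigensys {..<d} e \<sigma> (entries (mat_sum d m (\<lambda>i. mat_abs (A i))))"
    "mat_sum d m (\<lambda>i. mat_abs (A i)) \<in> carrier_mat d d"
    "\<And>a b. a < d \<Longrightarrow> b < d \<Longrightarrow> mat_sum d m (\<lambda>i. mat_abs (A i)) $$ (a, b) =
      (\<Sum>i\<in>{1..m}. \<Sum>k<d. of_real (sqrt (\<mu> i k)) * u i k a * cnj (u i k b))"
    "\<And>v. quadform {..<d} (entries (mat_sum d m (\<lambda>i. mat_abs (A i)))) v =
      (\<Sum>i\<in>{1..m}. \<Sum>k<d. sqrt (\<mu> i k) * (cmod (cinner {..<d} v (u i k)))\<^sup>2)"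
proof -
  define S where "S = mat_sum d m (\<lambda>i. mat_abs (A i))"
  let ?I = "{..<d}"
  have abs: "mat_abs (A i) = spectral_mat d (u i) (\<lambda>k. sqrt (\<mu> i k))" if "i \<in> {1..m}" for i
    by (rule mat_abs_eq[OF A[OF that] U[OF that]])
  then have "\<forall>i\<in>{1..m}. mat_abs (A i) \<in> carrier_mat d d" by simp
  note S = mat_sum_carrier_index[OF this, folded S_def]
  have S_index: "S $$ (a, b) = (\<Sum>i\<in>{1..m}. \<Sum>k<d. of_real (sqrt (\<mu> i k)) * u i k a * cnj (u i k b))"
    if "a < d" "b < d" for a b
    using S that by (auto simp: abs intro!: sum.cong)
  have "\<exists>e l. eigensys ?I e l (entries S)"
    by (intro hermitian_eigensys) (auto simp: S_index mult_ac)
  then obtain e \<sigma> where E: "eigensys ?I e \<sigma> (entries S)" by blast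
  have "quadform ?I (entries S) v = (\<Sum>i\<in>{1..m}. \<Sum>k<d. sqrt (\<mu> i k) * (cmod (cinner ?I v (u i k)))\<^sup>2)" for v
  proof -
    have "matvec ?I (entries S) v a = (\<Sum>i\<in>{1..m}. matvec ?I (entries (mat_abs (A i))) v a)" if "a \<in> ?I" for a
    proof -
      have "matvec ?I (entries S) v a = (\<Sum>b<d. \<Sum>i\<in>{1..m}. mat_abs (A i) $$ (a, b) * v b)"
        using S that by (simp add: matvec_def sum_distrib_right)
      also have "\<dots> = (\<Sum>i\<in>{1..m}. matvec ?I (entries (mat_abs (A i))) v a)"
        by (subst sum.swap) (simp add: matvec_def)
      finally show ?thesis .
    qed
    then have "cinner ?I (matvec ?I (entries S) v) v = cinner ?I (\<lambda>a. \<Sum>i\<in>{1..m}. matvec ?I (entries (mat_abs (A i))) v a) v"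
      by (intro cinner_cong) auto
    then have "quadform ?I (entries S) v = (\<Sum>i\<in>{1..m}. quadform ?I (entries (mat_abs (A i))) v)"
      by (simp add: quadform_def cinner_sum_left)
    also have "\<dots> = (\<Sum>i\<in>{1..m}. \<Sum>k<d. sqrt (\<mu> i k) * (cmod (cinner ?I v (u i k)))\<^sup>2)"
      using quadform_eigensys[OF eigensys_spectral_mat[OF U]] by (intro sum.cong refl) (simp add: abs)
    finally show ?thesis .
  qed
  with E S S_index show thesis by (intro that[folded S_def]) auto
qed

section \<open>The upper bound for finite exponents\<close>

theorem schatten_norm_sum_le:
  fixes q :: real
  assumes m: "1 \<le> m" and q: "2 \<le> q" and A: "\<And>i. i \<in> {1..m} \<Longrightarrow> A i \<in> carrier_mat d d"
  shows "schatten_norm (ereal q) (mat_sum d m A) \<le>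
    C_const (ereal q) m * schatten_norm (ereal q) (mat_sum d m (\<lambda>i. mat_abs (A i)))"
proof -
  let ?I = "{..<d}"
  define x where "x = x_sol q m"
  define n where "n = real m - 1"
  define r where "r = q / 2"
  have n: "0 \<le> n" using m by (simp add: n_def)
  have "1 < x \<and> x powr q = 2 * x + real m - 1"
    unfolding x_def x_sol_def
    using theI'[OF ex1_x_sol[OF q n]] by (simp add: n_def algebra_simps)
  then have x: "1 < x" and xq: "x powr q = 2 * x + n" by (auto simp: n_def)
  have "\<exists>u \<mu>. eigensys ?I u \<mu> (matmul ?I (adjoint (entries (A i))) (entries (A i)))" for i
    by (intro hermitian_eigensys) (auto simp: matmul_def adjoint_def mult.commute)
  then obtain u \<mu> where U: "\<And>i. eigensys ?I (u i) (\<mu> i) (matmul ?I (adjoint (entries (A i))) (entries (A i)))" by metis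
  define S where "S = mat_sum d m (\<lambda>i. mat_abs (A i))"
  define T where "T = mat_sum d m A"
  obtain e \<sigma> where ES: "eigensys ?I e \<sigma> (entries S)" and Sc: "S \<in> carrier_mat d d"
    and S_index: "\<And>a b. a < d \<Longrightarrow> b < d \<Longrightarrow> S $$ (a, b) =
      (\<Sum>i\<in>{1..m}. \<Sum>k<d. of_real (sqrt (\<mu> i k)) * u i k a * cnj (u i k b))"
    and S_quadform: "\<And>v. quadform ?I (entries S) v =
      (\<Sum>i\<in>{1..m}. \<Sum>k<d. sqrt (\<mu> i k) * (cmod (cinner ?I v (u i k)))\<^sup>2)"
    by (rule mat_abs_sum_eigensys[where A = A and m = m and d = d and u = u and \<mu> = \<mu>, OF A U, folded S_def]) blast+
  have \<mu>0: "0 \<le> \<mu> i k" if "k < d" for i k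
    using eigenvalue_gram[of ?I "u i" "\<mu> i" ?I "adjoint (entries (A i))" k] U that by simp
  have \<sigma>0: "0 \<le> \<sigma> k" if "k < d" for k
    using quadform_eigenvector[OF _ ES, of k] that \<mu>0 unfolding S_quadform
    by (metis (no_types, lifting) finite_lessThan lessThan_iff mult_nonneg_nonneg real_sqrt_ge_0_iff sum_nonneg zero_le_power2)
  have T_props: "T \<in> carrier_mat d d" "\<And>a b. a < d \<Longrightarrow> b < d \<Longrightarrow> T $$ (a, b) = (\<Sum>i\<in>{1..m}. A i $$ (a, b))"
    using mat_sum_carrier_index[of m A d, folded T_def] A by auto
  have "\<exists>e l. eigensys ?I e l (matmul ?I (adjoint (entries T)) (entries T))"
    by (intro hermitian_eigensys) (auto simp: matmul_def adjoint_def mult.commute)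
  then obtain eT \<tau> where ET: "eigensys ?I eT \<tau> (matmul ?I (adjoint (entries T)) (entries T))" by blast
  have ES': "eigensys ?I e \<sigma> (\<lambda>c c'. \<Sum>i\<in>{1..m}. \<Sum>k\<in>?I. of_real (sqrt (\<mu> i k)) * u i k c * cnj (u i k c'))"
    using ES by (subst (asm) eigensys_cong[OF S_index]) auto
  have "matmul ?I (adjoint (entries T)) (entries T) a b =
      matmul ?I (adjoint (\<lambda>c c'. \<Sum>i\<in>{1..m}. entries (A i) c c')) (\<lambda>c c'. \<Sum>i\<in>{1..m}. entries (A i) c c') a b" if "a < d" "b < d" for a b
    unfolding matmul_def adjoint_def using that by (intro sum.cong refl) (simp add: T_props(2))
  then have ET': "eigensys ?I eT \<tau> (matmul ?I (adjoint (\<lambda>c c'. \<Sum>i\<in>{1..m}. entries (A i) c c')) (\<lambda>c c'. \<Sum>i\<in>{1..m}. entries (A i) c c'))"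
    using ET by (subst (asm) eigensys_cong) auto
  define s\<tau> where "s\<tau> = (\<Sum>k<d. \<tau> k powr r)"
  define s\<sigma> where "s\<sigma> = (\<Sum>k<d. \<sigma> k powr q)"
  have "2 * (x + n) / x powr r * s\<tau> \<le> (x + n) powr r * (\<Sum>k<d. pos_powr q (\<sigma> k))"
    using sum_abs_trace_inequality[where K = ?I and m = m and r = r and x = x and A = "\<lambda>i. entries (A i)" and u = u, OF _ m _ x _ U ES' ET'] q xq
    by (simp add: n_def r_def s\<tau>_def)
  also have "(\<Sum>k<d. pos_powr q (\<sigma> k)) = s\<sigma>"
    unfolding s\<sigma>_def using \<sigma>0 by (intro sum.cong refl) (simp add: pos_powr_of_nonneg)
  finally have main: "2 * (x + n) / x powr r * s\<tau> \<le> (x + n) powr r * s\<sigma>" .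
  have pos: "0 < x powr r" "0 < x + n" using x n by auto
  have "s\<tau> \<le> (x * (x + n)) powr r / (2 * (x + n)) * s\<sigma>"
  proof -
    have "x powr r / (2 * (x + n)) * (2 * (x + n) / x powr r * s\<tau>) \<le> x powr r / (2 * (x + n)) * ((x + n) powr r * s\<sigma>)"
      using pos by (intro mult_left_mono[OF main]) auto
    then show ?thesis using pos x by (simp add: powr_mult)
  qed
  \<comment> \<open>The equation for \<open>x\<close> turns the constant of the trace inequality
    into the denominator of \<open>C_const\<close>.\<close>
  also have "2 * (x + n) = x powr q + n" using xq by simp
  finally have le: "s\<tau> \<le> (x * (x + n)) powr r / (x powr q + n) * s\<sigma>" .
  have s0: "0 \<le> s\<tau>" "0 \<le> s\<sigma>" by (auto simp: s\<tau>_def s\<sigma>_def intro!: sum_nonneg)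
  have "schatten_norm (ereal q) T = s\<tau> powr (1 / q)"
    unfolding s\<tau>_def r_def by (rule schatten_norm_eq[OF T_props(1) ET])
  also have "\<dots> \<le> ((x * (x + n)) powr r / (x powr q + n) * s\<sigma>) powr (1 / q)"
    using s0 q le by (intro powr_mono2) auto
  also have "\<dots> = ((x * (x + n)) powr r) powr (1 / q) / (x powr q + n) powr (1 / q) * s\<sigma> powr (1 / q)"
    using s0 x n by (simp add: powr_mult powr_divide)
  also have "((x * (x + n)) powr r) powr (1 / q) = sqrt (x * (x + n))"
    using x n q by (simp add: powr_powr r_def flip: powr_half_sqrt)
  also have "s\<sigma> powr (1 / q) = schatten_norm (ereal q) S"
    unfolding s\<sigma>_def using schatten_norm_psd[OF Sc ES \<sigma>0] by simp
  finally show ?thesis unfolding S_def[symmetric] T_def[symmetric]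
    by (simp add: C_const_def Let_def x_def[symmetric] n_def add_diff_eq)
qed

section \<open>The operator norm and the upper bound for the infinite exponent\<close>

lemma vec_norm_eq:
  "v \<in> carrier_vec d \<Longrightarrow> vec_norm v = sqrt (sqnorm {..<d} (\<lambda>i. v $ i))"
  by (simp add: vec_norm_def scalar_prod_def sqnorm_def lessThan_atLeast0 complex_norm_square[symmetric] del: of_real_power)

lemma vec_norm_mult_eq:
  assumes "A \<in> carrier_mat d d" "v \<in> carrier_vec d"
  shows "vec_norm (A *\<^sub>v v) = sqrt (sqnorm {..<d} (matvec {..<d} (entries A) (\<lambda>i. v $ i)))"
proof -
  have "A *\<^sub>v v \<in> carrier_vec d" using assms by simp
  moreover have "(A *\<^sub>v v) $ i = matvec {..<d} (entries A) (\<lambda>i. v $ i) i" if "i < d" for i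
    using assms that by (simp add: matvec_def scalar_prod_def lessThan_atLeast0)
  ultimately show ?thesis unfolding vec_norm_eq[OF \<open>A *\<^sub>v v \<in> carrier_vec d\<close>]
    by (intro arg_cong[where f = sqrt] sqnorm_cong) auto
qed

text \<open>A real supremum is only meaningful for a set bounded above. The bound used is crude, the
  root of the sum of the eigenvalues of \<open>A^* A\<close>.\<close>

lemma op_norm_bdd_above:
  assumes A: "A \<in> carrier_mat d d"
  shows "bdd_above ((\<lambda>v. vec_norm (A *\<^sub>v v)) ` {v \<in> carrier_vec (dim_col A). vec_norm v \<le> 1})"
proof -
  have "\<exists>e l. eigensys {..<d} e l (matmul {..<d} (adjoint (entries A)) (entries A))"
    by (intro hermitian_eigensys) (auto simp: matmul_def adjoint_def mult.commute)
  then obtain e \<mu> where E: "eigensys {..<d} e \<mu> (matmul {..<d} (adjoint (entries A)) (entries A))" by blast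
  have \<mu>0: "0 \<le> \<mu> k" if "k < d" for k
    using eigenvalue_gram[of "{..<d}" e \<mu> "{..<d}" "adjoint (entries A)" k] E that by simp
  have "vec_norm (A *\<^sub>v v) \<le> sqrt (\<Sum>k<d. \<mu> k)" if v: "v \<in> carrier_vec d" "vec_norm v \<le> 1" for v
  proof -
    let ?v = "\<lambda>i. v $ i"
    have v1: "sqnorm {..<d} ?v \<le> 1" using v by (simp add: vec_norm_eq)
    have "sqnorm {..<d} (matvec {..<d} (entries A) ?v) = (\<Sum>k<d. \<mu> k * (cmod (cinner {..<d} ?v (e k)))\<^sup>2)"
      using quadform_eigensys[OF E, of ?v] by (simp add: quadform_gram')
    also have "\<dots> \<le> (\<Sum>k<d. \<mu> k * 1)"
    proof (intro sum_mono mult_left_mono)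
      fix k assume "k \<in> {..<d}"
      then show "(cmod (cinner {..<d} ?v (e k)))\<^sup>2 \<le> 1"
        using cauchy_schwarz[OF eigensys_sqnorm[OF E], of k ?v] v1 by simp
    qed (use \<mu>0 in auto)
    finally show ?thesis using v A by (simp add: vec_norm_mult_eq)
  qed
  then show ?thesis using A by (intro bdd_aboveI2) auto
qed

lemma vec_norm_le_op_norm:
  assumes A: "A \<in> carrier_mat d d" and v: "sqnorm {..<d} v \<le> 1"
  shows "sqnorm {..<d} (matvec {..<d} (entries A) v) \<le> (op_norm A)\<^sup>2" "0 \<le> op_norm A"
proof -
  let ?w = "vec d v"
  have w: "?w \<in> carrier_vec d" by simp
  have eq: "sqnorm {..<d} (\<lambda>i. ?w $ i) = sqnorm {..<d} v" "matvec {..<d} (entries A) (\<lambda>i. ?w $ i) = matvec {..<d} (entries A) v"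
    by (auto intro: sqnorm_cong matvec_cong)
  have "vec_norm (A *\<^sub>v ?w) \<le> op_norm A"
    unfolding op_norm_def using A v w eq by (intro cSUP_upper op_norm_bdd_above[OF A]) (auto simp: vec_norm_eq)
  then have le: "sqrt (sqnorm {..<d} (matvec {..<d} (entries A) v)) \<le> op_norm A"
    using vec_norm_mult_eq[OF A w] eq by simp
  then show "sqnorm {..<d} (matvec {..<d} (entries A) v) \<le> (op_norm A)\<^sup>2" by (rule sqrt_le_D)
  show "0 \<le> op_norm A" using le by (meson order_trans real_sqrt_ge_0_iff sqnorm_nonneg)
qed

lemma op_norm_leI:
  assumes A: "A \<in> carrier_mat d d" and c: "0 \<le> c"
    and le: "\<And>v. sqnorm {..<d} v \<le> 1 \<Longrightarrow> sqnorm {..<d} (matvec {..<d} (entries A) v) \<le> c\<^sup>2"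
  shows "op_norm A \<le> c"
  unfolding op_norm_def
proof (rule cSUP_least)
  have "0\<^sub>v d \<in> {v \<in> carrier_vec (dim_col A). vec_norm v \<le> 1}"
    using A by (simp add: vec_norm_eq[of _ d] sqnorm_def)
  then show "{v \<in> carrier_vec (dim_col A). vec_norm v \<le> 1} \<noteq> {}" by blast
  fix v assume "v \<in> {v \<in> carrier_vec (dim_col A). vec_norm v \<le> 1}"
  then have v: "v \<in> carrier_vec d" "sqnorm {..<d} (\<lambda>i. v $ i) \<le> 1" using A by (auto simp: vec_norm_eq)
  show "vec_norm (A *\<^sub>v v) \<le> c"
    using le[OF v(2)] c by (simp add: vec_norm_mult_eq[OF A v(1)] real_le_lsqrt)
qed

text \<open>With \<open>N\<close> the norm of \<open>S\<close>, each
  \<open>|A_i| \<le> S \<le> N\<close>, hence \<open>|A_i|^2 \<le> N |A_i|\<close>. On the unit ball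
  the squared norm of \<open>T v\<close> is at most \<open>m\<close> times the quadratic form of the
  sum of the \<open>|A_i|^2\<close>, hence at most \<open>m N\<close> times that of
  \<open>S\<close>, hence at most \<open>m N^2\<close>.\<close>

theorem op_norm_sum_le:
  assumes m: "1 \<le> m" and A: "\<And>i. i \<in> {1..m} \<Longrightarrow> A i \<in> carrier_mat d d"
  shows "op_norm (mat_sum d m A) \<le> sqrt (real m) * op_norm (mat_sum d m (\<lambda>i. mat_abs (A i)))"
proof -
  let ?I = "{..<d}"
  have "\<exists>u \<mu>. eigensys ?I u \<mu> (matmul ?I (adjoint (entries (A i))) (entries (A i)))" for i
    by (intro hermitian_eigensys) (auto simp: matmul_def adjoint_def mult.commute)
  then obtain u \<mu> where U: "\<And>i. eigensys ?I (u i) (\<mu> i) (matmul ?I (adjoint (entries (A i))) (entries (A i)))" by metis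
  define S where "S = mat_sum d m (\<lambda>i. mat_abs (A i))"
  define T where "T = mat_sum d m A"
  obtain e \<sigma> where ES: "eigensys ?I e \<sigma> (entries S)" and Sc: "S \<in> carrier_mat d d"
    and S_quadform: "\<And>v. quadform ?I (entries S) v =
      (\<Sum>i\<in>{1..m}. \<Sum>k<d. sqrt (\<mu> i k) * (cmod (cinner ?I v (u i k)))\<^sup>2)"
    by (rule mat_abs_sum_eigensys[where A = A and m = m and d = d and u = u and \<mu> = \<mu>, OF A U, folded S_def]) blast+
  have \<mu>0: "0 \<le> \<mu> i k" if "k < d" for i k
    using eigenvalue_gram[of ?I "u i" "\<mu> i" ?I "adjoint (entries (A i))" k] U that by simp
  have T_props: "T \<in> carrier_mat d d" "\<And>a b. a < d \<Longrightarrow> b < d \<Longrightarrow> T $$ (a, b) = (\<Sum>i\<in>{1..m}. A i $$ (a, b))"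
    using mat_sum_carrier_index[of m A d, folded T_def] A by auto
  define N where "N = op_norm S"
  \<comment> \<open>The zero vector is an admissible test vector in every dimension, including
    \<open>d = 0\<close>.\<close>
  have N0: "0 \<le> N" unfolding N_def using vec_norm_le_op_norm(2)[OF Sc, of "\<lambda>_. 0"] by (simp add: sqnorm_def)
  have \<sigma>N: "\<sigma> k \<le> N" if "k < d" for k
  proof -
    have "sqnorm ?I (matvec ?I (entries S) (e k)) = sqnorm ?I (\<lambda>a. of_real (\<sigma> k) * e k a)"
      using matvec_eigensys[OF _ ES] that by (intro sqnorm_cong) auto
    also have "\<dots> = (\<sigma> k)\<^sup>2" using eigensys_sqnorm[OF ES] that by (simp add: sqnorm_scale)
    finally have "(\<sigma> k)\<^sup>2 \<le> N\<^sup>2"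
      using vec_norm_le_op_norm(1)[OF Sc, of "e k"] eigensys_sqnorm[OF ES, of k] that by (simp add: N_def)
    then show ?thesis using N0 by (rule power2_le_imp_le)
  qed
  have qN: "quadform ?I (entries S) v \<le> N" if "sqnorm ?I v \<le> 1" for v
  proof -
    have "quadform ?I (entries S) v \<le> (\<Sum>k<d. N * (cmod (cinner ?I v (e k)))\<^sup>2)"
      unfolding quadform_eigensys[OF ES] using \<sigma>N by (intro sum_mono mult_right_mono) auto
    also have "\<dots> = N * sqnorm ?I v" using parseval[OF _ ES, of v] by (simp add: sum_distrib_left[symmetric])
    also have "\<dots> \<le> N" using that N0 mult_left_mono[of "sqnorm ?I v" 1 N] by simp
    finally show ?thesis .
  qed
  \<comment> \<open>\<open>sqrt (\<mu> i k)\<close> is one of the nonnegative terms of the quadratic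
    form of \<open>S\<close> at the unit vector \<open>u i k\<close>.\<close>
  have \<mu>N: "sqrt (\<mu> i k) \<le> N" if i: "i \<in> {1..m}" and k: "k < d" for i k
  proof -
    have u1: "sqnorm ?I (u i k) = 1" using eigensys_sqnorm[OF U] k by simp
    have "sqrt (\<mu> i k) = sqrt (\<mu> i k) * (cmod (cinner ?I (u i k) (u i k)))\<^sup>2" by (simp add: cinner_self u1)
    also have "\<dots> \<le> (\<Sum>k'<d. sqrt (\<mu> i k') * (cmod (cinner ?I (u i k) (u i k')))\<^sup>2)"
      using k \<mu>0 by (intro member_le_sum) auto
    also have "\<dots> \<le> quadform ?I (entries S) (u i k)"
      unfolding S_quadform using i \<mu>0
      by (intro member_le_sum[of i "{1..m}" "\<lambda>i'. \<Sum>k'<d. sqrt (\<mu> i' k') * (cmod (cinner ?I (u i k) (u i' k')))\<^sup>2"] sum_nonneg) auto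
    also have "\<dots> \<le> N" using u1 by (intro qN) simp
    finally show ?thesis .
  qed
  show ?thesis unfolding S_def[symmetric] T_def[symmetric] N_def[symmetric]
  proof (rule op_norm_leI[OF T_props(1)])
    show "0 \<le> sqrt (real m) * N" using N0 by simp
    fix v assume v: "sqnorm ?I v \<le> 1"
    have "sqnorm ?I (matvec ?I (entries T) v) \<le> (\<Sum>a<d. real m * (\<Sum>i\<in>{1..m}. (cmod (matvec ?I (entries (A i)) v a))\<^sup>2))"
      unfolding sqnorm_def
    proof (rule sum_mono)
      fix a assume a: "a \<in> ?I"
      have "matvec ?I (entries T) v a = (\<Sum>b<d. \<Sum>i\<in>{1..m}. A i $$ (a, b) * v b)"
        using T_props a by (simp add: matvec_def sum_distrib_right)
      also have "\<dots> = (\<Sum>i\<in>{1..m}. matvec ?I (entries (A i)) v a)"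
        by (subst sum.swap) (simp add: matvec_def)
      finally have "(cmod (matvec ?I (entries T) v a))\<^sup>2 \<le> (\<Sum>i\<in>{1..m}. cmod (matvec ?I (entries (A i)) v a))\<^sup>2"
        by (simp add: norm_sum power_mono)
      also have "\<dots> \<le> real m * (\<Sum>i\<in>{1..m}. (cmod (matvec ?I (entries (A i)) v a))\<^sup>2)"
        using pos_powr_sum_le[of "{1..m}" "real m" 2 "\<lambda>i. cmod (matvec ?I (entries (A i)) v a)"] m
        by (simp add: pos_powr_of_nonneg sum_nonneg)
      finally show "(cmod (matvec ?I (entries T) v a))\<^sup>2 \<le> real m * (\<Sum>i\<in>{1..m}. (cmod (matvec ?I (entries (A i)) v a))\<^sup>2)" .
    qed
    also have "\<dots> = real m * (\<Sum>i\<in>{1..m}. sqnorm ?I (matvec ?I (entries (A i)) v))"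
      unfolding sum_distrib_left[symmetric] sqnorm_def by (subst sum.swap) simp
    also have "\<dots> = real m * (\<Sum>i\<in>{1..m}. \<Sum>k<d. \<mu> i k * (cmod (cinner ?I v (u i k)))\<^sup>2)"
      using quadform_eigensys[OF U, of _ v] by (simp add: quadform_gram')
    also have "\<dots> \<le> real m * (\<Sum>i\<in>{1..m}. \<Sum>k<d. N * (sqrt (\<mu> i k) * (cmod (cinner ?I v (u i k)))\<^sup>2))"
    proof (intro mult_left_mono sum_mono)
      fix i k assume ik: "i \<in> {1..m}" "k \<in> ?I"
      have "\<mu> i k = sqrt (\<mu> i k) * sqrt (\<mu> i k)" using \<mu>0 ik by simp
      also have "\<dots> \<le> N * sqrt (\<mu> i k)" using \<mu>N \<mu>0 ik by (intro mult_right_mono) auto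
      finally show "\<mu> i k * (cmod (cinner ?I v (u i k)))\<^sup>2 \<le> N * (sqrt (\<mu> i k) * (cmod (cinner ?I v (u i k)))\<^sup>2)"
        using mult_right_mono[of "\<mu> i k" "N * sqrt (\<mu> i k)" "(cmod (cinner ?I v (u i k)))\<^sup>2"] by (simp add: mult.assoc)
    qed simp
    also have "\<dots> = real m * (N * quadform ?I (entries S) v)"
      by (simp add: S_quadform sum_distrib_left[symmetric])
    also have "\<dots> \<le> real m * (N * N)"
      using qN[OF v] N0 by (intro mult_left_mono) auto
    also have "\<dots> = (sqrt (real m) * N)\<^sup>2" by (simp add: power2_eq_square[of N] power_mult_distrib)
    finally show "sqnorm ?I (matvec ?I (entries T) v) \<le> (sqrt (real m) * N)\<^sup>2" .
  qed
qed

section \<open>Optimality\<close>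

text \<open>\<open>M\<close> is \<open>\<alpha>\<close> times the identity plus
  \<open>\<beta>\<close> times the all-ones matrix, so its eigenvalues are \<open>\<alpha>\<close>
  and \<open>\<alpha> + n \<beta>\<close>. Instead of counting multiplicities, \<open>f\<close> is
  replaced by the affine function that agrees with it at these two points; its sum over the spectrum
  is fixed by the trace.\<close>

lemma sum_eigenvalues_scalar_plus_constant:
  fixes \<alpha> \<beta> :: real and f :: "real \<Rightarrow> real"
  assumes n: "1 \<le> n" and E: "eigensys {..<n} e l M"
    and M: "\<And>a b. a < n \<Longrightarrow> b < n \<Longrightarrow> M a b = of_real ((if a = b then \<alpha> else 0) + \<beta>)"
  shows "(\<Sum>k<n. f (l k)) = (real n - 1) * f \<alpha> + f (\<alpha> + real n * \<beta>)"
proof -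
  have l: "l k = \<alpha> \<or> l k = \<alpha> + real n * \<beta>" if k: "k < n" for k
  proof -
    \<comment> \<open>If the coordinate sum \<open>s\<close> vanishes, the eigenvalue equation
      itself gives \<open>l k = \<alpha>\<close>. Otherwise summing that equation over all
      coordinates and dividing by \<open>s\<close> gives the other value.\<close>
    define s where "s = (\<Sum>b<n. e k b)"
    have ev: "of_real (l k) * e k a = of_real \<alpha> * e k a + of_real \<beta> * s" if a: "a < n" for a
    proof -
      have "matvec {..<n} M (e k) a = (\<Sum>b<n. (if a = b then of_real \<alpha> * e k a else 0) + of_real \<beta> * e k b)"
        unfolding matvec_def using a by (intro sum.cong refl) (auto simp: M algebra_simps)
      also have "\<dots> = of_real \<alpha> * e k a + of_real \<beta> * s"
        using a by (simp add: sum.distrib s_def sum_distrib_left)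
      finally show ?thesis using matvec_eigensys[OF _ E, of k a] k a by simp
    qed
    show ?thesis
    proof (cases "s = 0")
      case True
      have "\<exists>a<n. e k a \<noteq> 0"
      proof (rule ccontr)
        assume "\<not> ?thesis"
        then have "sqnorm {..<n} (e k) = 0" by (simp add: sqnorm_def)
        then show False using eigensys_sqnorm[OF E, of k] k by simp
      qed
      then show ?thesis using ev True by auto
    next
      case False
      have "of_real (l k) * s = (\<Sum>a<n. of_real \<alpha> * e k a + of_real \<beta> * s)"
        unfolding s_def sum_distrib_left using ev by (intro sum.cong refl) (simp add: s_def sum_distrib_left)
      also have "\<dots> = of_real (\<alpha> + real n * \<beta>) * s"
        by (simp add: sum.distrib s_def sum_distrib_left[symmetric] algebra_simps)
      finally show ?thesis using False by (simp only: mult_cancel_right of_real_eq_iff simp_thms)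
    qed
  qed
  have "(\<Sum>a<n. M a a) = (\<Sum>a<n. \<Sum>k<n. of_real (l k) * (e k a * cnj (e k a)))"
    using E by (intro sum.cong refl) (simp add: eigensys_def mult.assoc)
  also have "\<dots> = (\<Sum>k<n. of_real (l k) * cinner {..<n} (e k) (e k))"
    by (subst sum.swap) (simp add: cinner_def sum_distrib_left)
  also have "\<dots> = of_real (\<Sum>k<n. l k)"
    using E by (simp add: eigensys_def orthonormal_def)
  finally have "of_real (\<Sum>k<n. l k) = (\<Sum>a<n. M a a)" by simp
  also have "\<dots> = of_real (real n * (\<alpha> + \<beta>))" by (simp add: M)
  finally have tr: "(\<Sum>k<n. l k) = real n * (\<alpha> + \<beta>)" using of_real_eq_iff by blast
  show ?thesis
  proof (cases "\<beta> = 0")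
    case True
    then have "(\<Sum>k<n. f (l k)) = (\<Sum>k<n. f \<alpha>)" using l by (intro sum.cong refl) auto
    then show ?thesis using True by (simp add: algebra_simps)
  next
    case False
    define c where "c = (f (\<alpha> + real n * \<beta>) - f \<alpha>) / (real n * \<beta>)"
    have c: "real n * \<beta> * c = f (\<alpha> + real n * \<beta>) - f \<alpha>" using False n by (simp add: c_def)
    have "(\<Sum>k<n. f (l k)) = (\<Sum>k<n. f \<alpha> + c * (l k - \<alpha>))"
    proof (rule sum.cong[OF refl])
      fix k assume "k \<in> {..<n}"
      then consider "l k = \<alpha>" | "l k = \<alpha> + real n * \<beta>" using l by blast
      then show "f (l k) = f \<alpha> + c * (l k - \<alpha>)"
        using c by cases (simp_all add: mult.commute)
    qed
    also have "\<dots> = real n * f \<alpha> + c * ((\<Sum>k<n. l k) - real n * \<alpha>)"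
      by (simp add: sum.distrib sum_distrib_left[symmetric] sum_subtractf)
    also have "\<dots> = real n * f \<alpha> + real n * \<beta> * c" by (simp add: tr algebra_simps)
    finally show ?thesis unfolding c by (simp add: algebra_simps)
  qed
qed

text \<open>
  The extremal family: \<open>A\<^sub>i = e\<^sub>0 v\<^sub>i\<^sup>*\<close> up to scaling, where the \<open>v\<^sub>i\<close> are the columns of the square root of
  the matrix with eigenvalue \<open>x\<close> on the constant vector and \<open>1\<close> on its complement.
\<close>

lemma extremal_family:
  fixes x :: real
  assumes m: "1 \<le> m" and x: "1 \<le> x"
  obtains A where "\<forall>i\<in>{1..m}. A i \<in> carrier_mat m m"
    "\<forall>i\<in>{1..m}. mat_abs (A i) \<in> carrier_mat m m"
    "\<And>c c'. c < m \<Longrightarrow> c' < m \<Longrightarrow> mat_sum m m A $$ (c, c') = (if c = 0 then of_real (sqrt (x * (x + real m - 1) / real m)) else 0)"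
    "\<And>c c'. c < m \<Longrightarrow> c' < m \<Longrightarrow> mat_sum m m (\<lambda>i. mat_abs (A i)) $$ (c, c') = of_real ((if c = c' then 1 else 0) + (x - 1) / real m)"
proof -
  define a where "a = (x + real m - 1) / real m"
  \<comment> \<open>\<open>v j\<close> is a column of the identity plus \<open>s\<close> times the
    all-ones matrix; \<open>m s = sqrt x - 1\<close> gives this matrix the eigenvalue
    \<open>sqrt x\<close> on the constant vector.\<close>
  define s where "s = (sqrt x - 1) / real m"
  have m0: "0 < real m" using m by simp
  have a0: "0 \<le> a" using x m by (simp add: a_def)
  define v :: "nat \<Rightarrow> nat \<Rightarrow> real" where "v j c = (if j = c then 1 else 0) + s" for j c
  have ms: "real m * s = sqrt x - 1" using m0 by (simp add: s_def)
  have v_sym: "v j c = v c j" for j c by (simp add: v_def)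
  have v_sum: "(\<Sum>j<m. v j c) = sqrt x" if "c < m" for c
  proof -
    have "(\<Sum>j<m. v j c) = 1 + real m * s" using that by (simp add: v_def sum.distrib)
    then show ?thesis by (simp add: ms)
  qed
  have v_gram: "(\<Sum>j<m. v j c * v j c') = (if c = c' then 1 else 0) + (x - 1) / real m" if "c < m" "c' < m" for c c'
  proof -
    have "(\<Sum>j<m. v j c * v j c') = (\<Sum>j<m. (if j = c then v c c' else 0) + s * v j c')"
      by (intro sum.cong refl) (simp add: v_def algebra_simps)
    also have "\<dots> = v c c' + s * sqrt x" using that by (simp add: sum.distrib v_sum flip: sum_distrib_left)
    also have "\<dots> = (if c = c' then 1 else 0) + (sqrt x - 1) * (sqrt x + 1) / real m"
      by (simp add: v_def s_def add_divide_distrib[symmetric] algebra_simps)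
    also have "(sqrt x - 1) * (sqrt x + 1) = x - 1" using x by (simp add: algebra_simps)
    finally show ?thesis .
  qed
  define A where "A i = mat m m (\<lambda>(c, c'). if c = 0 then complex_of_real (sqrt a * v (i - 1) c') else 0)" for i
  define P where "P i = mat m m (\<lambda>(c, c'). complex_of_real (v (i - 1) c * v (i - 1) c'))" for i
  have A: "A i \<in> carrier_mat m m" and P: "P i \<in> carrier_mat m m" for i by (simp_all add: A_def P_def)
  have abs: "mat_abs (A i) = P i" if i: "i \<in> {1..m}" for i
  proof -
    \<comment> \<open>Writing \<open>P i\<close> as a Gram matrix over a one-element index set makes
      its eigenvalues nonnegative by \<open>eigenvalue_gram\<close>.\<close>
    define B :: "nat \<Rightarrow> unit \<Rightarrow> complex" where "B c u = of_real (v (i - 1) c)" for c u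
    have PB: "P i $$ (c, c') = matmul {()} B (adjoint B) c c'" if "c < m" "c' < m" for c c'
      using that by (simp add: P_def matmul_def adjoint_def B_def)
    have "\<exists>e l. eigensys {..<m} e l (matmul {()} B (adjoint B))"
      by (intro hermitian_eigensys) (auto simp: matmul_def adjoint_def mult.commute)
    then obtain e l where E: "eigensys {..<m} e l (matmul {()} B (adjoint B))" by blast
    have "eigensys {..<m} e l (entries (P i))" using E by (subst eigensys_cong[OF PB]) auto
    moreover have "0 \<le> l k" if "k < m" for k
      using eigenvalue_gram[OF _ E, of k] that by simp
    moreover have "matmul {..<m} (adjoint (entries (A i))) (entries (A i)) c c' = matmul {..<m} (adjoint (entries (P i))) (entries (P i)) c c'"
      if c: "c < m" "c' < m" for c c'
    proof -
      have "matmul {..<m} (adjoint (entries (A i))) (entries (A i)) c c' =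
          (\<Sum>b<m. if b = 0 then of_real (sqrt a * v (i - 1) c) * of_real (sqrt a * v (i - 1) c') else 0)"
        unfolding matmul_def adjoint_def using c by (intro sum.cong refl) (auto simp: A_def)
      also have "\<dots> = of_real (sqrt a * v (i - 1) c) * of_real (sqrt a * v (i - 1) c')"
        using m by simp
      also have "\<dots> = of_real ((sqrt a * sqrt a) * (v (i - 1) c * v (i - 1) c'))"
        by (simp only: of_real_mult mult_ac)
      also have "sqrt a * sqrt a = (\<Sum>b<m. v b (i - 1) * v b (i - 1))"
      proof -
        have "i - 1 < m" using i m by auto
        then show ?thesis using v_gram[of "i - 1" "i - 1"] a0 m0 by (simp add: a_def field_simps)
      qed
      also have "of_real (\<dots> * (v (i - 1) c * v (i - 1) c')) = matmul {..<m} (adjoint (entries (P i))) (entries (P i)) c c'"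
        unfolding matmul_def adjoint_def of_real_mult of_real_sum sum_distrib_right using c
        by (intro sum.cong refl) (simp add: P_def v_sym mult_ac)
      finally show ?thesis .
    qed
    ultimately show ?thesis by (intro mat_abs_eqI[OF A P])
  qed
  have shift: "(\<Sum>i\<in>{1..m}. g (i - 1)) = (\<Sum>j<m. g j)" for g :: "nat \<Rightarrow> complex"
    using sum_bounds_lt_plus1[of "\<lambda>i. g (i - 1)" m] by simp
  show thesis
  proof (rule that)
    show "\<forall>i\<in>{1..m}. A i \<in> carrier_mat m m" using A by simp
    then show "mat_sum m m A $$ (c, c') = (if c = 0 then of_real (sqrt (x * (x + real m - 1) / real m)) else 0)"
      if "c < m" "c' < m" for c c'
    proof -
      have "mat_sum m m A $$ (c, c') = (\<Sum>i\<in>{1..m}. A i $$ (c, c'))"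
        using mat_sum_carrier_index[of m A m] A that by blast
      also have "\<dots> = (if c = 0 then \<Sum>i\<in>{1..m}. of_real (sqrt a * v (i - 1) c') else 0)"
        using that by (simp add: A_def)
      also have "(\<Sum>i\<in>{1..m}. complex_of_real (sqrt a * v (i - 1) c')) = (\<Sum>j<m. of_real (sqrt a * v j c'))"
        by (rule shift)
      also have "\<dots> = of_real (sqrt a * sqrt x)"
        unfolding of_real_sum[symmetric] sum_distrib_left[symmetric] using v_sum that by simp
      also have "sqrt a * sqrt x = sqrt (x * (x + real m - 1) / real m)"
        by (simp add: a_def real_sqrt_mult[symmetric] mult.commute)
      finally show ?thesis .
    qed
    show Pc: "\<forall>i\<in>{1..m}. mat_abs (A i) \<in> carrier_mat m m" using abs P by simp
    show "mat_sum m m (\<lambda>i. mat_abs (A i)) $$ (c, c') = of_real ((if c = c' then 1 else 0) + (x - 1) / real m)"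
      if "c < m" "c' < m" for c c'
    proof -
      have "mat_sum m m (\<lambda>i. mat_abs (A i)) $$ (c, c') = (\<Sum>i\<in>{1..m}. mat_abs (A i) $$ (c, c'))"
        using mat_sum_carrier_index[of m "\<lambda>i. mat_abs (A i)" m] Pc that by blast
      also have "\<dots> = (\<Sum>i\<in>{1..m}. of_real (v (i - 1) c * v (i - 1) c'))"
        using that abs by (intro sum.cong refl) (simp add: P_def)
      also have "\<dots> = (\<Sum>j<m. of_real (v j c * v j c'))"
        by (rule shift)
      also have "\<dots> = of_real ((if c = c' then 1 else 0) + (x - 1) / real m)"
        unfolding of_real_sum[symmetric] v_gram[OF that] ..
      finally show ?thesis .
    qed
  qed
qed

text \<open>The conditional with equal branches is the diagonal part, with
  \<open>\<alpha> = 0\<close>, of the shape that \<open>sum_eigenvalues_scalar_plus_constant\<close>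
  expects.\<close>

lemma matmul_adjoint_first_row:
  assumes m: "1 \<le> m" and t: "0 \<le> t"
    and T: "\<And>c c'. c < m \<Longrightarrow> c' < m \<Longrightarrow> T $$ (c, c') = (if c = 0 then complex_of_real (sqrt t) else 0)"
    and c: "c < m" "c' < m"
  shows "matmul {..<m} (adjoint (entries T)) (entries T) c c' = of_real ((if c = c' then 0 else 0) + t)"
proof -
  have "matmul {..<m} (adjoint (entries T)) (entries T) c c' = (\<Sum>b<m. if b = 0 then of_real (sqrt t) * of_real (sqrt t) else 0)"
    unfolding matmul_def adjoint_def using c T by (intro sum.cong refl) auto
  also have "\<dots> = of_real t" using m t by (simp flip: of_real_mult)
  finally show ?thesis by simp
qed

text \<open>The extremal family in dimension \<open>m\<close> at \<open>x = x_sol q m\<close>: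
  \<open>T\<close> has the single nonzero singular value \<open>sqrt (x (x + m - 1))\<close>, and
  \<open>S\<close> has the eigenvalue \<open>x\<close> once and \<open>1\<close> otherwise, so the
  ratio of the norms is exactly \<open>C_const\<close>.\<close>

theorem C_const_optimal_finite:
  fixes q :: real
  assumes m: "1 \<le> m" and q: "2 \<le> q"
    and C: "\<And>d A. (\<forall>i\<in>{1..m}. A i \<in> carrier_mat d d) \<Longrightarrow>
      schatten_norm (ereal q) (mat_sum d m A) \<le> C * schatten_norm (ereal q) (mat_sum d m (\<lambda>i. mat_abs (A i)))"
  shows "C_const (ereal q) m \<le> C"
proof -
  define x where "x = x_sol q m"
  have "1 < x \<and> x powr q = 2 * x + real m - 1"
    unfolding x_def x_sol_def
    using theI'[OF ex1_x_sol[of q "real m - 1"]] m q by (simp add: algebra_simps)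
  then have x: "1 < x" by simp
  obtain A where A: "\<forall>i\<in>{1..m}. A i \<in> carrier_mat m m"
    and absA: "\<forall>i\<in>{1..m}. mat_abs (A i) \<in> carrier_mat m m"
    and T: "\<And>c c'. c < m \<Longrightarrow> c' < m \<Longrightarrow> mat_sum m m A $$ (c, c') = (if c = 0 then of_real (sqrt (x * (x + real m - 1) / real m)) else 0)"
    and S: "\<And>c c'. c < m \<Longrightarrow> c' < m \<Longrightarrow> mat_sum m m (\<lambda>i. mat_abs (A i)) $$ (c, c') = of_real ((if c = c' then 1 else 0) + (x - 1) / real m)"
    by (rule extremal_family[OF m less_imp_le[OF x]]) blast
  define Tm where "Tm = mat_sum m m A"
  define Sm where "Sm = mat_sum m m (\<lambda>i. mat_abs (A i))"
  have Tc: "Tm \<in> carrier_mat m m" using mat_sum_carrier_index[OF A] by (simp add: Tm_def)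
  have Sc: "Sm \<in> carrier_mat m m" using mat_sum_carrier_index[OF absA] by (simp add: Sm_def)
  define t where "t = x * (x + real m - 1) / real m"
  have t: "0 \<le> t" "real m * t = x * (x + real m - 1)" using x m by (auto simp: t_def)
  have "\<exists>e l. eigensys {..<m} e l (matmul {..<m} (adjoint (entries Tm)) (entries Tm))"
    by (intro hermitian_eigensys) (auto simp: matmul_def adjoint_def mult.commute)
  then obtain e \<tau> where ET: "eigensys {..<m} e \<tau> (matmul {..<m} (adjoint (entries Tm)) (entries Tm))" by blast
  have "(\<Sum>k<m. \<tau> k powr (q / 2)) = (real m - 1) * 0 powr (q / 2) + (0 + real m * t) powr (q / 2)"
    using matmul_adjoint_first_row[OF m t(1), of Tm] T
    by (intro sum_eigenvalues_scalar_plus_constant[OF m ET]) (auto simp: Tm_def t_def)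
  then have "schatten_norm (ereal q) Tm = ((x * (x + real m - 1)) powr (q / 2)) powr (1 / q)"
    using schatten_norm_eq[OF Tc ET, of q] by (simp add: t)
  also have "\<dots> = sqrt (x * (x + real m - 1))"
    using x m q by (simp add: powr_powr flip: powr_half_sqrt)
  finally have nT: "schatten_norm (ereal q) Tm = sqrt (x * (x + real m - 1))" .
  have S': "Sm $$ (c, c') = of_real ((if c = c' then 1 else 0) + (x - 1) / real m)" if "c < m" "c' < m" for c c'
    using S[OF that] by (simp add: Sm_def)
  have "\<exists>e l. eigensys {..<m} e l (entries Sm)"
    by (intro hermitian_eigensys) (auto simp: S')
  then obtain f \<sigma> where ES: "eigensys {..<m} f \<sigma> (entries Sm)" by blast
  \<comment> \<open>Positivity of the spectrum of \<open>S\<close> is read off the same eigenvalue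
    formula, applied to \<open>min t 0\<close>, which vanishes at both \<open>1\<close> and
    \<open>x\<close>.\<close>
  have "(\<Sum>k<m. min (\<sigma> k) 0) = (real m - 1) * min 1 0 + min (1 + real m * ((x - 1) / real m)) 0"
    by (rule sum_eigenvalues_scalar_plus_constant[OF m ES S'])
  also have "\<dots> = 0" using x m by simp
  finally have "(\<Sum>k<m. - min (\<sigma> k) 0) = 0" by (simp add: sum_negf)
  then have "\<forall>k\<in>{..<m}. - min (\<sigma> k) 0 = 0" by (subst (asm) sum_nonneg_eq_0_iff) auto
  then have "min (\<sigma> k) 0 = 0" if "k < m" for k using that by simp
  then have \<sigma>: "0 \<le> \<sigma> k" if "k < m" for k using that by (metis min.cobounded1)
  have "(\<Sum>k<m. \<sigma> k powr q) = (real m - 1) * 1 powr q + (1 + real m * ((x - 1) / real m)) powr q"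
    by (rule sum_eigenvalues_scalar_plus_constant[OF m ES S'])
  then have nS: "schatten_norm (ereal q) Sm = (x powr q + real m - 1) powr (1 / q)"
    using schatten_norm_psd[OF Sc ES \<sigma>, of q] m by (simp add: add.commute add_diff_eq)
  have "0 < x powr q + real m - 1" using x m by (simp add: add_pos_nonneg add_diff_eq[symmetric])
  then have "sqrt (x * (x + real m - 1)) / (x powr q + real m - 1) powr (1 / q) \<le> C"
    using C[OF A, folded Tm_def Sm_def] unfolding nT nS by (simp add: pos_divide_le_eq)
  then show ?thesis by (simp add: C_const_def Let_def x_def)
qed

text \<open>The member \<open>x = 1\<close> of the extremal family: \<open>S\<close> is the
  identity, and \<open>T\<close> has ones in its first row and zeros elsewhere, so its norm
  \<open>sqrt m\<close> is attained at the constant unit vector \<open>w\<close>.\<close>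

theorem C_const_optimal_infinite:
  assumes m: "1 \<le> m"
    and C: "\<And>d A. (\<forall>i\<in>{1..m}. A i \<in> carrier_mat d d) \<Longrightarrow>
      op_norm (mat_sum d m A) \<le> C * op_norm (mat_sum d m (\<lambda>i. mat_abs (A i)))"
  shows "sqrt (real m) \<le> C"
proof -
  obtain A where A: "\<forall>i\<in>{1..m}. A i \<in> carrier_mat m m"
    and absA: "\<forall>i\<in>{1..m}. mat_abs (A i) \<in> carrier_mat m m"
    and T0: "\<And>c c'. c < m \<Longrightarrow> c' < m \<Longrightarrow> mat_sum m m A $$ (c, c') = (if c = 0 then of_real (sqrt (1 * (1 + real m - 1) / real m)) else 0)"
    and S0: "\<And>c c'. c < m \<Longrightarrow> c' < m \<Longrightarrow> mat_sum m m (\<lambda>i. mat_abs (A i)) $$ (c, c') = of_real ((if c = c' then 1 else 0) + (1 - 1) / real m)"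
    by (rule extremal_family[OF m order_refl]) blast
  define Tm where "Tm = mat_sum m m A"
  define Sm where "Sm = mat_sum m m (\<lambda>i. mat_abs (A i))"
  have Tc: "Tm \<in> carrier_mat m m" using mat_sum_carrier_index[OF A] by (simp add: Tm_def)
  have Sc: "Sm \<in> carrier_mat m m" using mat_sum_carrier_index[OF absA] by (simp add: Sm_def)
  have T: "Tm $$ (c, c') = (if c = 0 then 1 else 0)" if "c < m" "c' < m" for c c'
    unfolding Tm_def T0[OF that] using m by simp
  have S: "Sm $$ (c, c') = (if c = c' then 1 else 0)" if "c < m" "c' < m" for c c'
    unfolding Sm_def S0[OF that] by simp
  have S_matvec: "matvec {..<m} (entries Sm) v c = v c" if "c < m" for v c
  proof -
    have "matvec {..<m} (entries Sm) v c = (\<Sum>b<m. if b = c then v c else 0)"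
      unfolding matvec_def using that S by (intro sum.cong refl) auto
    then show ?thesis using that by simp
  qed
  have S_le: "op_norm Sm \<le> 1"
    using S_matvec by (intro op_norm_leI[OF Sc]) (auto simp: sqnorm_def)
  define w :: "nat \<Rightarrow> complex" where "w c = of_real (1 / sqrt (real m))" for c
  have w: "sqnorm {..<m} w = 1" using m by (simp add: sqnorm_def w_def norm_divide power_divide)
  have "matvec {..<m} (entries Tm) w 0 = of_real (sqrt (real m))"
  proof -
    have "matvec {..<m} (entries Tm) w 0 = (\<Sum>b<m. of_real (1 / sqrt (real m)))"
      unfolding matvec_def using T m by (intro sum.cong refl) (auto simp: w_def)
    also have "\<dots> = of_real (real m / sqrt (real m))" by simp
    finally show ?thesis by (simp only: real_div_sqrt of_nat_0_le_iff)
  qed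
  then have "real m \<le> sqnorm {..<m} (matvec {..<m} (entries Tm) w)"
    unfolding sqnorm_def using m member_le_sum[of 0 "{..<m}" "\<lambda>c. (cmod (matvec {..<m} (entries Tm) w c))\<^sup>2"] by simp
  also have "\<dots> \<le> (op_norm Tm)\<^sup>2" using vec_norm_le_op_norm(1)[OF Tc] w by simp
  finally have "sqrt (real m) \<le> op_norm Tm"
    using vec_norm_le_op_norm(2)[OF Tc, of w] w by (simp add: real_le_lsqrt)
  also have le: "op_norm Tm \<le> C * op_norm Sm" using C[OF A] by (simp add: Tm_def Sm_def)
  finally have mC: "sqrt (real m) \<le> C * op_norm Sm" .
  have S_nonneg: "0 \<le> op_norm Sm" using vec_norm_le_op_norm(2)[OF Sc, of w] w by simp
  \<comment> \<open>The norm of \<open>S\<close> enters only through the bound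
    \<open>op_norm Sm \<le> 1\<close>, so the sign of \<open>C\<close> is settled before multiplying
    this bound by \<open>C\<close>.\<close>
  have "0 < C * op_norm Sm" using mC m by (intro less_le_trans[OF _ mC]) simp
  then have "0 \<le> C" using S_nonneg by (simp add: zero_less_mult_iff)
  then have "C * op_norm Sm \<le> C * 1" using S_le by (rule mult_left_mono[rotated])
  with mC show ?thesis by simp
qed

theorem theorem1p1:
  fixes m :: nat and p :: ereal
  assumes "1 \<le> m" and "2 \<le> p"
  shows "(p \<noteq> \<infinity> \<longrightarrow> (\<exists>!x::real. 1 < x \<and> x powr real_of_ereal p = 2 * x + real m - 1)) \<and>
    (\<forall>d A. (\<forall>i\<in>{1..m}. A i \<in> carrier_mat d d) \<longrightarrow>
       schatten_norm p (mat_sum d m A)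
         \<le> C_const p m * schatten_norm p (mat_sum d m (\<lambda>i. mat_abs (A i)))) \<and>
    (\<forall>C::real.
       (\<forall>d A. (\<forall>i\<in>{1..m}. A i \<in> carrier_mat d d) \<longrightarrow>
          schatten_norm p (mat_sum d m A)
            \<le> C * schatten_norm p (mat_sum d m (\<lambda>i. mat_abs (A i)))) \<longrightarrow>
       C_const p m \<le> C)"
proof (cases p)
  case (real q)
  then have q: "2 \<le> q" using assms(2) by simp
  show ?thesis unfolding real
  proof (intro conjI impI allI)
    show "\<exists>!x::real. 1 < x \<and> x powr real_of_ereal (ereal q) = 2 * x + real m - 1"
      using ex1_x_sol[OF q, of "real m - 1"] assms(1) by (simp add: add_diff_eq)
  next
    fix d and A :: "nat \<Rightarrow> complex mat"
    assume "\<forall>i\<in>{1..m}. A i \<in> carrier_mat d d"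
    then show "schatten_norm (ereal q) (mat_sum d m A)
        \<le> C_const (ereal q) m * schatten_norm (ereal q) (mat_sum d m (\<lambda>i. mat_abs (A i)))"
      by (intro schatten_norm_sum_le assms(1) q) blast
  next
    fix C
    assume "\<forall>d A. (\<forall>i\<in>{1..m}. A i \<in> carrier_mat d d) \<longrightarrow>
          schatten_norm (ereal q) (mat_sum d m A)
            \<le> C * schatten_norm (ereal q) (mat_sum d m (\<lambda>i. mat_abs (A i)))"
    then show "C_const (ereal q) m \<le> C"
      by (intro C_const_optimal_finite assms(1) q) blast
  qed
next
  case PInf
  show ?thesis unfolding PInf schatten_norm_def C_const_def if_P[OF refl]
  proof (intro conjI impI allI)
    fix d and A :: "nat \<Rightarrow> complex mat"
    assume "\<forall>i\<in>{1..m}. A i \<in> carrier_mat d d"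
    then show "op_norm (mat_sum d m A) \<le> sqrt (real m) * op_norm (mat_sum d m (\<lambda>i. mat_abs (A i)))"
      by (intro op_norm_sum_le assms(1)) blast
  next
    fix C
    assume "\<forall>d A. (\<forall>i\<in>{1..m}. A i \<in> carrier_mat d d) \<longrightarrow>
          op_norm (mat_sum d m A) \<le> C * op_norm (mat_sum d m (\<lambda>i. mat_abs (A i)))"
    then show "sqrt (real m) \<le> C"
      by (intro C_const_optimal_infinite assms(1)) blast
  qed simp
next
  case MInf
  then show ?thesis using assms(2) by simp
qed

end
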